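(* (Working in $\mathsf{ZF}$.) Let $n>0$ be a natural number. If $\delta$ is a Berkeley cardinal, then unboundedly many cardinals below $\delta$ are parametrically $n$-ultraexact for some sequence of cardinals below $\delta$.
   Context: An ordinal $\delta$ is a Berkeley cardinal if for every transitive set $M$ with $\delta\in M$ and every $\eta<\delta$ there is a non-trivial elementary embedding $j\colon M\to M$ with $\eta<\mathrm{crit}(j)<\delta$. $C^{(n)}$ denotes the class of cardinals $\nu$ with $V_\nu\prec_{\Sigma_n}V$. For $n>0$ and a limit cardinal $\lambda$: given a cardinal $\eta\in C^{(n)}$ with $\eta>\lambda$, an elementary submodel $X\prec V_\eta$ with $V_\lambda\cup\{\lambda\}\subseteq X$, and a cardinal $\zeta\in C^{(n+1)}$ with $\zeta>\lambda$, an elementary embedding $k\colon X\to V_\zeta$ is an $n$-ultraexact embedding at $\lambda$ if $k(\lambda)=\lambda$, $k\restriction\lambda\neq\mathrm{id}_\lambda$ and $k\restriction V_\lambda\in X$. Given a strictly increasing sequence $\vec\mu=\langle\mu_m:m<\omega\rangle$ of cardinals with supremum $\lambda$, a cardinal $\kappa<\mu_0$ is parametrically $n$-ultraexact for $\vec\mu$ if for every $A\in V_{\lambda+1}$ there is an $n$-ultraexact embedding $k\colon X\to V_\zeta$ at $\lambda$ with $A\in\mathrm{ran}(k)$, $k(\kappa)=\mu_0$, $k(\mu_m)=\mu_{m+1}$ for all $m<\omega$, and $k(\mathrm{crit}(k))=\kappa$. *)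

theory Defs
  imports Main
begin

section \<open>First-order models of ZF\<close>

text \<open>
  HOL itself has a choice operator, so a universe of sets in which separation and replacement hold
  for arbitrary HOL predicates would satisfy the axiom of choice, and would contain no
  Berkeley cardinals. Therefore ZF is treated as a first-order theory: the axiom schemas
  range over syntactic formulas only, and a theorem of ZF is a statement that holds in every
  structure \<open>(UNIV, E)\<close> satisfying the axioms.
\<close>

datatype fm =
    FMem nat nat
  | FEq nat nat
  | FNeg fm
  | FAnd fm fm
  | FEx nat fm

primrec sat :: "('a \<Rightarrow> 'a \<Rightarrow> bool) \<Rightarrow> (nat \<Rightarrow> 'a) \<Rightarrow> fm \<Rightarrow> bool" where
  "sat E s (FMem i j) \<longleftrightarrow> E (s i) (s j)"
| "sat E s (FEq i j) \<longleftrightarrow> s i = s j"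
| "sat E s (FNeg p) \<longleftrightarrow> \<not> sat E s p"
| "sat E s (FAnd p q) \<longleftrightarrow> sat E s p \<and> sat E s q"
| "sat E s (FEx i p) \<longleftrightarrow> (\<exists>x. sat E (s(i := x)) p)"

locale set_structure =
  fixes E :: "'a \<Rightarrow> 'a \<Rightarrow> bool"  (infix "\<epsilon>" 50)

locale zf_model = set_structure E for E :: "'a \<Rightarrow> 'a \<Rightarrow> bool"  (infix "\<epsilon>" 50) +
  assumes extensionality: "(\<forall>z. z \<epsilon> x \<longleftrightarrow> z \<epsilon> y) \<Longrightarrow> x = y"
    and foundation: "y \<epsilon> x \<Longrightarrow> \<exists>y. y \<epsilon> x \<and> \<not> (\<exists>z. z \<epsilon> y \<and> z \<epsilon> x)"
    and pairing: "\<exists>p. \<forall>z. z \<epsilon> p \<longleftrightarrow> z = x \<or> z = y"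
    and union: "\<exists>u. \<forall>z. z \<epsilon> u \<longleftrightarrow> (\<exists>y. y \<epsilon> x \<and> z \<epsilon> y)"
    and powerset: "\<exists>p. \<forall>z. z \<epsilon> p \<longleftrightarrow> (\<forall>w. w \<epsilon> z \<longrightarrow> w \<epsilon> x)"
    and infinity: "\<exists>x. (\<exists>e. e \<epsilon> x \<and> (\<forall>y. \<not> y \<epsilon> e)) \<and>
          (\<forall>y. y \<epsilon> x \<longrightarrow> (\<exists>s. s \<epsilon> x \<and> (\<forall>w. w \<epsilon> s \<longleftrightarrow> w \<epsilon> y \<or> w = y)))"
    and separation: "\<exists>y. \<forall>z. z \<epsilon> y \<longleftrightarrow> z \<epsilon> x \<and> sat (\<epsilon>) (s(0 := z)) p"
    and replacement: "(\<forall>u. u \<epsilon> x \<longrightarrow> (\<exists>!v. sat (\<epsilon>) (s(0 := u, 1 := v)) p)) \<Longrightarrow>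
          \<exists>y. \<forall>v. v \<epsilon> y \<longleftrightarrow> (\<exists>u. u \<epsilon> x \<and> sat (\<epsilon>) (s(0 := u, 1 := v)) p)"

section \<open>Set theory inside a structure\<close>

text \<open>
  All notions below are evaluated inside the structure: quantifiers range over its elements,
  and functions, formulas, assignments and natural numbers are elements of it.
\<close>

context set_structure
begin

text \<open>The definite descriptions are meaningful whenever the set (or value) in question exists;
  in models of ZF this is the case for all uses below.\<close>

definition coll :: "('a \<Rightarrow> bool) \<Rightarrow> 'a" where
  "coll P = (THE x. \<forall>y. y \<epsilon> x \<longleftrightarrow> P y)"

definition subset :: "'a \<Rightarrow> 'a \<Rightarrow> bool" where
  "subset x y \<longleftrightarrow> (\<forall>z. z \<epsilon> x \<longrightarrow> z \<epsilon> y)"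

definition transitive :: "'a \<Rightarrow> bool" where
  "transitive x \<longleftrightarrow> (\<forall>y. y \<epsilon> x \<longrightarrow> subset y x)"

definition ordinal :: "'a \<Rightarrow> bool" where
  "ordinal x \<longleftrightarrow> transitive x \<and> (\<forall>y. y \<epsilon> x \<longrightarrow> transitive y)"

definition empty :: 'a where
  "empty = coll (\<lambda>_. False)"

definition succ :: "'a \<Rightarrow> 'a" where
  "succ x = coll (\<lambda>y. y \<epsilon> x \<or> y = x)"

definition omega :: 'a where
  "omega = coll (\<lambda>m. \<forall>I. empty \<epsilon> I \<and> (\<forall>x. x \<epsilon> I \<longrightarrow> succ x \<epsilon> I) \<longrightarrow> m \<epsilon> I)"

definition upair :: "'a \<Rightarrow> 'a \<Rightarrow> 'a" where
  "upair x y = coll (\<lambda>z. z = x \<or> z = y)"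

definition opair :: "'a \<Rightarrow> 'a \<Rightarrow> 'a" where
  "opair x y = upair (upair x x) (upair x y)"

definition app :: "'a \<Rightarrow> 'a \<Rightarrow> 'a" where
  "app f x = (THE y. opair x y \<epsilon> f)"

definition function_on :: "'a \<Rightarrow> 'a \<Rightarrow> bool" where
  "function_on f A \<longleftrightarrow>
     (\<forall>p. p \<epsilon> f \<longrightarrow> (\<exists>x y. x \<epsilon> A \<and> p = opair x y)) \<and>
     (\<forall>x. x \<epsilon> A \<longrightarrow> (\<exists>!y. opair x y \<epsilon> f))"

definition maps :: "'a \<Rightarrow> 'a \<Rightarrow> 'a \<Rightarrow> bool" where
  "maps f A B \<longleftrightarrow> function_on f A \<and> (\<forall>x. x \<epsilon> A \<longrightarrow> app f x \<epsilon> B)"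

definition lam :: "'a \<Rightarrow> ('a \<Rightarrow> 'a) \<Rightarrow> 'a" where
  "lam A F = coll (\<lambda>p. \<exists>x. x \<epsilon> A \<and> p = opair x (F x))"

definition restriction :: "'a \<Rightarrow> 'a \<Rightarrow> 'a" where
  "restriction f A = coll (\<lambda>p. p \<epsilon> f \<and> (\<exists>x y. x \<epsilon> A \<and> p = opair x y))"

definition bijection :: "'a \<Rightarrow> 'a \<Rightarrow> 'a \<Rightarrow> bool" where
  "bijection f A B \<longleftrightarrow> maps f A B \<and>
     (\<forall>x y. x \<epsilon> A \<and> y \<epsilon> A \<and> app f x = app f y \<longrightarrow> x = y) \<and>
     (\<forall>z. z \<epsilon> B \<longrightarrow> (\<exists>x. x \<epsilon> A \<and> app f x = z))"

definition cardinal :: "'a \<Rightarrow> bool" where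
  "cardinal k \<longleftrightarrow> ordinal k \<and> (\<forall>a. a \<epsilon> k \<longrightarrow> \<not> (\<exists>f. bijection f a k))"

definition limit_cardinal :: "'a \<Rightarrow> bool" where
  "limit_cardinal l \<longleftrightarrow> cardinal l \<and> l \<noteq> empty \<and>
     (\<forall>a. a \<epsilon> l \<longrightarrow> (\<exists>k. cardinal k \<and> a \<epsilon> k \<and> k \<epsilon> l))"

definition rank_hierarchy :: "'a \<Rightarrow> 'a \<Rightarrow> bool" where
  "rank_hierarchy a f \<longleftrightarrow> function_on f (succ a) \<and>
     (\<forall>b. b \<epsilon> succ a \<longrightarrow> app f b = coll (\<lambda>x. \<exists>c. c \<epsilon> b \<and> subset x (app f c)))"

definition Vset :: "'a \<Rightarrow> 'a" where
  "Vset a = (THE v. \<exists>f. rank_hierarchy a f \<and> app f a = v)"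

section \<open>Codes of formulas and satisfaction inside a structure\<close>

primrec num :: "nat \<Rightarrow> 'a" where
  "num 0 = empty"
| "num (Suc m) = succ (num m)"

definition cMem :: "'a \<Rightarrow> 'a \<Rightarrow> 'a" where
  "cMem i j = opair (num 0) (opair i j)"

definition cEq :: "'a \<Rightarrow> 'a \<Rightarrow> 'a" where
  "cEq i j = opair (num 1) (opair i j)"

definition cNeg :: "'a \<Rightarrow> 'a" where
  "cNeg p = opair (num 2) p"

definition cAnd :: "'a \<Rightarrow> 'a \<Rightarrow> 'a" where
  "cAnd p q = opair (num 3) (opair p q)"

definition cEx :: "'a \<Rightarrow> 'a \<Rightarrow> 'a" where
  "cEx i p = opair (num 4) (opair i p)"

definition cAll :: "'a \<Rightarrow> 'a \<Rightarrow> 'a" where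
  "cAll i p = cNeg (cEx i (cNeg p))"

definition is_fm :: "'a \<Rightarrow> bool" where
  "is_fm p \<longleftrightarrow> (\<forall>F.
     (\<forall>i j. i \<epsilon> omega \<and> j \<epsilon> omega \<longrightarrow> cMem i j \<epsilon> F \<and> cEq i j \<epsilon> F) \<and>
     (\<forall>q. q \<epsilon> F \<longrightarrow> cNeg q \<epsilon> F) \<and>
     (\<forall>q r. q \<epsilon> F \<and> r \<epsilon> F \<longrightarrow> cAnd q r \<epsilon> F) \<and>
     (\<forall>i q. i \<epsilon> omega \<and> q \<epsilon> F \<longrightarrow> cEx i q \<epsilon> F)
     \<longrightarrow> p \<epsilon> F)"

definition is_delta0 :: "'a \<Rightarrow> bool" where
  "is_delta0 p \<longleftrightarrow> (\<forall>F.
     (\<forall>i j. i \<epsilon> omega \<and> j \<epsilon> omega \<longrightarrow> cMem i j \<epsilon> F \<and> cEq i j \<epsilon> F) \<and>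
     (\<forall>q. q \<epsilon> F \<longrightarrow> cNeg q \<epsilon> F) \<and>
     (\<forall>q r. q \<epsilon> F \<and> r \<epsilon> F \<longrightarrow> cAnd q r \<epsilon> F) \<and>
     (\<forall>i j q. i \<epsilon> omega \<and> j \<epsilon> omega \<and> i \<noteq> j \<and> q \<epsilon> F \<longrightarrow> cEx i (cAnd (cMem i j) q) \<epsilon> F)
     \<longrightarrow> p \<epsilon> F)"

definition upd :: "'a \<Rightarrow> 'a \<Rightarrow> 'a \<Rightarrow> 'a" where
  "upd a i x = lam omega (\<lambda>k. if k = i then x else app a k)"

text \<open>An assignment in \<open>M\<close> is a function \<open>a\<close> with \<open>maps a omega M\<close>.\<close>

definition satisfaction_rel :: "'a \<Rightarrow> 'a \<Rightarrow> bool" where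
  "satisfaction_rel M S \<longleftrightarrow> (\<forall>a. maps a omega M \<longrightarrow>
     (\<forall>i j. i \<epsilon> omega \<and> j \<epsilon> omega \<longrightarrow>
        (opair (cMem i j) a \<epsilon> S \<longleftrightarrow> app a i \<epsilon> app a j) \<and>
        (opair (cEq i j) a \<epsilon> S \<longleftrightarrow> app a i = app a j)) \<and>
     (\<forall>p. is_fm p \<longrightarrow>
        (opair (cNeg p) a \<epsilon> S \<longleftrightarrow> \<not> opair p a \<epsilon> S)) \<and>
     (\<forall>p q. is_fm p \<and> is_fm q \<longrightarrow>
        (opair (cAnd p q) a \<epsilon> S \<longleftrightarrow> opair p a \<epsilon> S \<and> opair q a \<epsilon> S)) \<and>
     (\<forall>i p. i \<epsilon> omega \<and> is_fm p \<longrightarrow>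
        (opair (cEx i p) a \<epsilon> S \<longleftrightarrow> (\<exists>x. x \<epsilon> M \<and> opair p (upd a i x) \<epsilon> S))))"

definition satisfies :: "'a \<Rightarrow> 'a \<Rightarrow> 'a \<Rightarrow> bool" where
  "satisfies M p a \<longleftrightarrow> (\<exists>S. satisfaction_rel M S \<and> opair p a \<epsilon> S)"

section \<open>The Levy hierarchy and elementarity\<close>

text \<open>One quantifier per alternation; for \<open>n > 0\<close>, \<open>\<Sigma>\<^sub>n\<close>-elementarity of \<open>V\<^sub>\<nu>\<close> in \<open>V\<close> is
  unaffected by allowing blocks of quantifiers, which can be contracted by pairing.\<close>

fun is_sigma :: "nat \<Rightarrow> 'a \<Rightarrow> bool" and is_pi :: "nat \<Rightarrow> 'a \<Rightarrow> bool" where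
  "is_sigma 0 p \<longleftrightarrow> is_delta0 p"
| "is_sigma (Suc n) p \<longleftrightarrow> (\<exists>i q. i \<epsilon> omega \<and> is_pi n q \<and> p = cEx i q)"
| "is_pi 0 p \<longleftrightarrow> is_delta0 p"
| "is_pi (Suc n) p \<longleftrightarrow> (\<exists>i q. i \<epsilon> omega \<and> is_sigma n q \<and> p = cAll i q)"

text \<open>Truth in the whole universe, definable for each fixed level of the hierarchy:
  \<open>\<Delta>\<^sub>0\<close> truth is truth in some (equivalently, every) transitive set containing the parameters.\<close>

definition delta0_true :: "'a \<Rightarrow> 'a \<Rightarrow> bool" where
  "delta0_true p a \<longleftrightarrow> (\<exists>T. transitive T \<and> maps a omega T \<and> satisfies T p a)"

fun sigma_true :: "nat \<Rightarrow> 'a \<Rightarrow> 'a \<Rightarrow> bool" and pi_true :: "nat \<Rightarrow> 'a \<Rightarrow> 'a \<Rightarrow> bool" where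
  "sigma_true 0 p a \<longleftrightarrow> delta0_true p a"
| "sigma_true (Suc n) p a \<longleftrightarrow>
     (\<exists>i q. i \<epsilon> omega \<and> p = cEx i q \<and> (\<exists>x. pi_true n q (upd a i x)))"
| "pi_true 0 p a \<longleftrightarrow> delta0_true p a"
| "pi_true (Suc n) p a \<longleftrightarrow>
     (\<exists>i q. i \<epsilon> omega \<and> p = cAll i q \<and> (\<forall>x. sigma_true n q (upd a i x)))"

definition C :: "nat \<Rightarrow> 'a \<Rightarrow> bool" where
  "C n v \<longleftrightarrow> cardinal v \<and>
     (\<forall>p a. is_sigma n p \<and> maps a omega (Vset v) \<longrightarrow>
        (satisfies (Vset v) p a \<longleftrightarrow> sigma_true n p a))"

definition elementary_submodel :: "'a \<Rightarrow> 'a \<Rightarrow> bool" where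
  "elementary_submodel X N \<longleftrightarrow> subset X N \<and>
     (\<forall>p a. is_fm p \<and> maps a omega X \<longrightarrow> (satisfies X p a \<longleftrightarrow> satisfies N p a))"

definition elementary_embedding :: "'a \<Rightarrow> 'a \<Rightarrow> 'a \<Rightarrow> bool" where
  "elementary_embedding j M N \<longleftrightarrow> maps j M N \<and>
     (\<forall>p a. is_fm p \<and> maps a omega M \<longrightarrow>
        (satisfies M p a \<longleftrightarrow> satisfies N p (lam omega (\<lambda>i. app j (app a i)))))"

text \<open>\<open>c\<close> is the critical point of \<open>j\<close>, whose domain \<open>M\<close> need not be transitive.\<close>

definition is_crit :: "'a \<Rightarrow> 'a \<Rightarrow> 'a \<Rightarrow> bool" where
  "is_crit j M c \<longleftrightarrow> ordinal c \<and> c \<epsilon> M \<and> app j c \<noteq> c \<and>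
     (\<forall>b. b \<epsilon> c \<and> b \<epsilon> M \<longrightarrow> app j b = b)"

section \<open>Berkeley and parametrically ultraexact cardinals\<close>

definition berkeley :: "'a \<Rightarrow> bool" where
  "berkeley d \<longleftrightarrow> ordinal d \<and>
     (\<forall>M h. transitive M \<and> d \<epsilon> M \<and> h \<epsilon> d \<longrightarrow>
        (\<exists>j c. elementary_embedding j M M \<and> j \<noteq> lam M (\<lambda>x. x) \<and>
               is_crit j M c \<and> h \<epsilon> c \<and> c \<epsilon> d))"

definition ultraexact_embedding :: "nat \<Rightarrow> 'a \<Rightarrow> 'a \<Rightarrow> 'a \<Rightarrow> 'a \<Rightarrow> bool" where
  "ultraexact_embedding n l X z k \<longleftrightarrow>
     limit_cardinal l \<and>
     (\<exists>h. C n h \<and> l \<epsilon> h \<and> elementary_submodel X (Vset h)) \<and>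
     subset (Vset l) X \<and> l \<epsilon> X \<and>
     C (n + 1) z \<and> l \<epsilon> z \<and>
     elementary_embedding k X (Vset z) \<and>
     app k l = l \<and>
     restriction k l \<noteq> lam l (\<lambda>x. x) \<and>
     restriction k (Vset l) \<epsilon> X"

definition increasing_cardinals :: "'a \<Rightarrow> bool" where
  "increasing_cardinals mu \<longleftrightarrow> function_on mu omega \<and>
     (\<forall>m. m \<epsilon> omega \<longrightarrow> cardinal (app mu m)) \<and>
     (\<forall>m m'. m' \<epsilon> omega \<and> m \<epsilon> m' \<longrightarrow> app mu m \<epsilon> app mu m')"

definition seq_sup :: "'a \<Rightarrow> 'a" where
  "seq_sup mu = coll (\<lambda>x. \<exists>m. m \<epsilon> omega \<and> x \<epsilon> app mu m)"

definition parametrically_ultraexact :: "nat \<Rightarrow> 'a \<Rightarrow> 'a \<Rightarrow> bool" where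
  "parametrically_ultraexact n kap mu \<longleftrightarrow>
     increasing_cardinals mu \<and> cardinal kap \<and> kap \<epsilon> app mu empty \<and>
     (\<forall>A. A \<epsilon> Vset (succ (seq_sup mu)) \<longrightarrow>
        (\<exists>X z k. ultraexact_embedding n (seq_sup mu) X z k \<and>
           (\<exists>x. x \<epsilon> X \<and> app k x = A) \<and>
           app k kap = app mu empty \<and>
           (\<forall>m. m \<epsilon> omega \<longrightarrow> app k (app mu m) = app mu (succ m)) \<and>
           (\<exists>c. is_crit k X c \<and> app k c = kap)))"

end

end

theory Submission
  imports Defs
begin

text \<open>
  By the reflection principle, choose \<open>\<zeta> > \<delta>\<close> with \<open>\<zeta> \<in> C\<^sup>(\<^sup>m\<^sup>)\<close> for all
  \<open>m \<le> n + 1\<close>. Every elementary \<open>k: V\<^sub>\<zeta> \<rightarrow> V\<^sub>\<zeta>\<close> fixing a limit cardinal \<open>\<lambda> < \<zeta>\<close> and moving some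
  ordinal below it is \<open>n\<close>-ultraexact at \<open>\<lambda>\<close>, with \<open>X = V\<^sub>\<zeta>\<close>. A Berkeley cardinal yields an elementary
  \<open>J: N \<rightarrow> N\<close> with \<open>\<alpha> < crit(J) < \<delta>\<close> that fixes any given \<open>a \<in> N\<close>. Let \<open>c = crit(J)\<close>, with critical sequence
  \<open>c, J(c), J(J(c)), \<dots>\<close> below \<open>\<delta>\<close>. Call \<open>A \<in> V\<^sub>\<zeta>\<close> bad for a sequence \<open>s\<close> if no elementary
  \<open>k: V\<^sub>\<zeta> \<rightarrow> V\<^sub>\<zeta>\<close> with \<open>A\<close> in its range shifts \<open>s\<close>, fixes its supremum and maps its critical point to
  the first element of \<open>s\<close>. If \<open>A\<close> were bad for the critical sequence of \<open>J\<close>, then \<open>J(A)\<close> would be bad for its shift,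
  which is refuted by \<open>J\<close> itself. So \<open>c\<close> is parametrically ultraexact for \<open>J(c), J(J(c)), \<dots>\<close>.

  The choice of \<open>a\<close> replaces definability arguments inside \<open>N\<close>: truth in \<open>V\<^sub>\<zeta>\<close>, the badness relation and all
  other relations that \<open>J\<close> has to respect are coded as sets in the tuple \<open>a\<close>, so that only
  preservation of membership and of ordered pairs is needed.
\<close>

text \<open>What shapes the proof is that the axiom schemas speak of syntactic formulas only:
  comprehension, induction and recursion work inside the model just for predicates shown
  \<open>definable\<close>, and each use carries that side condition. A description by
  \<open>THE\<close> has an unknown value where it is improper, and no formula describes that value;
  total variants replace such descriptions and agree with them wherever they denote. Without choice,
  reflection closes under the ranks of witnesses rather than under witnesses. The \<zeta> obtained
  in this way has cofinality omega, so an assignment into \<open>V \<zeta>\<close> need not be an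
  element of it; since the truth of a formula depends on an initial segment of the assignment only,
  the rest is cut off. Taking the same \<zeta> for both stages in the definition of ultraexactness
  makes the submodel condition trivial, and the restriction of \<open>k\<close> to the stage at
  \<lambda> is an element of \<open>V \<zeta>\<close> because \<zeta> is a limit above
  \<lambda>.\<close>

section \<open>Renaming of variables in syntactic formulas\<close>

lemma sat_finitely_many_variables:
  "\<exists>k. \<forall>s s'. (\<forall>i<k. s i = s' i) \<longrightarrow> sat E s p = sat E s' p"
proof (induction p)
  case (FMem i j)
  show ?case by (rule exI[of _ "Suc (max i j)"]) (simp add: less_Suc_eq_le)
next
  case (FEq i j)
  show ?case by (rule exI[of _ "Suc (max i j)"]) (simp add: less_Suc_eq_le)
next
  case (FNeg p)
  then show ?case by simp
next
  case (FAnd p q)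
  then obtain k l where
    "\<forall>s s'. (\<forall>i<k. s i = s' i) \<longrightarrow> sat E s p = sat E s' p"
    "\<forall>s s'. (\<forall>i<l. s i = s' i) \<longrightarrow> sat E s q = sat E s' q" by blast
  then show ?case by (intro exI[of _ "max k l"]) (metis less_max_iff_disj sat.simps(4))
next
  case (FEx i p)
  then obtain k where k: "\<And>s s'. (\<forall>i<k. s i = s' i) \<Longrightarrow> sat E s p = sat E s' p" by blast
  have "sat E s (FEx i p) = sat E s' (FEx i p)" if "\<forall>i<k. s i = s' i" for s s'
  proof -
    have "sat E (s(i := x)) p = sat E (s'(i := x)) p" for x
      by (rule k) (use that in auto)
    then show ?thesis by simp
  qed
  then show ?case by blast
qed

text \<open>The map \<open>f\<close> may identify variables, so only the quantifier case is
  delicate: its bound variable needs a name that no variable of the body is renamed to. One exists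
  because the body reads only finitely many variables.\<close>

lemma sat_reindex: "\<exists>q. \<forall>s. sat E s q = sat E (\<lambda>i. s (f i)) p"
proof (induction p arbitrary: f)
  case (FMem i j)
  show ?case by (rule exI[of _ "FMem (f i) (f j)"]) simp
next
  case (FEq i j)
  show ?case by (rule exI[of _ "FEq (f i) (f j)"]) simp
next
  case (FNeg p)
  then obtain q where "\<forall>s. sat E s q = sat E (\<lambda>i. s (f i)) p" by blast
  then show ?case by (intro exI[of _ "FNeg q"]) simp
next
  case (FAnd p q)
  obtain p' where "\<forall>s. sat E s p' = sat E (\<lambda>i. s (f i)) p" using FAnd(1) by blast
  moreover obtain q' where "\<forall>s. sat E s q' = sat E (\<lambda>i. s (f i)) q" using FAnd(2) by blast
  ultimately show ?case by (intro exI[of _ "FAnd p' q'"]) simp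
next
  case (FEx i p)
  obtain k where k: "\<And>s s'. (\<forall>i<k. s i = s' i) \<Longrightarrow> sat E s p = sat E s' p"
    using sat_finitely_many_variables[of E p] by blast
  obtain m where m: "m \<notin> f ` {..<k}"
    using ex_new_if_finite[OF infinite_UNIV_nat, of "f ` {..<k}"] by auto
  obtain q where q: "\<And>s. sat E s q = sat E (\<lambda>j. s ((f(i := m)) j)) p"
    using FEx[of "f(i := m)"] by blast
  have "sat E (s(m := x)) q = sat E ((\<lambda>j. s (f j))(i := x)) p" for s x
    unfolding q by (rule k) (use m in auto)
  then show ?case by (intro exI[of _ "FEx m q"]) simp
qed

definition interleave :: "(nat \<Rightarrow> 'a) \<Rightarrow> (nat \<Rightarrow> 'a) \<Rightarrow> nat \<Rightarrow> 'a" where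
  "interleave s t i = (if even i then s (i div 2) else t (i div 2))"

section \<open>A calculus of definable predicates and functions\<close>

context zf_model
begin

text \<open>Definability with parameters: the argument of the predicate occupies the even variables, the
  parameters the odd ones.\<close>

definition definable :: "((nat \<Rightarrow> 'a) \<Rightarrow> bool) \<Rightarrow> bool" where
  "definable P \<longleftrightarrow> (\<exists>p t. \<forall>s. P s \<longleftrightarrow> sat (\<epsilon>) (interleave s t) p)"

text \<open>A graph condition: the value sits in variable 0 and the arguments are shifted up by one.
  With the same convention the quantifier rules below act as on de Bruijn indices.\<close>

definition definable_fun :: "((nat \<Rightarrow> 'a) \<Rightarrow> 'a) \<Rightarrow> bool" where
  "definable_fun f \<longleftrightarrow> definable (\<lambda>s. s 0 = f (\<lambda>i. s (Suc i)))"

lemma definableI: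
  assumes "\<And>s. P s \<longleftrightarrow> sat (\<epsilon>) (\<lambda>i. interleave s t (f i)) p"
  shows "definable P"
proof -
  obtain q where "\<forall>s. sat (\<epsilon>) s q = sat (\<epsilon>) (\<lambda>i. s (f i)) p" using sat_reindex by blast
  then show ?thesis unfolding definable_def using assms by (intro exI[of _ q] exI[of _ t]) simp
qed

lemma definable_const: "definable (\<lambda>s. b)"
proof -
  have "sat (\<epsilon>) s (if b then FEq 0 0 else FNeg (FEq 0 0)) = b" for s :: "nat \<Rightarrow> 'a" by simp
  then show ?thesis unfolding definable_def by blast
qed

lemma definable_not: "definable P \<Longrightarrow> definable (\<lambda>s. \<not> P s)"
  unfolding definable_def by (metis sat.simps(3))

lemma definable_and:
  assumes "definable P" "definable Q"
  shows "definable (\<lambda>s. P s \<and> Q s)"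
proof -
  obtain p t where p: "\<And>s. P s \<longleftrightarrow> sat (\<epsilon>) (interleave s t) p"
    using assms(1) unfolding definable_def by blast
  obtain q u where q: "\<And>s. Q s \<longleftrightarrow> sat (\<epsilon>) (interleave s u) q"
    using assms(2) unfolding definable_def by blast
  \<comment> \<open>The two parameter lists are merged into \<open>interleave t u\<close>. Entry
    \<open>t k\<close>, formerly at variable \<open>2k+1\<close>, now sits at \<open>4k+1\<close>,
    and \<open>u k\<close> at \<open>4k+3\<close>.\<close>
  define f g :: "nat \<Rightarrow> nat" where
    "f i = (if even i then i else 2 * (i - 1) + 1)" and
    "g i = (if even i then i else 2 * i + 1)" for i
  have f: "(\<lambda>i. interleave s (interleave t u) (f i)) = interleave s t" for s :: "nat \<Rightarrow> 'a"
    by (rule ext) (auto simp: interleave_def f_def elim!: oddE)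
  have g: "(\<lambda>i. interleave s (interleave t u) (g i)) = interleave s u" for s :: "nat \<Rightarrow> 'a"
    by (rule ext) (auto simp: interleave_def g_def elim!: oddE)
  obtain p' where p': "\<And>s. sat (\<epsilon>) s p' = sat (\<epsilon>) (\<lambda>i. s (f i)) p" using sat_reindex by blast
  obtain q' where q': "\<And>s. sat (\<epsilon>) s q' = sat (\<epsilon>) (\<lambda>i. s (g i)) q" using sat_reindex by blast
  show ?thesis unfolding definable_def
    by (intro exI[of _ "FAnd p' q'"] exI[of _ "interleave t u"]) (simp add: p q p' q' f g)
qed

lemma definable_reindex:
  assumes "definable P"
  shows "definable (\<lambda>s. P (\<lambda>i. s (h i)))"
proof -
  obtain p t where p: "\<And>s. P s \<longleftrightarrow> sat (\<epsilon>) (interleave s t) p"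
    using assms(1) unfolding definable_def by blast
  show ?thesis
    by (rule definableI[of _ t "\<lambda>i. if even i then 2 * h (i div 2) else i" p], unfold p,
        rule arg_cong[of _ _ "\<lambda>s. sat (\<epsilon>) s p"]) (auto simp: interleave_def)
qed

text \<open>Arguments from \<open>k\<close> on become parameters. In this way an instance with fixed
  surroundings \<open>e\<close> becomes a predicate of one or two variables, the form that
  separation and replacement accept.\<close>

lemma definable_fix:
  assumes "definable P"
  shows "definable (\<lambda>s. P (\<lambda>i. if i < k then s i else e i))"
proof -
  obtain p t where p: "\<And>s. P s \<longleftrightarrow> sat (\<epsilon>) (interleave s t) p"
    using assms(1) unfolding definable_def by blast
  define f :: "nat \<Rightarrow> nat" where
    "f i = (if even i \<and> i div 2 < k then i else 2 * i + 1)" for i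
  have "interleave (\<lambda>i. if i < k then s i else e i) t = (\<lambda>i. interleave s (interleave e t) (f i))"
    for s :: "nat \<Rightarrow> 'a"
    by (rule ext) (auto simp: interleave_def f_def)
  then show ?thesis by (intro definableI[of _ "interleave e t" f p]) (simp add: p)
qed

lemma definable_ex:
  assumes "definable (\<lambda>s. Q (\<lambda>i. s (Suc i)) (s 0))"
  shows "definable (\<lambda>s. \<exists>x. Q s x)"
proof -
  obtain p t where p: "\<And>s. Q (\<lambda>i. s (Suc i)) (s 0) \<longleftrightarrow> sat (\<epsilon>) (interleave s t) p"
    using assms(1) unfolding definable_def by blast
  \<comment> \<open>The quantifier binds variable 1, the first parameter slot. The parameters move
    up one place to free it, with \<open>t 0\<close> as filler, and the arguments move down because
    argument 0 of the body is the bound variable.\<close>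
  define f :: "nat \<Rightarrow> nat" where
    "f i = (if i = 0 then 1 else if even i then i - 2 else i + 2)" for i
  obtain q where q: "\<And>s. sat (\<epsilon>) s q = sat (\<epsilon>) (\<lambda>i. s (f i)) p" using sat_reindex by blast
  have f: "(\<lambda>i. ((interleave s (case_nat (t 0) t))(1 := x)) (f i)) = interleave (case_nat x s) t"
    for s :: "nat \<Rightarrow> 'a" and x
    by (rule ext) (auto simp: interleave_def f_def split: nat.split elim!: evenE oddE)
  have "Q s x \<longleftrightarrow> sat (\<epsilon>) (interleave (case_nat x s) t) p" for s x
    using p[of "case_nat x s"] by simp
  then have "(\<exists>x. Q s x) \<longleftrightarrow> sat (\<epsilon>) (interleave s (case_nat (t 0) t)) (FEx 1 q)" for s
    by (simp only: sat.simps q f)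
  then show ?thesis unfolding definable_def by blast
qed

lemma definable_or: "definable P \<Longrightarrow> definable Q \<Longrightarrow> definable (\<lambda>s. P s \<or> Q s)"
  using definable_not[OF definable_and[OF definable_not[of P] definable_not[of Q]]] by simp

lemma definable_imp: "definable P \<Longrightarrow> definable Q \<Longrightarrow> definable (\<lambda>s. P s \<longrightarrow> Q s)"
  using definable_not[OF definable_and[OF _ definable_not[of Q]], of P] by simp

lemma definable_iff:
  assumes "definable P" "definable Q"
  shows "definable (\<lambda>s. P s \<longleftrightarrow> Q s)"
proof -
  have "definable (\<lambda>s. (P s \<longrightarrow> Q s) \<and> (Q s \<longrightarrow> P s))"
    by (intro definable_and definable_imp assms)
  then show ?thesis by (simp add: iff_conv_conj_imp)
qed

lemma definable_all:
  assumes "definable (\<lambda>s. Q (\<lambda>i. s (Suc i)) (s 0))"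
  shows "definable (\<lambda>s. \<forall>x. Q s x)"
  using definable_not[OF definable_ex[of "\<lambda>s x. \<not> Q s x", OF definable_not[OF assms]]] by simp

lemma definable_if:
  assumes "definable B" "definable P" "definable Q"
  shows "definable (\<lambda>s. if B s then P s else Q s)"
proof -
  have "definable (\<lambda>s. (B s \<longrightarrow> P s) \<and> (\<not> B s \<longrightarrow> Q s))"
    by (intro definable_and definable_imp definable_not assms)
  then show ?thesis by (rule back_subst[of definable]) (auto intro!: ext)
qed

text \<open>The bound is a metatheoretic number and the defining formula may vary with
  \<open>m\<close>, as it does for truth at level \<open>m\<close> of the Levy hierarchy; the result
  is a finite disjunction.\<close>

lemma definable_ex_less:
  fixes K :: nat
  assumes "\<And>m. definable (P m)"
  shows "definable (\<lambda>s. \<exists>m<K. P m s)"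
proof (induction K)
  case 0
  show ?case using definable_const[of False] by simp
next
  case (Suc K)
  have "definable (\<lambda>s. (\<exists>m<K. P m s) \<or> P K s)" by (rule definable_or[OF Suc assms])
  then show ?case by (simp add: less_Suc_eq ex_disj_distrib conj_disj_distribR)
qed

lemma definable_eq_var: "definable (\<lambda>s. s i = s j)"
  by (rule definableI[of _ undefined id "FEq (2 * i) (2 * j)"]) (simp add: interleave_def)

lemma definable_mem_var: "definable (\<lambda>s. s i \<epsilon> s j)"
  by (rule definableI[of _ undefined id "FMem (2 * i) (2 * j)"]) (simp add: interleave_def)

lemma definable_fun_var: "definable_fun (\<lambda>s. s i)"
  unfolding definable_fun_def by (rule definable_eq_var)

lemma definable_fun_const: "definable_fun (\<lambda>s. c)"
proof -
  have "definable (\<lambda>s. s 0 = c)"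
    by (rule definableI[of _ "\<lambda>_. c" id "FEq 0 1"]) (simp add: interleave_def)
  then show ?thesis unfolding definable_fun_def .
qed

text \<open>Formulas have no function symbols, so a term is substituted by quantifying over its
  value.\<close>

lemma definable_app1:
  assumes R: "definable (\<lambda>s. R (s 0))" and f: "definable_fun f"
  shows "definable (\<lambda>s. R (f s))"
proof -
  have "definable (\<lambda>s. \<exists>x. x = f s \<and> R x)"
    by (rule definable_ex, rule definable_and[OF f[unfolded definable_fun_def] R])
  then show ?thesis by simp
qed

lemma definable_fun_weaken:
  assumes "definable_fun f"
  shows "definable_fun (\<lambda>s. f (\<lambda>i. s (h i)))"
  using definable_reindex[OF assms[unfolded definable_fun_def], of "case_nat 0 (\<lambda>i. Suc (h i))"]
  unfolding definable_fun_def by simp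

lemma definable_app2:
  assumes R: "definable (\<lambda>s. R (s 0) (s 1))" and f: "definable_fun f" and g: "definable_fun g"
  shows "definable (\<lambda>s. R (f s) (g s))"
proof -
  have "definable (\<lambda>s. \<exists>x. x = f s \<and> R x (g s))"
  proof (rule definable_ex, rule definable_and[OF f[unfolded definable_fun_def]])
    have "definable (\<lambda>s. \<exists>y. y = g (\<lambda>i. s (Suc i)) \<and> R (s 0) y)"
    proof (rule definable_ex, rule definable_and)
      show "definable (\<lambda>s. s 0 = g (\<lambda>i. s (Suc (Suc i))))"
        using definable_fun_weaken[OF g, of Suc] unfolding definable_fun_def by simp
      show "definable (\<lambda>s. R (s (Suc 0)) (s 0))"
        using definable_reindex[OF R, of "\<lambda>i. if i = 0 then Suc 0 else 0"] by simp
    qed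
    then show "definable (\<lambda>s. R (s 0) (g (\<lambda>i. s (Suc i))))" by simp
  qed
  then show ?thesis by simp
qed

lemma definable_app3:
  assumes R: "definable (\<lambda>s. R (s 0) (s 1) (s 2))"
    and f: "definable_fun f" and g: "definable_fun g" and h: "definable_fun h"
  shows "definable (\<lambda>s. R (f s) (g s) (h s))"
proof -
  have "definable (\<lambda>s. \<exists>x. x = f s \<and> R x (g s) (h s))"
  proof (rule definable_ex, rule definable_and[OF f[unfolded definable_fun_def]])
    have "definable (\<lambda>s. \<exists>y. y = g (\<lambda>i. s (Suc i)) \<and> R (s 0) y (h (\<lambda>i. s (Suc i))))"
    proof (rule definable_ex, rule definable_and)
      show "definable (\<lambda>s. s 0 = g (\<lambda>i. s (Suc (Suc i))))"
        using definable_fun_weaken[OF g, of Suc] unfolding definable_fun_def by simp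
      have "definable (\<lambda>s. \<exists>z. z = h (\<lambda>i. s (Suc (Suc i))) \<and> R (s (Suc 0)) (s 0) z)"
      proof (rule definable_ex, rule definable_and)
        show "definable (\<lambda>s. s 0 = h (\<lambda>i. s (Suc (Suc (Suc i)))))"
          using definable_fun_weaken[OF h, of "\<lambda>i. Suc (Suc i)"] unfolding definable_fun_def by simp
        show "definable (\<lambda>s. R (s (Suc (Suc 0))) (s (Suc 0)) (s 0))"
          using definable_reindex[OF R, of "\<lambda>i. if i = 0 then Suc (Suc 0) else if i = 1 then Suc 0 else 0"]
          by (simp add: numeral_2_eq_2)
      qed
      then show "definable (\<lambda>s. R (s (Suc 0)) (s 0) (h (\<lambda>i. s (Suc (Suc i)))))" by simp
    qed
    then show "definable (\<lambda>s. R (s 0) (g (\<lambda>i. s (Suc i))) (h (\<lambda>i. s (Suc i))))" by simp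
  qed
  then show ?thesis by simp
qed

lemma definable_fun_app1:
  assumes F: "definable (\<lambda>s. s 0 = F (s 1))" and f: "definable_fun f"
  shows "definable_fun (\<lambda>s. F (f s))"
  unfolding definable_fun_def
  using definable_app2[of "\<lambda>x y. x = F y", OF F definable_fun_var definable_fun_weaken[OF f]] .

lemma definable_fun_app2:
  assumes F: "definable (\<lambda>s. s 0 = F (s 1) (s 2))" and f: "definable_fun f" and g: "definable_fun g"
  shows "definable_fun (\<lambda>s. F (f s) (g s))"
  unfolding definable_fun_def
  using definable_app3[of "\<lambda>x y z. x = F y z", OF F definable_fun_var
      definable_fun_weaken[OF f] definable_fun_weaken[OF g]] .

lemma definable_eq: "definable_fun f \<Longrightarrow> definable_fun g \<Longrightarrow> definable (\<lambda>s. f s = g s)"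
  by (rule definable_app2[of "(=)", OF definable_eq_var])

lemma definable_mem: "definable_fun f \<Longrightarrow> definable_fun g \<Longrightarrow> definable (\<lambda>s. f s \<epsilon> g s)"
  by (rule definable_app2[of "(\<epsilon>)", OF definable_mem_var])

lemma definable_fun_if:
  assumes B: "definable B" and f: "definable_fun f" and g: "definable_fun g"
  shows "definable_fun (\<lambda>s. if B s then f s else g s)"
proof -
  have "definable (\<lambda>s. if B (\<lambda>i. s (Suc i)) then s 0 = f (\<lambda>i. s (Suc i)) else s 0 = g (\<lambda>i. s (Suc i)))"
    using f g unfolding definable_fun_def by (intro definable_if definable_reindex[OF B])
  then show ?thesis unfolding definable_fun_def by (rule back_subst[of definable]) (auto intro!: ext)
qed

named_theorems dfn

lemmas [dfn] = definable_not definable_and definable_or definable_imp definable_iff definable_ex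
  definable_all definable_if definable_eq definable_mem definable_fun_if
  definable_const definable_fun_const definable_fun_var definable_ex_less

text \<open>Unlike \<open>THE\<close>, this is definable even where the description is improper.\<close>

definition the_or :: "('a \<Rightarrow> bool) \<Rightarrow> 'a" where
  "the_or P = (if \<exists>!y. P y then THE y. P y else empty)"

lemma the_or_eq: "P y \<Longrightarrow> (\<And>z. P z \<Longrightarrow> z = y) \<Longrightarrow> the_or P = y"
  unfolding the_or_def by (subst if_P, erule ex1I, blast, rule the_equality)

lemma the_or_holds: "\<exists>!y. P y \<Longrightarrow> P (the_or P)"
  unfolding the_or_def by (subst if_P, assumption, rule theI')

lemma definable_the_or[dfn]:
  assumes "definable (\<lambda>s. P (\<lambda>i. s (Suc i)) (s 0))"
  shows "definable_fun (\<lambda>s. the_or (P s))"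
proof -
  \<comment> \<open>Properness is itself first-order, so the case distinction with its default
    \<open>empty\<close> becomes a single formula.\<close>
  have eq: "z = the_or Q \<longleftrightarrow> (\<exists>x. Q x \<and> (\<forall>y. Q y \<longrightarrow> y = x) \<and> z = x) \<or>
      (\<not> (\<exists>x. Q x \<and> (\<forall>y. Q y \<longrightarrow> y = x)) \<and> z = empty)" for z Q
  proof (cases "\<exists>!y. Q y")
    case True
    then obtain x where x: "Q x" "\<And>y. Q y \<Longrightarrow> y = x" by blast
    then have "the_or Q = x" by (rule the_or_eq)
    then show ?thesis using x by blast
  next
    case False
    then have e: "the_or Q = empty" by (simp add: the_or_def)
    have "\<not> (\<exists>x. Q x \<and> (\<forall>y. Q y \<longrightarrow> y = x))" using False unfolding Ex1_def .
    then show ?thesis unfolding e by blast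
  qed
  have 1: "definable (\<lambda>s. P (\<lambda>i. s (Suc (Suc i))) (s 0))"
    using definable_reindex[OF assms, of "case_nat 0 (\<lambda>i. Suc (Suc i))"] by simp
  have 2: "definable (\<lambda>s. P (\<lambda>i. s (Suc (Suc (Suc i)))) (s 0))"
    using definable_reindex[OF assms, of "case_nat 0 (\<lambda>i. Suc (Suc (Suc i)))"] by simp
  show ?thesis unfolding definable_fun_def eq
    by (intro dfn 1 2)
qed

section \<open>Elementary set theory\<close>

lemma ext_iff: "x = y \<longleftrightarrow> (\<forall>z. z \<epsilon> x \<longleftrightarrow> z \<epsilon> y)"
  using extensionality by blast

lemma coll_eq: "\<forall>y. y \<epsilon> x \<longleftrightarrow> P y \<Longrightarrow> coll P = x"
  unfolding coll_def by (rule the_equality) (auto simp: ext_iff)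

lemma mem_coll: "\<exists>x. \<forall>y. y \<epsilon> x \<longleftrightarrow> P y \<Longrightarrow> y \<epsilon> coll P \<longleftrightarrow> P y"
  using coll_eq by blast

lemma separation_definable:
  assumes "definable (\<lambda>s. P (s 0))"
  shows "\<exists>y. \<forall>z. z \<epsilon> y \<longleftrightarrow> z \<epsilon> x \<and> P z"
proof -
  obtain p t where p: "\<And>s. P (s 0) \<longleftrightarrow> sat (\<epsilon>) (interleave s t) p"
    using assms(1) unfolding definable_def by blast
  \<comment> \<open>Separation tests variable 0 and leaves the others to the parameters: every
    argument variable is read from 0, and parameter \<open>t k\<close> from variable
    \<open>k+1\<close>.\<close>
  obtain q where q: "\<And>s. sat (\<epsilon>) s q = sat (\<epsilon>) (\<lambda>i. s (if even i then 0 else Suc (i div 2))) p"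
    using sat_reindex[of "(\<epsilon>)" "\<lambda>i. if even i then 0 else Suc (i div 2)" p] by blast
  have "P z \<longleftrightarrow> sat (\<epsilon>) ((case_nat x t)(0 := z)) q" for z
    unfolding q p[of "\<lambda>_. z", simplified]
    by (rule arg_cong[of _ _ "\<lambda>s. sat (\<epsilon>) s p"]) (auto simp: interleave_def)
  then show ?thesis using separation[of x "case_nat x t" q] by simp
qed

lemma replacement_definable:
  assumes "definable (\<lambda>s. P (s 0) (s 1))" and "\<And>u. u \<epsilon> x \<Longrightarrow> \<exists>!v. P u v"
  shows "\<exists>y. \<forall>v. v \<epsilon> y \<longleftrightarrow> (\<exists>u. u \<epsilon> x \<and> P u v)"
proof -
  obtain p t where p: "\<And>s. P (s 0) (s 1) \<longleftrightarrow> sat (\<epsilon>) (interleave s t) p"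
    using assms(1) unfolding definable_def by blast
  \<comment> \<open>Variable 0 is the input, variable 1 the value, and the parameters start at 2;
    all further arguments read the value.\<close>
  define f :: "nat \<Rightarrow> nat" where
    "f i = (if i = 0 then 0 else if even i then 1 else Suc (Suc (i div 2)))" for i
  obtain q where q: "\<And>s. sat (\<epsilon>) s q = sat (\<epsilon>) (\<lambda>i. s (f i)) p"
    using sat_reindex[of "(\<epsilon>)" f p] by blast
  have "P u v \<longleftrightarrow> sat (\<epsilon>) ((case_nat x (case_nat x t))(0 := u, 1 := v)) q" for u v
    unfolding q p[of "\<lambda>i. if i = 0 then u else v", simplified]
    by (rule arg_cong[of _ _ "\<lambda>s. sat (\<epsilon>) s p"])
      (auto simp: interleave_def f_def elim!: evenE intro!: ext)
  then show ?thesis using replacement[of x "case_nat x (case_nat x t)" q] assms(2) by simp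
qed

definition sep :: "'a \<Rightarrow> ('a \<Rightarrow> bool) \<Rightarrow> 'a" where
  "sep x P = coll (\<lambda>z. z \<epsilon> x \<and> P z)"

lemma mem_sep: "definable (\<lambda>s. P (s 0)) \<Longrightarrow> z \<epsilon> sep x P \<longleftrightarrow> z \<epsilon> x \<and> P z"
  unfolding sep_def by (rule mem_coll[OF separation_definable])

lemma definable_sep[dfn]:
  assumes f: "definable_fun f" and P: "definable (\<lambda>s. P (\<lambda>i. s (Suc i)) (s 0))"
  shows "definable_fun (\<lambda>s. sep (f s) (P s))"
proof -
  \<comment> \<open>For fixed surroundings the instance is a one-place predicate, so the set exists
    and can be replaced by its membership condition, which no longer contains a description.\<close>
  have "definable (\<lambda>s. P e (s 0))" for e
    using definable_fix[OF P, of 1 "case_nat undefined e"] by simp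
  then have eq: "z = sep (f e) (P e) \<longleftrightarrow> (\<forall>w. w \<epsilon> z \<longleftrightarrow> w \<epsilon> f e \<and> P e w)" for z e
    using mem_sep by (simp add: ext_iff)
  have 1: "definable (\<lambda>s. P (\<lambda>i. s (Suc (Suc i))) (s 0))"
    using definable_reindex[OF P, of "case_nat 0 (\<lambda>i. Suc (Suc i))"] by simp
  show ?thesis unfolding definable_fun_def eq
    by (intro dfn definable_fun_weaken[OF f] 1)
qed

lemma mem_empty[simp]: "\<not> y \<epsilon> empty"
proof -
  have "\<exists>x. \<forall>y. y \<epsilon> x \<longleftrightarrow> False"
    using separation_definable[of "\<lambda>_. False", OF definable_const] by simp
  from mem_coll[OF this] show ?thesis unfolding empty_def by simp
qed

lemma mem_upair[simp]: "z \<epsilon> upair x y \<longleftrightarrow> z = x \<or> z = y"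
  unfolding upair_def by (rule mem_coll) (rule pairing)

definition bigcup :: "'a \<Rightarrow> 'a" where
  "bigcup x = coll (\<lambda>z. \<exists>y. y \<epsilon> x \<and> z \<epsilon> y)"

lemma mem_bigcup[simp]: "z \<epsilon> bigcup x \<longleftrightarrow> (\<exists>y. y \<epsilon> x \<and> z \<epsilon> y)"
  unfolding bigcup_def by (rule mem_coll) (rule union)

definition cup :: "'a \<Rightarrow> 'a \<Rightarrow> 'a" where
  "cup x y = bigcup (upair x y)"

lemma mem_cup[simp]: "z \<epsilon> cup x y \<longleftrightarrow> z \<epsilon> x \<or> z \<epsilon> y"
  unfolding cup_def by auto

definition pow :: "'a \<Rightarrow> 'a" where
  "pow x = coll (\<lambda>z. subset z x)"

lemma mem_pow[simp]: "z \<epsilon> pow x \<longleftrightarrow> subset z x"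
  unfolding pow_def subset_def by (rule mem_coll) (rule powerset)

lemma mem_succ[simp]: "z \<epsilon> succ x \<longleftrightarrow> z \<epsilon> x \<or> z = x"
  unfolding succ_def by (rule mem_coll) (rule exI[of _ "cup x (upair x x)"], simp)

lemma upair_eq_iff: "upair x y = upair u v \<longleftrightarrow> x = u \<and> y = v \<or> x = v \<and> y = u"
  by (subst ext_iff, simp, metis)

lemma opair_inject[simp]: "opair x y = opair u v \<longleftrightarrow> x = u \<and> y = v"
  unfolding opair_def by (auto simp: upair_eq_iff)

lemma subset_refl[simp]: "subset x x"
  unfolding subset_def by blast

lemma subsetD: "subset x y \<Longrightarrow> z \<epsilon> x \<Longrightarrow> z \<epsilon> y"
  unfolding subset_def by blast

lemma subset_trans: "subset x y \<Longrightarrow> subset y z \<Longrightarrow> subset x z"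
  unfolding subset_def by blast

lemma definable_subset[dfn]:
  "definable_fun f \<Longrightarrow> definable_fun g \<Longrightarrow> definable (\<lambda>s. subset (f s) (g s))"
  by (rule definable_app2[of subset]) (unfold subset_def, intro dfn)

lemma definable_transitive[dfn]: "definable_fun f \<Longrightarrow> definable (\<lambda>s. transitive (f s))"
  by (rule definable_app1[of transitive]) (unfold transitive_def, intro dfn)

lemma definable_ordinal[dfn]: "definable_fun f \<Longrightarrow> definable (\<lambda>s. ordinal (f s))"
  by (rule definable_app1[of ordinal]) (unfold ordinal_def, intro dfn)

lemma definable_upair[dfn]:
  "definable_fun f \<Longrightarrow> definable_fun g \<Longrightarrow> definable_fun (\<lambda>s. upair (f s) (g s))"
  by (rule definable_fun_app2[of upair]) (unfold ext_iff mem_upair, intro dfn)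

lemma definable_opair[dfn]:
  "definable_fun f \<Longrightarrow> definable_fun g \<Longrightarrow> definable_fun (\<lambda>s. opair (f s) (g s))"
  unfolding opair_def by (intro dfn)

lemma definable_bigcup[dfn]: "definable_fun f \<Longrightarrow> definable_fun (\<lambda>s. bigcup (f s))"
  by (rule definable_fun_app1[of bigcup]) (unfold ext_iff mem_bigcup, intro dfn)

lemma definable_cup[dfn]:
  "definable_fun f \<Longrightarrow> definable_fun g \<Longrightarrow> definable_fun (\<lambda>s. cup (f s) (g s))"
  unfolding cup_def by (intro dfn)

lemma definable_pow[dfn]: "definable_fun f \<Longrightarrow> definable_fun (\<lambda>s. pow (f s))"
  by (rule definable_fun_app1[of pow]) (unfold ext_iff mem_pow, intro dfn)

lemma definable_succ[dfn]: "definable_fun f \<Longrightarrow> definable_fun (\<lambda>s. succ (f s))"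
  by (rule definable_fun_app1[of succ]) (unfold ext_iff mem_succ, intro dfn)

lemma definable_ex1[dfn]:
  assumes "definable (\<lambda>s. Q (\<lambda>i. s (Suc i)) (s 0))"
  shows "definable (\<lambda>s. \<exists>!x. Q s x)"
proof -
  have 1: "definable (\<lambda>s. Q (\<lambda>i. s (Suc (Suc i))) (s 0))"
    using definable_reindex[OF assms, of "case_nat 0 (\<lambda>i. Suc (Suc i))"] by simp
  show ?thesis unfolding Ex1_def by (intro dfn assms 1)
qed

lemma definable_fun_compose:
  "definable_fun (\<lambda>s. F (s 0)) \<Longrightarrow> definable_fun f \<Longrightarrow> definable_fun (\<lambda>s. F (f s))"
  by (rule definable_fun_app1) (simp_all add: definable_fun_def)

section \<open>Ordinals\<close>

lemma foundation_definable:
  assumes "definable (\<lambda>s. P (s 0))" "y \<epsilon> x" "P y"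
  shows "\<exists>y. y \<epsilon> x \<and> P y \<and> (\<forall>z. z \<epsilon> y \<and> z \<epsilon> x \<longrightarrow> \<not> P z)"
  using foundation[of y "sep x P"] assms(2,3) by (auto simp: mem_sep[OF assms(1)])

lemma mem_asym: "x \<epsilon> y \<Longrightarrow> \<not> y \<epsilon> x"
  using foundation[of x "upair x y"] by auto

lemma mem_irrefl[simp]: "\<not> x \<epsilon> x"
  using mem_asym by blast

lemma ordinal_elem: "ordinal x \<Longrightarrow> y \<epsilon> x \<Longrightarrow> ordinal y"
  unfolding ordinal_def transitive_def subset_def by blast

lemma ordinal_trans: "ordinal x \<Longrightarrow> y \<epsilon> x \<Longrightarrow> z \<epsilon> y \<Longrightarrow> z \<epsilon> x"
  unfolding ordinal_def transitive_def subset_def by blast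

lemma ordinal_subset: "ordinal x \<Longrightarrow> y \<epsilon> x \<Longrightarrow> subset y x"
  unfolding ordinal_def transitive_def by blast

text \<open>A minimal counterexample is sought inside the set \<open>succ x\<close>, where
  separation applies to the definable \<open>P\<close>.\<close>

lemma ordinal_induct:
  assumes "ordinal x" and P: "definable (\<lambda>s. P (s 0))"
    and step: "\<And>x. ordinal x \<Longrightarrow> (\<And>y. y \<epsilon> x \<Longrightarrow> P y) \<Longrightarrow> P x"
  shows "P x"
proof (rule ccontr)
  assume "\<not> P x"
  then obtain z where z: "z \<epsilon> succ x" "\<not> P z" "\<And>y. y \<epsilon> z \<Longrightarrow> y \<epsilon> succ x \<Longrightarrow> P y"
    using foundation_definable[OF definable_not[OF P], of x "succ x"] by auto
  have "ordinal z" using z(1) assms(1) ordinal_elem by auto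
  moreover have "y \<epsilon> succ x" if "y \<epsilon> z" for y
    using that z(1) assms(1) ordinal_trans by auto
  ultimately show False using step z by blast
qed

lemma ordinal_linear:
  assumes "ordinal x" "ordinal y"
  shows "x \<epsilon> y \<or> x = y \<or> y \<epsilon> x"
proof -
  have "\<forall>y. ordinal y \<longrightarrow> x \<epsilon> y \<or> x = y \<or> y \<epsilon> x"
    using assms(1)
  proof (rule ordinal_induct[where P = "\<lambda>x. \<forall>y. ordinal y \<longrightarrow> x \<epsilon> y \<or> x = y \<or> y \<epsilon> x"])
    show "definable (\<lambda>s. \<forall>y. ordinal y \<longrightarrow> s 0 \<epsilon> y \<or> s 0 = y \<or> y \<epsilon> s 0)" by (intro dfn)
    fix x assume x: "ordinal x"
      and IHx: "\<And>z. z \<epsilon> x \<Longrightarrow> \<forall>y. ordinal y \<longrightarrow> z \<epsilon> y \<or> z = y \<or> y \<epsilon> z"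
    have "x \<epsilon> y \<or> x = y \<or> y \<epsilon> x" if "ordinal y" for y
      using that
    proof (rule ordinal_induct[where P = "\<lambda>y. x \<epsilon> y \<or> x = y \<or> y \<epsilon> x"])
      show "definable (\<lambda>s. x \<epsilon> s 0 \<or> x = s 0 \<or> s 0 \<epsilon> x)" by (intro dfn)
      fix y assume y: "ordinal y" and IHy: "\<And>z. z \<epsilon> y \<Longrightarrow> x \<epsilon> z \<or> x = z \<or> z \<epsilon> x"
      show "x \<epsilon> y \<or> x = y \<or> y \<epsilon> x"
      proof (rule ccontr)
        assume n: "\<not> (x \<epsilon> y \<or> x = y \<or> y \<epsilon> x)"
        have "z \<epsilon> y" if "z \<epsilon> x" for z
          using IHx[OF that] y n ordinal_trans[OF x that] that by blast
        moreover have "z \<epsilon> x" if "z \<epsilon> y" for z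
          using IHy[OF that] n ordinal_trans[OF y that] that by blast
        ultimately have "x = y" using extensionality by blast
        then show False using n by blast
      qed
    qed
    then show "\<forall>y. ordinal y \<longrightarrow> x \<epsilon> y \<or> x = y \<or> y \<epsilon> x" by blast
  qed
  then show ?thesis using assms(2) by blast
qed

lemma ordinal_subset_iff:
  "ordinal x \<Longrightarrow> ordinal y \<Longrightarrow> subset x y \<longleftrightarrow> x = y \<or> x \<epsilon> y"
  using ordinal_linear[of x y] ordinal_subset subsetD mem_irrefl subset_refl by metis

lemma ordinal_empty[simp]: "ordinal empty"
  unfolding ordinal_def transitive_def by simp

lemma ordinal_succ: "ordinal x \<Longrightarrow> ordinal (succ x)"
  unfolding ordinal_def transitive_def subset_def mem_succ by blast

lemma ordinal_bigcup: "(\<And>y. y \<epsilon> x \<Longrightarrow> ordinal y) \<Longrightarrow> ordinal (bigcup x)"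
  unfolding ordinal_def transitive_def subset_def mem_bigcup by blast

lemma ordinal_cup: "ordinal x \<Longrightarrow> ordinal y \<Longrightarrow> ordinal (cup x y)"
  unfolding cup_def by (rule ordinal_bigcup) auto

section \<open>Least fixed points and the natural numbers\<close>

text \<open>The intersection of all sets closed under \<open>step\<close>: the common form of
  \<open>omega\<close>, \<open>is_fm\<close> and \<open>is_delta0\<close>. It is a set once some
  closed set exists.\<close>

definition lfp_set :: "('a \<Rightarrow> 'a \<Rightarrow> bool) \<Rightarrow> 'a" where
  "lfp_set step = coll (\<lambda>w. \<forall>F. (\<forall>v. step F v \<longrightarrow> v \<epsilon> F) \<longrightarrow> w \<epsilon> F)"

lemma mem_lfp_set:
  assumes "definable (\<lambda>s. step (s 0) (s 1))" and "\<forall>w. step B w \<longrightarrow> w \<epsilon> B"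
  shows "w \<epsilon> lfp_set step \<longleftrightarrow> (\<forall>F. (\<forall>v. step F v \<longrightarrow> v \<epsilon> F) \<longrightarrow> w \<epsilon> F)"
  unfolding lfp_set_def
proof (rule mem_coll)
  have "definable (\<lambda>s. \<forall>F. (\<forall>v. step F v \<longrightarrow> v \<epsilon> F) \<longrightarrow> s 0 \<epsilon> F)"
    by (intro dfn definable_app2[OF assms(1)])
  from separation_definable[OF this, of B]
  show "\<exists>x. \<forall>y. y \<epsilon> x \<longleftrightarrow> (\<forall>F. (\<forall>v. step F v \<longrightarrow> v \<epsilon> F) \<longrightarrow> y \<epsilon> F)"
    using assms(2) by (metis (no_types, lifting))
qed

text \<open>Knaster-Tarski for a monotone definable operator with a closed set \<open>B\<close>. In
  the induction rule the hypothesis is packed into \<open>sep (lfp_set step) P\<close>, the members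
  already known to satisfy \<open>P\<close>.\<close>

lemma lfp_set_properties:
  assumes "definable (\<lambda>s. step (s 0) (s 1))" and "\<forall>w. step B w \<longrightarrow> w \<epsilon> B"
    and "\<forall>W W' w. step W w \<longrightarrow> subset W W' \<longrightarrow> step W' w"
  shows lfp_set_closed: "step (lfp_set step) w \<Longrightarrow> w \<epsilon> lfp_set step"
    and lfp_set_cases: "w \<epsilon> lfp_set step \<Longrightarrow> step (lfp_set step) w"
    and lfp_set_induct: "w \<epsilon> lfp_set step \<Longrightarrow> definable (\<lambda>s. P (s 0)) \<Longrightarrow>
      (\<And>v. step (sep (lfp_set step) P) v \<Longrightarrow> P v) \<Longrightarrow> P w"
proof -
  note mem = mem_lfp_set[OF assms(1,2)]
  have mono: "\<And>W W' w. step W w \<Longrightarrow> subset W W' \<Longrightarrow> step W' w" using assms(3) by blast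
  have sub: "subset (lfp_set step) F" if "\<And>v. step F v \<Longrightarrow> v \<epsilon> F" for F
  proof -
    have "\<forall>v. step F v \<longrightarrow> v \<epsilon> F" using that by blast
    then show ?thesis unfolding subset_def mem by blast
  qed
  show cl: "w \<epsilon> lfp_set step" if "step (lfp_set step) w" for w
    unfolding mem using that mono sub by blast
  have d: "definable (\<lambda>s. step (lfp_set step) (s 0))"
    by (rule definable_app2[OF assms(1)]) (intro dfn)+
  show "step (lfp_set step) w" if "w \<epsilon> lfp_set step"
  proof -
    have "subset (lfp_set step) (sep (lfp_set step) (step (lfp_set step)))"
    proof (rule sub)
      fix v assume "step (sep (lfp_set step) (step (lfp_set step))) v"
      then have "step (lfp_set step) v" by (rule mono) (auto simp: subset_def mem_sep[OF d])
      then show "v \<epsilon> sep (lfp_set step) (step (lfp_set step))" using cl by (simp add: mem_sep[OF d])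
    qed
    then show ?thesis using that by (auto simp: subset_def mem_sep[OF d])
  qed
  show "P w" if w: "w \<epsilon> lfp_set step" and P: "definable (\<lambda>s. P (s 0))"
    and P': "\<And>v. step (sep (lfp_set step) P) v \<Longrightarrow> P v"
  proof -
    have "subset (lfp_set step) (sep (lfp_set step) P)"
    proof (rule sub)
      fix v assume v: "step (sep (lfp_set step) P) v"
      then have "step (lfp_set step) v" by (rule mono) (auto simp: subset_def mem_sep[OF P])
      then show "v \<epsilon> sep (lfp_set step) P" using cl P'[OF v] by (simp add: mem_sep[OF P])
    qed
    then show ?thesis using w by (auto simp: subset_def mem_sep[OF P])
  qed
qed

definition omega_step :: "'a \<Rightarrow> 'a \<Rightarrow> bool" where
  "omega_step I m \<longleftrightarrow> m = empty \<or> (\<exists>x. x \<epsilon> I \<and> m = succ x)"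

lemma omega_lfp: "omega = lfp_set omega_step"
  unfolding omega_def lfp_set_def omega_step_def by (rule arg_cong[of _ _ coll]) (auto intro!: ext)

lemma ex_omega_closed: "\<exists>B. \<forall>m. omega_step B m \<longrightarrow> m \<epsilon> B"
proof -
  obtain x e where "e \<epsilon> x" "\<forall>y. \<not> y \<epsilon> e"
    and s: "\<forall>y. y \<epsilon> x \<longrightarrow> (\<exists>s. s \<epsilon> x \<and> (\<forall>w. w \<epsilon> s \<longleftrightarrow> w \<epsilon> y \<or> w = y))"
    using infinity by blast
  then have "empty \<epsilon> x" by (metis ext_iff mem_empty)
  moreover have "succ y \<epsilon> x" if "y \<epsilon> x" for y
  proof -
    obtain s where "s \<epsilon> x" "\<forall>w. w \<epsilon> s \<longleftrightarrow> w \<epsilon> y \<or> w = y" using s \<open>y \<epsilon> x\<close> by blast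
    moreover from this have "s = succ y" by (simp add: ext_iff)
    ultimately show ?thesis by simp
  qed
  ultimately show ?thesis unfolding omega_step_def by blast
qed

lemma definable_omega_step: "definable (\<lambda>s. omega_step (s 0) (s 1))"
  unfolding omega_step_def by (intro dfn)

lemma omega_step_mono: "\<forall>W W' w. omega_step W w \<longrightarrow> subset W W' \<longrightarrow> omega_step W' w"
  unfolding omega_step_def subset_def by blast

lemma empty_omega[simp]: "empty \<epsilon> omega"
  and succ_omega: "m \<epsilon> omega \<Longrightarrow> succ m \<epsilon> omega"
  and omega_cases: "m \<epsilon> omega \<Longrightarrow> m = empty \<or> (\<exists>k. k \<epsilon> omega \<and> m = succ k)"
proof -
  obtain B where B: "\<forall>m. omega_step B m \<longrightarrow> m \<epsilon> B" using ex_omega_closed by blast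
  note p = lfp_set_closed[OF definable_omega_step B omega_step_mono]
    lfp_set_cases[OF definable_omega_step B omega_step_mono]
  have s: "omega_step I empty" "x \<epsilon> I \<Longrightarrow> omega_step I (succ x)" for I x
    by (auto simp: omega_step_def)
  show "empty \<epsilon> omega" "m \<epsilon> omega \<Longrightarrow> succ m \<epsilon> omega"
    unfolding omega_lfp by (rule p(1)[OF s(1)], rule p(1)[OF s(2)])
  show "m \<epsilon> omega \<Longrightarrow> m = empty \<or> (\<exists>k. k \<epsilon> omega \<and> m = succ k)"
    unfolding omega_lfp using p(2)[of m] unfolding omega_step_def[of _ m] by blast
qed

lemma omega_induct:
  assumes "m \<epsilon> omega" and P: "definable (\<lambda>s. P (s 0))" and "P empty"
    and "\<And>m. m \<epsilon> omega \<Longrightarrow> P m \<Longrightarrow> P (succ m)"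
  shows "P m"
proof -
  obtain B where B: "\<forall>m. omega_step B m \<longrightarrow> m \<epsilon> B" using ex_omega_closed by blast
  show ?thesis
    by (rule lfp_set_induct[OF definable_omega_step B omega_step_mono assms(1)[unfolded omega_lfp] P])
      (use assms(3,4) in \<open>auto simp: omega_step_def mem_sep[OF P] omega_lfp\<close>)
qed

lemma ordinal_nat: "m \<epsilon> omega \<Longrightarrow> ordinal m"
  by (rule omega_induct[where P = ordinal]) (auto intro: ordinal_succ dfn)

lemma nat_subset_omega: "m \<epsilon> omega \<Longrightarrow> subset m omega"
  by (rule omega_induct[where P = "\<lambda>m. subset m omega"])
    (auto simp: subset_def intro!: definable_subset[unfolded subset_def] definable_fun_var definable_fun_const)

lemma mem_nat_omega: "m \<epsilon> omega \<Longrightarrow> k \<epsilon> m \<Longrightarrow> k \<epsilon> omega"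
  using nat_subset_omega subsetD by blast

lemma ordinal_omega[simp]: "ordinal omega"
  using nat_subset_omega ordinal_nat unfolding ordinal_def transitive_def by blast

lemma num_omega[simp]: "num m \<epsilon> omega"
  by (induction m) (auto intro: succ_omega)

lemma num_mem: "m < n \<Longrightarrow> num m \<epsilon> num n"
  by (induction n) (auto simp: less_Suc_eq)

lemma num_inject[simp]: "num m = num n \<longleftrightarrow> m = n"
  using num_mem[of m n] num_mem[of n m] by (cases m n rule: linorder_cases) auto

section \<open>Functions\<close>

lemma definable_function_on[dfn]:
  "definable_fun f \<Longrightarrow> definable_fun g \<Longrightarrow> definable (\<lambda>s. function_on (f s) (g s))"
  by (rule definable_app2[of function_on]) (unfold function_on_def, intro dfn)

text \<open>Outside the domain of a function \<open>app\<close> and \<open>upd\<close> are improper descriptions, for which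
  definability cannot be proved; \<open>appd\<close> and \<open>updd\<close> below are total variants.\<close>

definition appd :: "'a \<Rightarrow> 'a \<Rightarrow> 'a" where
  "appd f x = the_or (\<lambda>y. opair x y \<epsilon> f)"

lemma definable_appd[dfn]:
  "definable_fun f \<Longrightarrow> definable_fun g \<Longrightarrow> definable_fun (\<lambda>s. appd (f s) (g s))"
  by (rule definable_fun_app2[of appd])
    (unfold appd_def, intro dfn)

lemma function_mem_iff: "function_on f A \<Longrightarrow> x \<epsilon> A \<Longrightarrow> opair x y \<epsilon> f \<longleftrightarrow> y = app f x"
proof -
  assume "function_on f A" "x \<epsilon> A"
  then have u: "\<exists>!y. opair x y \<epsilon> f" unfolding function_on_def by blast
  have "opair x (app f x) \<epsilon> f" unfolding app_def using theI'[OF u] .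
  then show ?thesis using u by blast
qed

lemma function_app_mem: "function_on f A \<Longrightarrow> x \<epsilon> A \<Longrightarrow> opair x (app f x) \<epsilon> f"
  by (simp add: function_mem_iff)

lemma function_dom: "function_on f A \<Longrightarrow> opair x y \<epsilon> f \<Longrightarrow> x \<epsilon> A"
  unfolding function_on_def by (metis opair_inject)

lemma function_memE:
  assumes "function_on f A" "p \<epsilon> f"
  obtains x where "x \<epsilon> A" "p = opair x (app f x)"
proof -
  obtain x y where "x \<epsilon> A" "p = opair x y" using assms unfolding function_on_def by blast
  then show thesis using that function_mem_iff[OF assms(1), of x y] assms(2) by blast
qed

lemma appd_eq_app: "function_on f A \<Longrightarrow> x \<epsilon> A \<Longrightarrow> appd f x = app f x"
  unfolding appd_def by (rule the_or_eq) (simp_all add: function_mem_iff)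

lemma function_ext:
  assumes f: "function_on f A" and g: "function_on g A" and eq: "\<And>x. x \<epsilon> A \<Longrightarrow> app f x = app g x"
  shows "f = g"
proof (rule extensionality, intro allI iffI)
  show "p \<epsilon> g" if "p \<epsilon> f" for p
    by (rule function_memE[OF f that]) (simp add: eq function_app_mem[OF g])
  show "p \<epsilon> f" if "p \<epsilon> g" for p
    by (rule function_memE[OF g that]) (simp add: eq[symmetric] function_app_mem[OF f])
qed

definition repl :: "'a \<Rightarrow> ('a \<Rightarrow> 'a) \<Rightarrow> 'a" where
  "repl A F = coll (\<lambda>y. \<exists>x. x \<epsilon> A \<and> y = F x)"

lemma mem_repl:
  assumes "definable_fun (\<lambda>s. F (s 0))"
  shows "y \<epsilon> repl A F \<longleftrightarrow> (\<exists>x. x \<epsilon> A \<and> y = F x)"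
  unfolding repl_def
proof (rule mem_coll, rule replacement_definable)
  show "definable (\<lambda>s. s 1 = F (s 0))"
    by (intro dfn definable_fun_compose[OF assms])
qed simp

lemma definable_repl[dfn]:
  assumes f: "definable_fun f" and P: "definable_fun (\<lambda>s. P (\<lambda>i. s (Suc i)) (s 0))"
  shows "definable_fun (\<lambda>s. repl (f s) (P s))"
proof -
  have "definable_fun (\<lambda>s. P e (s 0))" for e
    using definable_fix[OF P[unfolded definable_fun_def], of 2 "case_nat undefined (case_nat undefined e)"]
    unfolding definable_fun_def by (simp add: numeral_2_eq_2)
  then have eq: "z = repl (f e) (P e) \<longleftrightarrow> (\<forall>w. w \<epsilon> z \<longleftrightarrow> (\<exists>x. x \<epsilon> f e \<and> w = P e x))" for z e
    using mem_repl by (simp add: ext_iff)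
  have 1: "definable (\<lambda>s. s (Suc 0) = P (\<lambda>i. s (Suc (Suc (Suc i)))) (s 0))"
    using definable_reindex[OF P[unfolded definable_fun_def],
        of "case_nat 1 (case_nat 0 (\<lambda>i. Suc (Suc (Suc i))))"] by simp
  show ?thesis unfolding definable_fun_def eq
    by (intro dfn definable_fun_weaken[OF f] 1)
qed

lemma mem_lam:
  assumes "definable_fun (\<lambda>s. F (s 0))"
  shows "p \<epsilon> lam A F \<longleftrightarrow> (\<exists>x. x \<epsilon> A \<and> p = opair x (F x))"
proof -
  have "lam A F = repl A (\<lambda>x. opair x (F x))" unfolding lam_def repl_def ..
  moreover have "definable_fun (\<lambda>s. opair (s 0) (F (s 0)))" by (intro dfn assms)
  ultimately show ?thesis using mem_repl by simp
qed

lemma lam_cong: "(\<And>x. x \<epsilon> A \<Longrightarrow> F x = G x) \<Longrightarrow> lam A F = lam A G"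
  unfolding lam_def by (rule arg_cong[of _ _ coll]) (auto intro!: ext)

lemma function_on_lam: "definable_fun (\<lambda>s. F (s 0)) \<Longrightarrow> function_on (lam A F) A"
  unfolding function_on_def by (auto simp: mem_lam)

lemma app_lam: "definable_fun (\<lambda>s. F (s 0)) \<Longrightarrow> x \<epsilon> A \<Longrightarrow> app (lam A F) x = F x"
  using function_mem_iff[OF function_on_lam, of F x A "F x"] by (simp add: mem_lam)

lemma restriction_sep: "restriction f A = sep f (\<lambda>p. \<exists>x y. x \<epsilon> A \<and> p = opair x y)"
  unfolding restriction_def sep_def ..

lemma definable_restriction[dfn]:
  "definable_fun f \<Longrightarrow> definable_fun g \<Longrightarrow> definable_fun (\<lambda>s. restriction (f s) (g s))"
  by (rule definable_fun_app2[of restriction]) (unfold restriction_sep, intro dfn)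

lemma mem_restriction: "p \<epsilon> restriction f A \<longleftrightarrow> p \<epsilon> f \<and> (\<exists>x y. x \<epsilon> A \<and> p = opair x y)"
  unfolding restriction_sep by (rule mem_sep) (intro dfn)

lemma function_on_restriction:
  assumes "function_on f A" "subset B A"
  shows "function_on (restriction f B) B"
  unfolding function_on_def mem_restriction
proof (intro conjI allI impI)
  show "\<exists>!y. opair x y \<epsilon> f \<and> (\<exists>x' y'. x' \<epsilon> B \<and> opair x y = opair x' y')" if "x \<epsilon> B" for x
    using function_mem_iff[OF assms(1) subsetD[OF assms(2) that]] that by simp
qed blast

lemma app_restriction:
  "function_on f A \<Longrightarrow> subset B A \<Longrightarrow> x \<epsilon> B \<Longrightarrow> app (restriction f B) x = app f x"
  using function_mem_iff[OF function_on_restriction, of f A B x "app f x"]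
  by (auto simp: mem_restriction function_app_mem dest: subsetD)

text \<open>Stated through the graph: \<open>app\<close> is a description that may fail to denote,
  so it has to be eliminated before definability can be derived.\<close>

lemma maps_iff:
  "maps f A B \<longleftrightarrow> function_on f A \<and> (\<forall>x. x \<epsilon> A \<longrightarrow> (\<exists>y. y \<epsilon> B \<and> opair x y \<epsilon> f))"
  unfolding maps_def by (auto simp: function_mem_iff)

lemma definable_maps[dfn]:
  "definable_fun f \<Longrightarrow> definable_fun g \<Longrightarrow> definable_fun h \<Longrightarrow> definable (\<lambda>s. maps (f s) (g s) (h s))"
  by (rule definable_app3[of maps]) (unfold maps_iff, intro dfn)

lemma bijection_iff:
  "bijection f A B \<longleftrightarrow> maps f A B \<and>
    (\<forall>x y z. opair x z \<epsilon> f \<and> opair y z \<epsilon> f \<longrightarrow> x = y) \<and> (\<forall>z. z \<epsilon> B \<longrightarrow> (\<exists>x. opair x z \<epsilon> f))"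
proof (cases "function_on f A")
  case True
  have e: "opair x z \<epsilon> f \<longleftrightarrow> x \<epsilon> A \<and> z = app f x" for x z
    using function_mem_iff[OF True] function_dom[OF True] by blast
  show ?thesis unfolding bijection_def e by (auto dest: sym)
qed (simp add: bijection_def maps_def)

lemma definable_bijection[dfn]:
  "definable_fun f \<Longrightarrow> definable_fun g \<Longrightarrow> definable_fun h \<Longrightarrow>
    definable (\<lambda>s. bijection (f s) (g s) (h s))"
  by (rule definable_app3[of bijection]) (unfold bijection_iff, intro dfn)

lemma definable_cardinal[dfn]: "definable_fun f \<Longrightarrow> definable (\<lambda>s. cardinal (f s))"
  by (rule definable_app1[of cardinal]) (unfold cardinal_def, intro dfn)

section \<open>Transfinite recursion\<close>

text \<open>The set-sized partial solutions, on the ordinal \<open>a\<close>, of the recursion whose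
  value at \<open>b\<close> is \<open>G\<close> of the graph below \<open>b\<close>.\<close>

definition approx :: "('a \<Rightarrow> 'a) \<Rightarrow> 'a \<Rightarrow> 'a \<Rightarrow> bool" where
  "approx G a g \<longleftrightarrow> function_on g a \<and> (\<forall>b. b \<epsilon> a \<longrightarrow> opair b (G (restriction g b)) \<epsilon> g)"

definition trec :: "('a \<Rightarrow> 'a) \<Rightarrow> 'a \<Rightarrow> 'a" where
  "trec G a = the_or (\<lambda>y. ordinal a \<and> (\<exists>g. approx G a g \<and> y = G g))"

lemma approx_app: "approx G a g \<Longrightarrow> b \<epsilon> a \<Longrightarrow> app g b = G (restriction g b)"
  unfolding approx_def using function_mem_iff[of g a b] by auto

lemma approx_function: "approx G a g \<Longrightarrow> function_on g a"
  unfolding approx_def by blast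

lemma approx_restriction:
  assumes "ordinal a" "approx G a g" "b \<epsilon> a"
  shows "approx G b (restriction g b)"
  unfolding approx_def
proof (intro conjI allI impI)
  note f = approx_function[OF assms(2)] and sub = ordinal_subset[OF assms(1,3)]
  show f': "function_on (restriction g b) b" by (rule function_on_restriction[OF f sub])
  fix c assume c: "c \<epsilon> b"
  then have "c \<epsilon> a" using subsetD[OF sub] by blast
  have cb: "subset c b" using ordinal_subset[OF ordinal_elem[OF assms(1,3)] c] .
  have "restriction (restriction g b) c = restriction g c"
    unfolding ext_iff mem_restriction using subsetD[OF cb] by blast
  then have "app (restriction g b) c = G (restriction (restriction g b) c)"
    using app_restriction[OF f sub c] approx_app[OF assms(2) \<open>c \<epsilon> a\<close>] by simp
  then show "opair c (G (restriction (restriction g b) c)) \<epsilon> restriction g b"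
    using function_mem_iff[OF f' c] by simp
qed

lemma approx_unique:
  assumes "ordinal a" "approx G a g" "approx G a h"
  shows "g = h"
proof (rule function_ext[OF approx_function[OF assms(2)] approx_function[OF assms(3)]])
  note g = approx_function[OF assms(2)] and h = approx_function[OF assms(3)]
  fix b assume b: "b \<epsilon> a"
  \<comment> \<open>The induction is run with \<open>appd\<close> in place of \<open>app\<close>,
    because its predicate must be definable also at ordinals outside the domain.\<close>
  have "b \<epsilon> a \<longrightarrow> appd g b = appd h b"
  proof (rule ordinal_induct[OF ordinal_elem[OF assms(1) b], where P = "\<lambda>b. b \<epsilon> a \<longrightarrow> appd g b = appd h b"])
    show "definable (\<lambda>s. s 0 \<epsilon> a \<longrightarrow> appd g (s 0) = appd h (s 0))" by (intro dfn)
    fix x assume IH: "\<And>y. y \<epsilon> x \<Longrightarrow> y \<epsilon> a \<longrightarrow> appd g y = appd h y"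
    show "x \<epsilon> a \<longrightarrow> appd g x = appd h x"
    proof
      assume x: "x \<epsilon> a"
      note sub = ordinal_subset[OF assms(1) x]
      have "restriction g x = restriction h x"
      proof (rule function_ext[OF function_on_restriction[OF g sub] function_on_restriction[OF h sub]])
        fix y assume y: "y \<epsilon> x"
        then have "y \<epsilon> a" using subsetD[OF sub] by blast
        then show "app (restriction g x) y = app (restriction h x) y"
          using IH[OF y] y by (simp add: app_restriction[OF g sub] app_restriction[OF h sub]
              appd_eq_app[OF g] appd_eq_app[OF h])
      qed
      then show "appd g x = appd h x"
        using approx_app[OF assms(2) x] approx_app[OF assms(3) x] x
        by (simp add: appd_eq_app[OF g] appd_eq_app[OF h])
    qed
  qed
  then show "app g b = app h b" using b by (simp add: appd_eq_app[OF g] appd_eq_app[OF h])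
qed

lemma trec_eq_approx:
  assumes "ordinal a" "approx G a g"
  shows "trec G a = G g"
  unfolding trec_def using assms by (intro the_or_eq) (auto dest: approx_unique)

lemma approx_eq_lam:
  assumes G: "definable_fun (\<lambda>s. trec G (s 0))" and a: "ordinal a" "approx G a g"
  shows "g = lam a (trec G)"
proof (rule function_ext[OF approx_function[OF a(2)] function_on_lam[OF G]])
  fix b assume b: "b \<epsilon> a"
  show "app g b = app (lam a (trec G)) b"
    unfolding app_lam[OF G b] approx_app[OF a(2) b]
    using trec_eq_approx[OF ordinal_elem[OF a(1) b] approx_restriction[OF a b]] by simp
qed

lemma definable_trec_base:
  assumes "definable_fun (\<lambda>s. G (s 0))"
  shows "definable_fun (\<lambda>s. trec G (s 0))"
  unfolding trec_def approx_def by (intro dfn definable_fun_compose[OF assms])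

lemma definable_trec:
  assumes "definable_fun (\<lambda>s. G (s 0))" "definable_fun f"
  shows "definable_fun (\<lambda>s. trec G (f s))"
  by (rule definable_fun_compose[OF definable_trec_base[OF assms(1)] assms(2)])

text \<open>Nothing has to be glued: by the induction hypothesis \<open>trec G\<close> is already
  correct below \<open>a\<close>, and replacement turns its restriction to \<open>a\<close> into the
  required function.\<close>

lemma ex_approx:
  assumes G: "definable_fun (\<lambda>s. G (s 0))" and "ordinal a"
  shows "\<exists>g. approx G a g"
  using assms(2)
proof (rule ordinal_induct[where P = "\<lambda>a. \<exists>g. approx G a g"])
  show "definable (\<lambda>s. \<exists>g. approx G (s 0) g)"
    unfolding approx_def by (intro dfn definable_fun_compose[OF G])
  note T = definable_trec_base[OF G]
  fix a assume a: "ordinal a" and IH: "\<And>b. b \<epsilon> a \<Longrightarrow> \<exists>g. approx G b g"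
  have "approx G a (lam a (trec G))"
    unfolding approx_def
  proof (intro conjI allI impI)
    show f: "function_on (lam a (trec G)) a" by (rule function_on_lam[OF T])
    fix b assume b: "b \<epsilon> a"
    obtain g where g: "approx G b g" using IH[OF b] by blast
    note ob = ordinal_elem[OF a b] and sub = ordinal_subset[OF a b]
    have "restriction (lam a (trec G)) b = lam b (trec G)"
      by (rule function_ext[OF function_on_restriction[OF f sub] function_on_lam[OF T]])
        (simp add: app_restriction[OF f sub] app_lam[OF T] subsetD[OF sub])
    then have "G (restriction (lam a (trec G)) b) = trec G b"
      using trec_eq_approx[OF ob g] approx_eq_lam[OF T ob g] by simp
    then show "opair b (G (restriction (lam a (trec G)) b)) \<epsilon> lam a (trec G)"
      using b by (simp add: mem_lam[OF T])
  qed
  then show "\<exists>g. approx G a g" by blast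
qed

lemma trec_unfold:
  assumes G: "definable_fun (\<lambda>s. G (s 0))" and "ordinal a"
  shows "trec G a = G (lam a (trec G))"
  using ex_approx[OF assms] trec_eq_approx[OF assms(2)] approx_eq_lam[OF definable_trec_base[OF G] assms(2)]
  by metis

section \<open>Recursion on the natural numbers\<close>

text \<open>Reads the last value off the graph \<open>g\<close> of all earlier ones: the largest
  index \<open>m\<close> is the one for which every index lies in \<open>succ m\<close>. The empty
  graph marks stage 0.\<close>

definition nrec_step :: "'a \<Rightarrow> ('a \<Rightarrow> 'a) \<Rightarrow> 'a \<Rightarrow> 'a" where
  "nrec_step z F g = (if g = empty then z
     else the_or (\<lambda>y. \<exists>m u. opair m u \<epsilon> g \<and> (\<forall>k v. opair k v \<epsilon> g \<longrightarrow> k \<epsilon> succ m) \<and> y = F u))"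

definition nrec :: "'a \<Rightarrow> ('a \<Rightarrow> 'a) \<Rightarrow> 'a \<Rightarrow> 'a" where
  "nrec z F = trec (nrec_step z F)"

context
  fixes F assumes F: "definable_fun (\<lambda>s. F (s 0))"
begin

lemma definable_nrec_step: "definable_fun (\<lambda>s. nrec_step z F (s 0))"
  unfolding nrec_step_def by (intro dfn definable_fun_compose[OF F])

lemma definable_nrec: "definable_fun f \<Longrightarrow> definable_fun (\<lambda>s. nrec z F (f s))"
  unfolding nrec_def by (rule definable_trec[OF definable_nrec_step])

lemma nrec_empty[simp]: "nrec z F empty = z"
proof -
  have "lam empty (nrec z F) = empty"
    by (subst ext_iff) (simp add: mem_lam[OF definable_nrec[OF definable_fun_var]])
  moreover have "nrec z F empty = nrec_step z F (lam empty (nrec z F))"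
    unfolding nrec_def by (rule trec_unfold[OF definable_nrec_step ordinal_empty])
  ultimately show ?thesis by (simp add: nrec_step_def[of _ _ empty])
qed

lemma nrec_succ[simp]:
  assumes "m \<epsilon> omega"
  shows "nrec z F (succ m) = F (nrec z F m)"
proof -
  let ?g = "lam (succ m) (nrec z F)"
  have g: "p \<epsilon> ?g \<longleftrightarrow> (\<exists>x. x \<epsilon> succ m \<and> p = opair x (nrec z F x))" for p
    by (rule mem_lam[OF definable_nrec[OF definable_fun_var]])
  have "nrec z F (succ m) = nrec_step z F ?g"
    unfolding nrec_def by (rule trec_unfold[OF definable_nrec_step ordinal_nat[OF succ_omega[OF assms]]])
  also have "\<dots> = F (nrec z F m)"
  proof -
    have "opair m (nrec z F m) \<epsilon> ?g" unfolding g by auto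
    then have "?g \<noteq> empty" by auto
    moreover have "the_or (\<lambda>y. \<exists>k u. opair k u \<epsilon> ?g \<and> (\<forall>l v. opair l v \<epsilon> ?g \<longrightarrow> l \<epsilon> succ k) \<and> y = F u)
        = F (nrec z F m)"
    proof (rule the_or_eq)
      show "\<exists>k u. opair k u \<epsilon> ?g \<and> (\<forall>l v. opair l v \<epsilon> ?g \<longrightarrow> l \<epsilon> succ k) \<and> F (nrec z F m) = F u"
        unfolding g by (intro exI[of _ m] exI[of _ "nrec z F m"]) auto
      fix y assume "\<exists>k u. opair k u \<epsilon> ?g \<and> (\<forall>l v. opair l v \<epsilon> ?g \<longrightarrow> l \<epsilon> succ k) \<and> y = F u"
      then obtain k where k: "k \<epsilon> succ m" "y = F (nrec z F k)"
        and l: "\<And>l. l \<epsilon> succ m \<Longrightarrow> l \<epsilon> succ k"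
        unfolding g by auto
      have "m \<epsilon> succ k" using l by simp
      then have "k = m" using k(1) mem_asym by auto
      then show "y = F (nrec z F m)" using k by simp
    qed
    ultimately show ?thesis unfolding nrec_step_def by simp
  qed
  finally show ?thesis .
qed

end

section \<open>The cumulative hierarchy\<close>

definition least :: "('a \<Rightarrow> bool) \<Rightarrow> 'a" where
  "least P = the_or (\<lambda>a. ordinal a \<and> P a \<and> (\<forall>b. b \<epsilon> a \<longrightarrow> \<not> P b))"

lemma least_holds:
  assumes P: "definable (\<lambda>s. P (s 0))" and a: "ordinal a" "P a"
  shows ordinal_least: "ordinal (least P)" and least_prop: "P (least P)"
proof -
  obtain b where b: "b \<epsilon> succ a" "P b" "\<And>c. c \<epsilon> b \<Longrightarrow> c \<epsilon> succ a \<Longrightarrow> \<not> P c"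
    using foundation_definable[OF P, of a "succ a"] a(2) by auto
  have ob: "ordinal b" using b(1) ordinal_elem[OF ordinal_succ[OF a(1)]] by blast
  have lb: "\<not> P c" if "c \<epsilon> b" for c
    using b(3)[OF that] ordinal_trans[OF ordinal_succ[OF a(1)] b(1) that] by blast
  have "least P = b"
    unfolding least_def
  proof (rule the_or_eq)
    show "ordinal b \<and> P b \<and> (\<forall>c. c \<epsilon> b \<longrightarrow> \<not> P c)" using ob b(2) lb by blast
    fix c assume "ordinal c \<and> P c \<and> (\<forall>d. d \<epsilon> c \<longrightarrow> \<not> P d)"
    then show "c = b" using ordinal_linear[of c b] ob b(2) lb by blast
  qed
  then show "ordinal (least P)" "P (least P)" using ob b(2) by simp_all
qed

lemma definable_least[dfn]:
  assumes "definable (\<lambda>s. P (\<lambda>i. s (Suc i)) (s 0))"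
  shows "definable_fun (\<lambda>s. least (P s))"
proof -
  have 1: "definable (\<lambda>s. P (\<lambda>i. s (Suc (Suc i))) (s 0))"
    using definable_reindex[OF assms, of "case_nat 0 (\<lambda>i. Suc (Suc i))"] by simp
  show ?thesis unfolding least_def by (intro dfn assms 1)
qed

definition V_step :: "'a \<Rightarrow> 'a" where
  "V_step g = the_or (\<lambda>v. \<forall>z. z \<epsilon> v \<longleftrightarrow> (\<exists>x y. opair x y \<epsilon> g \<and> subset z y))"

text \<open>A definable stand-in for \<open>Vset\<close> that is total on the model; the two agree
  on ordinals by \<open>Vset_eq\<close>.\<close>

definition V :: "'a \<Rightarrow> 'a" where
  "V = trec V_step"

lemma definable_V_step: "definable_fun (\<lambda>s. V_step (s 0))"
  unfolding V_step_def by (intro dfn)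

lemma definable_V[dfn]: "definable_fun f \<Longrightarrow> definable_fun (\<lambda>s. V (f s))"
  unfolding V_def by (rule definable_trec[OF definable_V_step])

lemma mem_V:
  assumes "ordinal a"
  shows "z \<epsilon> V a \<longleftrightarrow> (\<exists>c. c \<epsilon> a \<and> subset z (V c))"
proof -
  have d: "definable_fun (\<lambda>s. V (s 0))" "definable_fun (\<lambda>s. pow (V (s 0)))" by (intro dfn)+
  have "V a = V_step (lam a V)" unfolding V_def by (rule trec_unfold[OF definable_V_step assms])
  also have "\<dots> = bigcup (repl a (\<lambda>c. pow (V c)))"
    unfolding V_step_def
  proof (rule the_or_eq)
    show "\<forall>z. z \<epsilon> bigcup (repl a (\<lambda>c. pow (V c))) \<longleftrightarrow> (\<exists>x y. opair x y \<epsilon> lam a V \<and> subset z y)"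
      by (auto simp: mem_lam[OF d(1)] mem_repl[OF d(2)])
    fix v assume "\<forall>z. z \<epsilon> v \<longleftrightarrow> (\<exists>x y. opair x y \<epsilon> lam a V \<and> subset z y)"
    then show "v = bigcup (repl a (\<lambda>c. pow (V c)))"
      by (subst ext_iff) (auto simp: mem_lam[OF d(1)] mem_repl[OF d(2)])
  qed
  finally show ?thesis by (auto simp: mem_repl[OF d(2)])
qed

lemma rank_hierarchy_app:
  assumes a: "ordinal a" and f: "rank_hierarchy a f" and b: "b \<epsilon> succ a"
  shows "app f b = V b"
proof -
  have fn: "function_on f (succ a)" using f unfolding rank_hierarchy_def by blast
  note sa = ordinal_succ[OF a]
  have "b \<epsilon> succ a \<longrightarrow> appd f b = V b"
  proof (rule ordinal_induct[OF ordinal_elem[OF sa b], where P = "\<lambda>b. b \<epsilon> succ a \<longrightarrow> appd f b = V b"])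
    show "definable (\<lambda>s. s 0 \<epsilon> succ a \<longrightarrow> appd f (s 0) = V (s 0))" by (intro dfn)
    fix b assume ob: "ordinal b" and IH: "\<And>c. c \<epsilon> b \<Longrightarrow> c \<epsilon> succ a \<longrightarrow> appd f c = V c"
    show "b \<epsilon> succ a \<longrightarrow> appd f b = V b"
    proof
      assume b: "b \<epsilon> succ a"
      have "app f c = V c" if "c \<epsilon> b" for c
        using IH[OF that] appd_eq_app[OF fn ordinal_trans[OF sa b that]] ordinal_trans[OF sa b that]
        by (simp only: simp_thms)
      then have "\<forall>z. z \<epsilon> V b \<longleftrightarrow> (\<exists>c. c \<epsilon> b \<and> subset z (app f c))"
        unfolding mem_V[OF ob] by metis
      then have "coll (\<lambda>z. \<exists>c. c \<epsilon> b \<and> subset z (app f c)) = V b" by (rule coll_eq)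
      then show "appd f b = V b"
        using f b unfolding rank_hierarchy_def by (simp add: appd_eq_app[OF fn] del: mem_succ)
    qed
  qed
  then show ?thesis using b by (simp add: appd_eq_app[OF fn] del: mem_succ)
qed

lemma Vset_eq:
  assumes a: "ordinal a"
  shows "Vset a = V a"
proof -
  have d: "definable_fun (\<lambda>s. V (s 0))" by (intro dfn)
  have "rank_hierarchy a (lam (succ a) V)"
    unfolding rank_hierarchy_def
  proof (intro conjI allI impI function_on_lam[OF d])
    fix b assume b: "b \<epsilon> succ a"
    have ob: "ordinal b" by (rule ordinal_elem[OF ordinal_succ[OF a] b])
    have "app (lam (succ a) V) c = V c" if "c \<epsilon> b" for c
      by (rule app_lam[OF d ordinal_trans[OF ordinal_succ[OF a] b that]])
    then have "\<forall>z. z \<epsilon> V b \<longleftrightarrow> (\<exists>c. c \<epsilon> b \<and> subset z (app (lam (succ a) V) c))"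
      unfolding mem_V[OF ob] by metis
    then have "coll (\<lambda>x. \<exists>c. c \<epsilon> b \<and> subset x (app (lam (succ a) V) c)) = V b" by (rule coll_eq)
    then show "app (lam (succ a) V) b = coll (\<lambda>x. \<exists>c. c \<epsilon> b \<and> subset x (app (lam (succ a) V) c))"
      using app_lam[OF d b] by simp
  qed
  then show ?thesis unfolding Vset_def using rank_hierarchy_app[OF a] by (intro the_equality) auto
qed

lemma V_mono: "ordinal a \<Longrightarrow> c \<epsilon> a \<Longrightarrow> subset (V c) (V a)"
  unfolding subset_def using mem_V[of a] mem_V[of c] ordinal_elem ordinal_trans by meson

lemma V_mono_subset: "ordinal a \<Longrightarrow> ordinal c \<Longrightarrow> subset c a \<Longrightarrow> subset (V c) (V a)"
  using V_mono ordinal_subset_iff[of c a] by auto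

lemma V_transitive: "ordinal a \<Longrightarrow> z \<epsilon> V a \<Longrightarrow> w \<epsilon> z \<Longrightarrow> w \<epsilon> V a"
  using mem_V[of a z] V_mono[of a] subsetD by blast

lemma transitive_V: "ordinal a \<Longrightarrow> transitive (V a)"
  unfolding transitive_def subset_def using V_transitive by blast

lemma V_mem_V: "ordinal a \<Longrightarrow> c \<epsilon> a \<Longrightarrow> V c \<epsilon> V a"
  using mem_V by auto

lemma V_subset_closed: "ordinal a \<Longrightarrow> z \<epsilon> V a \<Longrightarrow> subset w z \<Longrightarrow> w \<epsilon> V a"
  using mem_V[of a] subset_trans[of w z] by blast

lemma ordinal_subset_V:
  assumes "ordinal a"
  shows "subset a (V a)"
  using assms
proof (rule ordinal_induct[where P = "\<lambda>a. subset a (V a)"])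
  show "definable (\<lambda>s. subset (s 0) (V (s 0)))" by (intro dfn)
  show "subset x (V x)" if "ordinal x" "\<And>y. y \<epsilon> x \<Longrightarrow> subset y (V y)" for x
    using that mem_V[of x] unfolding subset_def[of x] by blast
qed

lemma ordinal_not_mem_V:
  assumes "ordinal a"
  shows "\<not> a \<epsilon> V a"
  using assms
proof (rule ordinal_induct[where P = "\<lambda>a. \<not> a \<epsilon> V a"])
  show "definable (\<lambda>s. \<not> s 0 \<epsilon> V (s 0))" by (intro dfn)
  show "\<not> x \<epsilon> V x" if "ordinal x" "\<And>y. y \<epsilon> x \<Longrightarrow> \<not> y \<epsilon> V y" for x
    using that mem_V[of x x] subsetD by blast
qed

lemma ordinal_mem_V: "ordinal a \<Longrightarrow> c \<epsilon> a \<Longrightarrow> c \<epsilon> V a"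
  using mem_V ordinal_subset_V ordinal_elem by blast

lemma ordinal_mem_V_iff:
  assumes "ordinal a" "ordinal c"
  shows "c \<epsilon> V a \<longleftrightarrow> c \<epsilon> a"
proof -
  have "\<not> c \<epsilon> V a" if "subset a c"
    using V_mono_subset[OF assms(2,1) that] ordinal_not_mem_V[OF assms(2)] subsetD by blast
  then show ?thesis
    using ordinal_mem_V[OF assms(1)] ordinal_linear[OF assms] ordinal_subset[OF assms(2)] by auto
qed

text \<open>The witness is the transitive closure of the singleton of \<open>x\<close>, the union of
  its omega many iterated unions.\<close>

lemma ex_transitive: "\<exists>T. transitive T \<and> x \<epsilon> T"
proof -
  have d: "definable_fun (\<lambda>s. bigcup (s 0))" by (intro dfn)
  let ?f = "nrec (upair x x) bigcup"
  have df: "definable_fun (\<lambda>s. ?f (s 0))" by (rule definable_nrec[OF d definable_fun_var])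
  let ?T = "bigcup (repl omega ?f)"
  have T: "y \<epsilon> ?T \<longleftrightarrow> (\<exists>m. m \<epsilon> omega \<and> y \<epsilon> ?f m)" for y by (auto simp: mem_repl[OF df])
  have "x \<epsilon> ?f empty" by (simp add: nrec_empty[OF d])
  then have "x \<epsilon> ?T" unfolding T using empty_omega by blast
  moreover have "z \<epsilon> ?T" if "y \<epsilon> ?T" "z \<epsilon> y" for y z
  proof -
    obtain m where m: "m \<epsilon> omega" "y \<epsilon> ?f m" using \<open>y \<epsilon> ?T\<close> unfolding T by blast
    then have "z \<epsilon> ?f (succ m)" using \<open>z \<epsilon> y\<close> by (auto simp: nrec_succ[OF d])
    then show ?thesis unfolding T using succ_omega[OF m(1)] by blast
  qed
  ultimately show ?thesis unfolding transitive_def subset_def by blast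
qed

text \<open>Least stages take the place of chosen ones; replacement and a supremum then bound them
  all at once.\<close>

lemma mem_V_if_subset:
  assumes "\<And>y. y \<epsilon> x \<Longrightarrow> \<exists>a. ordinal a \<and> y \<epsilon> V a"
  shows "\<exists>a. ordinal a \<and> x \<epsilon> V a"
proof -
  let ?F = "\<lambda>y. least (\<lambda>a. y \<epsilon> V a)"
  have dF: "definable_fun (\<lambda>s. ?F (s 0))" by (intro dfn)
  have d: "definable (\<lambda>s. y \<epsilon> V (s 0))" for y by (intro dfn)
  have F: "ordinal (?F y)" "y \<epsilon> V (?F y)" if "y \<epsilon> x" for y
    using assms[OF that] least_holds[OF d] by blast+
  let ?s = "bigcup (repl x ?F)"
  have s: "ordinal ?s" by (rule ordinal_bigcup) (use F(1) in \<open>auto simp: mem_repl[OF dF]\<close>)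
  have "y \<epsilon> V ?s" if "y \<epsilon> x" for y
  proof -
    have "subset (?F y) ?s" using that by (auto simp: subset_def mem_repl[OF dF])
    then show ?thesis using V_mono_subset[OF s F(1)[OF that]] F(2)[OF that] subsetD by blast
  qed
  then have "x \<epsilon> V (succ ?s)" unfolding mem_V[OF ordinal_succ[OF s]] by (auto simp: subset_def)
  then show ?thesis using ordinal_succ[OF s] by blast
qed

text \<open>In a transitive set around \<open>x\<close>, a minimal element without a stage would
  have all its elements in stages, which \<open>mem_V_if_subset\<close> excludes.\<close>

lemma ex_mem_V: "\<exists>a. ordinal a \<and> x \<epsilon> V a"
proof (rule ccontr)
  assume n: "\<not> (\<exists>a. ordinal a \<and> x \<epsilon> V a)"
  obtain T where T: "transitive T" "x \<epsilon> T" using ex_transitive by blast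
  have "definable (\<lambda>s. \<not> (\<exists>a. ordinal a \<and> s 0 \<epsilon> V a))" by (intro dfn)
  from foundation_definable[OF this T(2) n] obtain y where y: "y \<epsilon> T"
    "\<not> (\<exists>a. ordinal a \<and> y \<epsilon> V a)" "\<And>z. z \<epsilon> y \<Longrightarrow> z \<epsilon> T \<Longrightarrow> \<exists>a. ordinal a \<and> z \<epsilon> V a"
    by blast
  have "\<exists>a. ordinal a \<and> z \<epsilon> V a" if "z \<epsilon> y" for z
    using y(3)[OF that] T(1) y(1) that unfolding transitive_def subset_def by blast
  from mem_V_if_subset[OF this] y(2) show False by blast
qed

section \<open>Closure properties of limit stages\<close>

definition limit :: "'a \<Rightarrow> bool" where
  "limit l \<longleftrightarrow> ordinal l \<and> empty \<epsilon> l \<and> (\<forall>a. a \<epsilon> l \<longrightarrow> succ a \<epsilon> l)"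

context
  fixes l assumes l: "limit l"
begin

lemma limit_ordinal: "ordinal l"
  using l unfolding limit_def by blast

lemma mem_V_limit: "x \<epsilon> V l \<longleftrightarrow> (\<exists>c. c \<epsilon> l \<and> x \<epsilon> V c)"
proof
  assume "x \<epsilon> V l"
  then obtain c where c: "c \<epsilon> l" "subset x (V c)" using mem_V[OF limit_ordinal] by blast
  then have "x \<epsilon> V (succ c)" using mem_V[OF ordinal_succ[OF ordinal_elem[OF limit_ordinal c(1)]]] by auto
  then show "\<exists>c. c \<epsilon> l \<and> x \<epsilon> V c" using l c(1) unfolding limit_def by blast
next
  show "x \<epsilon> V l" if "\<exists>c. c \<epsilon> l \<and> x \<epsilon> V c"
    using that V_mono[OF limit_ordinal] subsetD by blast
qed

lemma subset_V_limit: "c \<epsilon> l \<Longrightarrow> subset x (V c) \<Longrightarrow> x \<epsilon> V l"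
  using mem_V[OF limit_ordinal] by blast

lemma pow_mem_V: "x \<epsilon> V l \<Longrightarrow> pow x \<epsilon> V l"
  unfolding mem_V_limit[of x] using V_subset_closed[OF ordinal_elem[OF limit_ordinal]]
  by (auto intro!: subset_V_limit simp: subset_def)

lemma bigcup_mem_V: "x \<epsilon> V l \<Longrightarrow> bigcup x \<epsilon> V l"
  unfolding mem_V_limit[of x] using V_transitive[OF ordinal_elem[OF limit_ordinal]]
  by (auto intro!: subset_V_limit simp: subset_def) blast

lemma upair_mem_V:
  assumes "x \<epsilon> V l" "y \<epsilon> V l"
  shows "upair x y \<epsilon> V l"
proof -
  obtain c d where c: "c \<epsilon> l" "x \<epsilon> V c" and d: "d \<epsilon> l" "y \<epsilon> V d"
    using assms mem_V_limit by blast
  have o: "ordinal c" "ordinal d" using ordinal_elem[OF limit_ordinal] c(1) d(1) by auto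
  then consider "subset c d" | "subset d c" using ordinal_linear ordinal_subset by (metis subset_refl)
  then show ?thesis
  proof cases
    case 1
    then have "x \<epsilon> V d" using V_mono_subset[OF o(2,1)] c(2) subsetD by blast
    then show ?thesis using d by (intro subset_V_limit[of d]) (auto simp: subset_def)
  next
    case 2
    then have "y \<epsilon> V c" using V_mono_subset[OF o] d(2) subsetD by blast
    then show ?thesis using c by (intro subset_V_limit[of c]) (auto simp: subset_def)
  qed
qed

lemma opair_mem_V: "x \<epsilon> V l \<Longrightarrow> y \<epsilon> V l \<Longrightarrow> opair x y \<epsilon> V l"
  unfolding opair_def by (intro upair_mem_V)

lemma cup_mem_V: "x \<epsilon> V l \<Longrightarrow> y \<epsilon> V l \<Longrightarrow> cup x y \<epsilon> V l"
  unfolding cup_def by (intro upair_mem_V bigcup_mem_V)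

lemma opair_mem_VD:
  assumes "opair x y \<epsilon> V l"
  shows "x \<epsilon> V l" "y \<epsilon> V l"
proof -
  have "upair x y \<epsilon> V l" by (rule V_transitive[OF limit_ordinal assms]) (simp add: opair_def)
  then show "x \<epsilon> V l" "y \<epsilon> V l" by (rule V_transitive[OF limit_ordinal], simp)+
qed

lemma pow_pow_cup_mem_V: "x \<epsilon> V l \<Longrightarrow> y \<epsilon> V l \<Longrightarrow> pow (pow (cup x y)) \<epsilon> V l"
  by (intro pow_mem_V cup_mem_V)

text \<open>Such a relation is a subset of \<open>pow (pow (cup x y))\<close>, which belongs to the
  limit stage. This places functions and restrictions in \<open>V l\<close> without computing
  ranks.\<close>

lemma relation_mem_V:
  assumes "x \<epsilon> V l" "y \<epsilon> V l" "\<And>p. p \<epsilon> r \<Longrightarrow> \<exists>u v. u \<epsilon> x \<and> v \<epsilon> y \<and> p = opair u v"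
  shows "r \<epsilon> V l"
proof (rule V_subset_closed[OF limit_ordinal pow_pow_cup_mem_V[OF assms(1,2)]])
  show "subset r (pow (pow (cup x y)))"
    unfolding subset_def using assms(3) by (force simp: opair_def subset_def)
qed

lemma nat_mem_V:
  assumes "m \<epsilon> omega"
  shows "m \<epsilon> V l"
proof -
  have "m \<epsilon> l" using assms
    by (rule omega_induct[where P = "\<lambda>m. m \<epsilon> l"]) (use l in \<open>auto simp: limit_def intro!: dfn\<close>)
  then show ?thesis using ordinal_mem_V[OF limit_ordinal] by blast
qed

end

section \<open>Formulas and satisfaction\<close>

lemma limit_omega: "limit omega"
  unfolding limit_def by (simp add: succ_omega)

lemma fm_simps[simp]:
  "cMem i j = cMem k l \<longleftrightarrow> i = k \<and> j = l" "cEq i j = cEq k l \<longleftrightarrow> i = k \<and> j = l"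
  "cNeg p = cNeg q \<longleftrightarrow> p = q" "cAnd p q = cAnd p' q' \<longleftrightarrow> p = p' \<and> q = q'"
  "cEx i p = cEx k q \<longleftrightarrow> i = k \<and> p = q" "cAll i p = cAll k q \<longleftrightarrow> i = k \<and> p = q"
  "cMem i j \<noteq> cEq k l" "cMem i j \<noteq> cNeg p" "cMem i j \<noteq> cAnd p q" "cMem i j \<noteq> cEx k p"
  "cEq i j \<noteq> cMem k l" "cEq i j \<noteq> cNeg p" "cEq i j \<noteq> cAnd p q" "cEq i j \<noteq> cEx k p"
  "cNeg p \<noteq> cMem k l" "cNeg p \<noteq> cEq k l" "cNeg p \<noteq> cAnd q r" "cNeg p \<noteq> cEx k q"
  "cAnd p q \<noteq> cMem k l" "cAnd p q \<noteq> cEq k l" "cAnd p q \<noteq> cNeg r" "cAnd p q \<noteq> cEx k r"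
  "cEx i p \<noteq> cMem k l" "cEx i p \<noteq> cEq k l" "cEx i p \<noteq> cNeg q" "cEx i p \<noteq> cAnd q r"
  unfolding cMem_def cEq_def cNeg_def cAnd_def cEx_def cAll_def
  by (simp_all del: num.simps)

lemma definable_fm_constructors[dfn]:
  shows "definable_fun f \<Longrightarrow> definable_fun g \<Longrightarrow> definable_fun (\<lambda>s. cMem (f s) (g s))"
    "definable_fun f \<Longrightarrow> definable_fun g \<Longrightarrow> definable_fun (\<lambda>s. cEq (f s) (g s))"
    "definable_fun f \<Longrightarrow> definable_fun (\<lambda>s. cNeg (f s))"
    "definable_fun f \<Longrightarrow> definable_fun g \<Longrightarrow> definable_fun (\<lambda>s. cAnd (f s) (g s))"
    "definable_fun f \<Longrightarrow> definable_fun g \<Longrightarrow> definable_fun (\<lambda>s. cEx (f s) (g s))"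
    "definable_fun f \<Longrightarrow> definable_fun g \<Longrightarrow> definable_fun (\<lambda>s. cAll (f s) (g s))"
  unfolding cMem_def cEq_def cNeg_def cAnd_def cEx_def cAll_def by (intro dfn; assumption)+

definition fm_step :: "'a \<Rightarrow> 'a \<Rightarrow> bool" where
  "fm_step F p \<longleftrightarrow>
     (\<exists>i j. i \<epsilon> omega \<and> j \<epsilon> omega \<and> (p = cMem i j \<or> p = cEq i j)) \<or>
     (\<exists>q. q \<epsilon> F \<and> p = cNeg q) \<or> (\<exists>q r. q \<epsilon> F \<and> r \<epsilon> F \<and> p = cAnd q r) \<or>
     (\<exists>i q. i \<epsilon> omega \<and> q \<epsilon> F \<and> p = cEx i q)"

definition delta0_step :: "'a \<Rightarrow> 'a \<Rightarrow> bool" where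
  "delta0_step F p \<longleftrightarrow>
     (\<exists>i j. i \<epsilon> omega \<and> j \<epsilon> omega \<and> (p = cMem i j \<or> p = cEq i j)) \<or>
     (\<exists>q. q \<epsilon> F \<and> p = cNeg q) \<or> (\<exists>q r. q \<epsilon> F \<and> r \<epsilon> F \<and> p = cAnd q r) \<or>
     (\<exists>i j q. i \<epsilon> omega \<and> j \<epsilon> omega \<and> i \<noteq> j \<and> q \<epsilon> F \<and> p = cEx i (cAnd (cMem i j) q))"

lemma definable_fm_step: "definable (\<lambda>s. fm_step (s 0) (s 1))"
  and definable_delta0_step: "definable (\<lambda>s. delta0_step (s 0) (s 1))"
  unfolding fm_step_def delta0_step_def by (intro dfn)+

lemma fm_step_simps:
  "fm_step F (cMem i j) \<longleftrightarrow> i \<epsilon> omega \<and> j \<epsilon> omega" "fm_step F (cEq i j) \<longleftrightarrow> i \<epsilon> omega \<and> j \<epsilon> omega"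
  "fm_step F (cNeg p) \<longleftrightarrow> p \<epsilon> F" "fm_step F (cAnd p q) \<longleftrightarrow> p \<epsilon> F \<and> q \<epsilon> F"
  "fm_step F (cEx i p) \<longleftrightarrow> i \<epsilon> omega \<and> p \<epsilon> F"
  by (simp_all add: fm_step_def)

lemma delta0_step_simps:
  "delta0_step F (cMem i j) \<longleftrightarrow> i \<epsilon> omega \<and> j \<epsilon> omega" "delta0_step F (cEq i j) \<longleftrightarrow> i \<epsilon> omega \<and> j \<epsilon> omega"
  "delta0_step F (cNeg p) \<longleftrightarrow> p \<epsilon> F" "delta0_step F (cAnd p q) \<longleftrightarrow> p \<epsilon> F \<and> q \<epsilon> F"
  "delta0_step F (cEx i (cAnd (cMem i j) p)) \<longleftrightarrow> i \<epsilon> omega \<and> j \<epsilon> omega \<and> i \<noteq> j \<and> p \<epsilon> F"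
  by (simp_all add: delta0_step_def)

text \<open>Codes of formulas are hereditarily finite, so \<open>V omega\<close> is a closed set of
  the kind that \<open>lfp_set\<close> requires.\<close>

lemma fm_step_bounded: "\<forall>p. fm_step (V omega) p \<longrightarrow> p \<epsilon> V omega"
  and delta0_step_bounded: "\<forall>p. delta0_step (V omega) p \<longrightarrow> p \<epsilon> V omega"
proof -
  have n: "num m \<epsilon> V omega" for m by (rule nat_mem_V[OF limit_omega num_omega])
  show "\<forall>p. fm_step (V omega) p \<longrightarrow> p \<epsilon> V omega" "\<forall>p. delta0_step (V omega) p \<longrightarrow> p \<epsilon> V omega"
    unfolding fm_step_def delta0_step_def cMem_def cEq_def cNeg_def cAnd_def cEx_def
    by (auto intro!: opair_mem_V[OF limit_omega] n intro: nat_mem_V[OF limit_omega] simp del: num.simps)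
qed

lemma fm_step_mono: "\<forall>W W' w. fm_step W w \<longrightarrow> subset W W' \<longrightarrow> fm_step W' w"
proof (intro allI impI)
  fix W W' w assume w: "fm_step W w" and sub: "subset W W'"
  show "fm_step W' w"
    using w[unfolded fm_step_def] by (elim disjE exE conjE; simp add: fm_step_simps subsetD[OF sub])
qed

lemma delta0_step_mono: "\<forall>W W' w. delta0_step W w \<longrightarrow> subset W W' \<longrightarrow> delta0_step W' w"
proof (intro allI impI)
  fix W W' w assume w: "delta0_step W w" and sub: "subset W W'"
  show "delta0_step W' w"
    using w[unfolded delta0_step_def] by (elim disjE exE conjE; simp add: delta0_step_simps subsetD[OF sub])
qed

definition FM :: 'a where "FM = lfp_set fm_step"

lemma is_fm_iff: "is_fm p \<longleftrightarrow> p \<epsilon> FM"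
proof -
  have "(\<forall>i j. i \<epsilon> omega \<and> j \<epsilon> omega \<longrightarrow> cMem i j \<epsilon> F \<and> cEq i j \<epsilon> F) \<and>
     (\<forall>q. q \<epsilon> F \<longrightarrow> cNeg q \<epsilon> F) \<and> (\<forall>q r. q \<epsilon> F \<and> r \<epsilon> F \<longrightarrow> cAnd q r \<epsilon> F) \<and>
     (\<forall>i q. i \<epsilon> omega \<and> q \<epsilon> F \<longrightarrow> cEx i q \<epsilon> F)
     \<longleftrightarrow> (\<forall>v. fm_step F v \<longrightarrow> v \<epsilon> F)" (is "?L \<longleftrightarrow> ?R") for F
  proof
    show ?R if ?L using that by (auto simp: fm_step_def)
    assume ?R
    then have F: "fm_step F v \<Longrightarrow> v \<epsilon> F" for v by blast
    show ?L by (intro conjI allI impI; rule F; simp add: fm_step_simps)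
  qed
  then show ?thesis
    unfolding is_fm_def FM_def mem_lfp_set[OF definable_fm_step fm_step_bounded] by simp
qed

lemma is_delta0_iff: "is_delta0 p \<longleftrightarrow> p \<epsilon> lfp_set delta0_step"
proof -
  have "(\<forall>i j. i \<epsilon> omega \<and> j \<epsilon> omega \<longrightarrow> cMem i j \<epsilon> F \<and> cEq i j \<epsilon> F) \<and>
     (\<forall>q. q \<epsilon> F \<longrightarrow> cNeg q \<epsilon> F) \<and> (\<forall>q r. q \<epsilon> F \<and> r \<epsilon> F \<longrightarrow> cAnd q r \<epsilon> F) \<and>
     (\<forall>i j q. i \<epsilon> omega \<and> j \<epsilon> omega \<and> i \<noteq> j \<and> q \<epsilon> F \<longrightarrow> cEx i (cAnd (cMem i j) q) \<epsilon> F)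
     \<longleftrightarrow> (\<forall>v. delta0_step F v \<longrightarrow> v \<epsilon> F)" (is "?L \<longleftrightarrow> ?R") for F
  proof
    show ?R if ?L using that by (auto simp: delta0_step_def)
    assume ?R
    then have F: "delta0_step F v \<Longrightarrow> v \<epsilon> F" for v by blast
    show ?L by (intro conjI allI impI; rule F; simp add: delta0_step_simps)
  qed
  then show ?thesis
    unfolding is_delta0_def mem_lfp_set[OF definable_delta0_step delta0_step_bounded] by simp
qed

lemma FM_intros:
  "i \<epsilon> omega \<Longrightarrow> j \<epsilon> omega \<Longrightarrow> cMem i j \<epsilon> FM" "i \<epsilon> omega \<Longrightarrow> j \<epsilon> omega \<Longrightarrow> cEq i j \<epsilon> FM"
  "p \<epsilon> FM \<Longrightarrow> cNeg p \<epsilon> FM" "p \<epsilon> FM \<Longrightarrow> q \<epsilon> FM \<Longrightarrow> cAnd p q \<epsilon> FM"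
  "i \<epsilon> omega \<Longrightarrow> p \<epsilon> FM \<Longrightarrow> cEx i p \<epsilon> FM" "i \<epsilon> omega \<Longrightarrow> p \<epsilon> FM \<Longrightarrow> cAll i p \<epsilon> FM"
proof -
  have c: "\<And>p. fm_step FM p \<Longrightarrow> p \<epsilon> FM"
    unfolding FM_def by (rule lfp_set_closed[OF definable_fm_step fm_step_bounded fm_step_mono])
  show "i \<epsilon> omega \<Longrightarrow> j \<epsilon> omega \<Longrightarrow> cMem i j \<epsilon> FM" "i \<epsilon> omega \<Longrightarrow> j \<epsilon> omega \<Longrightarrow> cEq i j \<epsilon> FM"
    "p \<epsilon> FM \<Longrightarrow> cNeg p \<epsilon> FM" "p \<epsilon> FM \<Longrightarrow> q \<epsilon> FM \<Longrightarrow> cAnd p q \<epsilon> FM"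
    "i \<epsilon> omega \<Longrightarrow> p \<epsilon> FM \<Longrightarrow> cEx i p \<epsilon> FM"
    by (rule c, simp add: fm_step_simps)+
  show "i \<epsilon> omega \<Longrightarrow> p \<epsilon> FM \<Longrightarrow> cAll i p \<epsilon> FM"
    unfolding cAll_def by ((rule c, simp add: fm_step_simps)+)
qed

lemma FM_induct:
  assumes "p \<epsilon> FM" and P: "definable (\<lambda>s. P (s 0))"
    and "\<And>i j. i \<epsilon> omega \<Longrightarrow> j \<epsilon> omega \<Longrightarrow> P (cMem i j)"
    and "\<And>i j. i \<epsilon> omega \<Longrightarrow> j \<epsilon> omega \<Longrightarrow> P (cEq i j)"
    and "\<And>q. q \<epsilon> FM \<Longrightarrow> P q \<Longrightarrow> P (cNeg q)"
    and "\<And>q r. q \<epsilon> FM \<Longrightarrow> r \<epsilon> FM \<Longrightarrow> P q \<Longrightarrow> P r \<Longrightarrow> P (cAnd q r)"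
    and "\<And>i q. i \<epsilon> omega \<Longrightarrow> q \<epsilon> FM \<Longrightarrow> P q \<Longrightarrow> P (cEx i q)"
  shows "P p"
proof (rule lfp_set_induct[OF definable_fm_step fm_step_bounded fm_step_mono assms(1)[unfolded FM_def] P])
  fix v assume "fm_step (sep (lfp_set fm_step) P) v"
  then show "P v"
    unfolding FM_def[symmetric] fm_step_def[of _ v] mem_sep[OF P] using assms(3-)
    by (elim disjE exE conjE; simp)
qed

lemma delta0_induct:
  assumes "is_delta0 p" and P: "definable (\<lambda>s. P (s 0))"
    and "\<And>i j. i \<epsilon> omega \<Longrightarrow> j \<epsilon> omega \<Longrightarrow> P (cMem i j)"
    and "\<And>i j. i \<epsilon> omega \<Longrightarrow> j \<epsilon> omega \<Longrightarrow> P (cEq i j)"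
    and "\<And>q. is_delta0 q \<Longrightarrow> P q \<Longrightarrow> P (cNeg q)"
    and "\<And>q r. is_delta0 q \<Longrightarrow> is_delta0 r \<Longrightarrow> P q \<Longrightarrow> P r \<Longrightarrow> P (cAnd q r)"
    and "\<And>i j q. i \<epsilon> omega \<Longrightarrow> j \<epsilon> omega \<Longrightarrow> i \<noteq> j \<Longrightarrow> is_delta0 q \<Longrightarrow> P q \<Longrightarrow>
      P (cEx i (cAnd (cMem i j) q))"
  shows "P p"
proof (rule lfp_set_induct[OF definable_delta0_step delta0_step_bounded delta0_step_mono
      assms(1)[unfolded is_delta0_iff] P])
  fix v assume "delta0_step (sep (lfp_set delta0_step) P) v"
  then show "P v"
    unfolding is_delta0_iff[symmetric] delta0_step_def[of _ v] mem_sep[OF P] using assms(3-)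
    by (elim disjE exE conjE; simp)
qed

lemma delta0_FM: "is_delta0 p \<Longrightarrow> p \<epsilon> FM"
  by (rule delta0_induct[where P = "\<lambda>p. p \<epsilon> FM"]) (simp_all add: FM_intros, intro dfn)

lemma FM_V: "q \<epsilon> FM \<Longrightarrow> q \<epsilon> V omega"
  by (rule FM_induct[where P = "\<lambda>q. q \<epsilon> V omega"], assumption, intro dfn)
    (use fm_step_bounded in \<open>auto simp: fm_step_simps dest: spec\<close>)

lemma definable_lam[dfn]:
  "definable_fun f \<Longrightarrow> definable_fun (\<lambda>s. F (\<lambda>i. s (Suc i)) (s 0)) \<Longrightarrow> definable_fun (\<lambda>s. lam (f s) (F s))"
proof -
  assume f: "definable_fun f" and F: "definable_fun (\<lambda>s. F (\<lambda>i. s (Suc i)) (s 0))"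
  have "lam A G = repl A (\<lambda>x. opair x (G x))" for A G unfolding lam_def repl_def ..
  then show ?thesis
    using definable_repl[OF f definable_opair[OF definable_fun_var[of 0] F]] by simp
qed

definition updd :: "'a \<Rightarrow> 'a \<Rightarrow> 'a \<Rightarrow> 'a" where
  "updd a i x = lam omega (\<lambda>k. if k = i then x else appd a k)"

lemma definable_updd[dfn]:
  "definable_fun f \<Longrightarrow> definable_fun g \<Longrightarrow> definable_fun h \<Longrightarrow>
    definable_fun (\<lambda>s. updd (f s) (g s) (h s))"
  unfolding updd_def
  by (intro dfn definable_fun_weaken[of f Suc] definable_fun_weaken[of g Suc] definable_fun_weaken[of h Suc])

lemma upd_eq_updd: "function_on a omega \<Longrightarrow> upd a i x = updd a i x"
  unfolding upd_def updd_def by (rule lam_cong) (simp add: appd_eq_app)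

lemma function_on_updd: "function_on (updd a i x) omega"
  unfolding updd_def by (rule function_on_lam) (intro dfn)

lemma app_updd: "function_on a omega \<Longrightarrow> k \<epsilon> omega \<Longrightarrow> app (updd a i x) k = (if k = i then x else app a k)"
  unfolding updd_def by (subst app_lam) (auto simp: appd_eq_app intro!: dfn)

lemma maps_function: "maps f A B \<Longrightarrow> function_on f A"
  unfolding maps_def by blast

lemma maps_app: "maps f A B \<Longrightarrow> x \<epsilon> A \<Longrightarrow> app f x \<epsilon> B"
  unfolding maps_def by blast

lemma maps_mono: "maps f A B \<Longrightarrow> subset B D \<Longrightarrow> maps f A D"
  unfolding maps_def subset_def by blast

lemma maps_updd: "maps a omega M \<Longrightarrow> x \<epsilon> M \<Longrightarrow> maps (updd a i x) omega M"
  unfolding maps_def by (simp add: function_on_updd app_updd)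

lemma satisfaction_rel_iff:
  "satisfaction_rel M S \<longleftrightarrow> (\<forall>a. maps a omega M \<longrightarrow>
     (\<forall>i j. i \<epsilon> omega \<and> j \<epsilon> omega \<longrightarrow>
        (opair (cMem i j) a \<epsilon> S \<longleftrightarrow> appd a i \<epsilon> appd a j) \<and>
        (opair (cEq i j) a \<epsilon> S \<longleftrightarrow> appd a i = appd a j)) \<and>
     (\<forall>p. p \<epsilon> FM \<longrightarrow> (opair (cNeg p) a \<epsilon> S \<longleftrightarrow> \<not> opair p a \<epsilon> S)) \<and>
     (\<forall>p q. p \<epsilon> FM \<and> q \<epsilon> FM \<longrightarrow>
        (opair (cAnd p q) a \<epsilon> S \<longleftrightarrow> opair p a \<epsilon> S \<and> opair q a \<epsilon> S)) \<and>
     (\<forall>i p. i \<epsilon> omega \<and> p \<epsilon> FM \<longrightarrow>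
        (opair (cEx i p) a \<epsilon> S \<longleftrightarrow> (\<exists>x. x \<epsilon> M \<and> opair p (updd a i x) \<epsilon> S))))"
  unfolding satisfaction_rel_def is_fm_iff
  by (rule iff_allI, rule imp_cong[OF refl], drule maps_function)
    (simp add: appd_eq_app upd_eq_updd cong: conj_cong imp_cong)

lemma definable_satisfaction_rel[dfn]:
  "definable_fun f \<Longrightarrow> definable_fun g \<Longrightarrow> definable (\<lambda>s. satisfaction_rel (f s) (g s))"
  by (rule definable_app2[of satisfaction_rel]) (unfold satisfaction_rel_iff, intro dfn)

lemma definable_satisfies[dfn]:
  "definable_fun f \<Longrightarrow> definable_fun g \<Longrightarrow> definable_fun h \<Longrightarrow>
    definable (\<lambda>s. satisfies (f s) (g s) (h s))"
  by (rule definable_app3[of satisfies]) (unfold satisfies_def, intro dfn)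

section \<open>Existence and uniqueness of satisfaction relations\<close>

definition cart :: "'a \<Rightarrow> 'a \<Rightarrow> 'a" where
  "cart X Y = sep (pow (pow (cup X Y))) (\<lambda>p. \<exists>x y. x \<epsilon> X \<and> y \<epsilon> Y \<and> p = opair x y)"

lemma mem_cart: "p \<epsilon> cart X Y \<longleftrightarrow> (\<exists>x y. x \<epsilon> X \<and> y \<epsilon> Y \<and> p = opair x y)"
proof -
  have "definable (\<lambda>s. \<exists>x y. x \<epsilon> X \<and> y \<epsilon> Y \<and> s 0 = opair x y)" by (intro dfn)
  then show ?thesis unfolding cart_def by (subst mem_sep) (force simp: opair_def subset_def)+
qed

definition Asg :: "'a \<Rightarrow> 'a" where
  "Asg M = sep (pow (cart omega M)) (\<lambda>a. maps a omega M)"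

lemma mem_Asg[simp]: "a \<epsilon> Asg M \<longleftrightarrow> maps a omega M"
proof -
  have "subset a (cart omega M)" if "maps a omega M"
    unfolding subset_def mem_cart
    using function_memE[OF maps_function[OF that]] maps_app[OF that] by metis
  moreover have "definable (\<lambda>s. maps (s 0) omega M)" by (intro dfn)
  ultimately show ?thesis unfolding Asg_def by (auto simp: mem_sep)
qed

context
  fixes M :: 'a
begin

text \<open>Because of negation, the clauses for satisfaction are not monotone as clauses about
  pairs of a code and an assignment. They become monotone for pairs of a code and its whole truth
  set, so that \<open>lfp_set\<close> applies.\<close>

definition truth_step :: "'a \<Rightarrow> 'a \<Rightarrow> bool" where
  "truth_step W w \<longleftrightarrow>
    (\<exists>i j. i \<epsilon> omega \<and> j \<epsilon> omega \<and> (w = opair (cMem i j) (sep (Asg M) (\<lambda>a. appd a i \<epsilon> appd a j)) \<or>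
      w = opair (cEq i j) (sep (Asg M) (\<lambda>a. appd a i = appd a j)))) \<or>
    (\<exists>q T. opair q T \<epsilon> W \<and> w = opair (cNeg q) (sep (Asg M) (\<lambda>a. \<not> a \<epsilon> T))) \<or>
    (\<exists>q r T U. opair q T \<epsilon> W \<and> opair r U \<epsilon> W \<and> w = opair (cAnd q r) (sep (Asg M) (\<lambda>a. a \<epsilon> T \<and> a \<epsilon> U))) \<or>
    (\<exists>i q T. i \<epsilon> omega \<and> opair q T \<epsilon> W \<and>
      w = opair (cEx i q) (sep (Asg M) (\<lambda>a. \<exists>x. x \<epsilon> M \<and> updd a i x \<epsilon> T)))"

lemma definable_truth_step: "definable (\<lambda>s. truth_step (s 0) (s 1))"
  unfolding truth_step_def by (intro dfn)

lemma truth_step_simps: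
  "truth_step W (opair (cMem i j) X) \<longleftrightarrow> i \<epsilon> omega \<and> j \<epsilon> omega \<and> X = sep (Asg M) (\<lambda>a. appd a i \<epsilon> appd a j)"
  "truth_step W (opair (cEq i j) X) \<longleftrightarrow> i \<epsilon> omega \<and> j \<epsilon> omega \<and> X = sep (Asg M) (\<lambda>a. appd a i = appd a j)"
  "truth_step W (opair (cNeg q) X) \<longleftrightarrow> (\<exists>T. opair q T \<epsilon> W \<and> X = sep (Asg M) (\<lambda>a. \<not> a \<epsilon> T))"
  "truth_step W (opair (cAnd q r) X) \<longleftrightarrow> (\<exists>T U. opair q T \<epsilon> W \<and> opair r U \<epsilon> W \<and>
    X = sep (Asg M) (\<lambda>a. a \<epsilon> T \<and> a \<epsilon> U))"
  "truth_step W (opair (cEx i q) X) \<longleftrightarrow> (\<exists>T. i \<epsilon> omega \<and> opair q T \<epsilon> W \<and>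
    X = sep (Asg M) (\<lambda>a. \<exists>x. x \<epsilon> M \<and> updd a i x \<epsilon> T))"
  by (simp_all add: truth_step_def) blast+

lemma truth_step_mono: "\<forall>W W' w. truth_step W w \<longrightarrow> subset W W' \<longrightarrow> truth_step W' w"
proof (intro allI impI)
  fix W W' w assume w: "truth_step W w" and sub: "subset W W'"
  show "truth_step W' w"
    using w[unfolded truth_step_def] by (elim disjE exE conjE; simp add: truth_step_simps; blast intro: subsetD[OF sub])
qed

lemma sep_subset: "definable (\<lambda>s. P (s 0)) \<Longrightarrow> subset (sep x P) x"
  unfolding subset_def by (simp add: mem_sep)

lemma truth_step_bounded:
  "\<forall>w. truth_step (cart FM (pow (Asg M))) w \<longrightarrow> w \<epsilon> cart FM (pow (Asg M))"
proof -
  have 1: "subset (sep (Asg M) (\<lambda>a. appd a i \<epsilon> appd a j)) (Asg M)"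
    "subset (sep (Asg M) (\<lambda>a. appd a i = appd a j)) (Asg M)"
    "subset (sep (Asg M) (\<lambda>a. \<not> a \<epsilon> T)) (Asg M)"
    "subset (sep (Asg M) (\<lambda>a. a \<epsilon> T \<and> a \<epsilon> U)) (Asg M)"
    "subset (sep (Asg M) (\<lambda>a. \<exists>x. x \<epsilon> M \<and> updd a i x \<epsilon> T)) (Asg M)" for i j T U
    by (rule sep_subset, intro dfn)+
  have "opair p T \<epsilon> cart FM (pow (Asg M)) \<longleftrightarrow> p \<epsilon> FM \<and> subset T (Asg M)" for p T
    unfolding mem_cart by simp
  then show ?thesis unfolding truth_step_def by (auto simp: 1 intro: FM_intros)
qed

definition truth_sets :: 'a where "truth_sets = lfp_set truth_step"

lemma truth_sets_iff: "w \<epsilon> truth_sets \<longleftrightarrow> truth_step truth_sets w"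
  unfolding truth_sets_def
  using lfp_set_closed[OF definable_truth_step truth_step_bounded truth_step_mono]
    lfp_set_cases[OF definable_truth_step truth_step_bounded truth_step_mono] by blast

lemma truth_sets_simps:
  "i \<epsilon> omega \<Longrightarrow> j \<epsilon> omega \<Longrightarrow> opair (cMem i j) X \<epsilon> truth_sets \<longleftrightarrow> X = sep (Asg M) (\<lambda>a. appd a i \<epsilon> appd a j)"
  "i \<epsilon> omega \<Longrightarrow> j \<epsilon> omega \<Longrightarrow> opair (cEq i j) X \<epsilon> truth_sets \<longleftrightarrow> X = sep (Asg M) (\<lambda>a. appd a i = appd a j)"
  "opair (cNeg q) X \<epsilon> truth_sets \<longleftrightarrow> (\<exists>T. opair q T \<epsilon> truth_sets \<and> X = sep (Asg M) (\<lambda>a. \<not> a \<epsilon> T))"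
  "opair (cAnd q r) X \<epsilon> truth_sets \<longleftrightarrow> (\<exists>T U. opair q T \<epsilon> truth_sets \<and> opair r U \<epsilon> truth_sets \<and>
    X = sep (Asg M) (\<lambda>a. a \<epsilon> T \<and> a \<epsilon> U))"
  "i \<epsilon> omega \<Longrightarrow> opair (cEx i q) X \<epsilon> truth_sets \<longleftrightarrow> (\<exists>T. opair q T \<epsilon> truth_sets \<and>
    X = sep (Asg M) (\<lambda>a. \<exists>x. x \<epsilon> M \<and> updd a i x \<epsilon> T))"
  unfolding truth_sets_iff[of "opair (cMem i j) X"] truth_sets_iff[of "opair (cEq i j) X"]
    truth_sets_iff[of "opair (cNeg q) X"] truth_sets_iff[of "opair (cAnd q r) X"]
    truth_sets_iff[of "opair (cEx i q) X"]
  by (simp_all add: truth_step_simps)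

lemma ex1_truth_set:
  assumes "p \<epsilon> FM"
  shows "\<exists>!T. opair p T \<epsilon> truth_sets"
  using assms
proof (rule FM_induct[where P = "\<lambda>p. \<exists>!T. opair p T \<epsilon> truth_sets"])
  show "definable (\<lambda>s. \<exists>!T. opair (s 0) T \<epsilon> truth_sets)" by (intro dfn)
next
  fix q assume "\<exists>!T. opair q T \<epsilon> truth_sets"
  then obtain T where T: "\<And>X. opair q X \<epsilon> truth_sets \<longleftrightarrow> X = T" by metis
  show "\<exists>!T. opair (cNeg q) T \<epsilon> truth_sets" by (simp add: truth_sets_simps T)
  show "\<exists>!T. opair (cEx i q) T \<epsilon> truth_sets" if "i \<epsilon> omega" for i
    using that by (simp add: truth_sets_simps T)
  fix r assume "\<exists>!T. opair r T \<epsilon> truth_sets"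
  then obtain U where U: "\<And>X. opair r X \<epsilon> truth_sets \<longleftrightarrow> X = U" by metis
  show "\<exists>!T. opair (cAnd q r) T \<epsilon> truth_sets" by (simp add: truth_sets_simps T U)
qed (simp_all add: truth_sets_simps)

definition truth_set :: "'a \<Rightarrow> 'a" where
  "truth_set p = the_or (\<lambda>T. opair p T \<epsilon> truth_sets)"

lemma truth_set_iff: "p \<epsilon> FM \<Longrightarrow> opair p T \<epsilon> truth_sets \<longleftrightarrow> T = truth_set p"
  unfolding truth_set_def using the_or_holds[OF ex1_truth_set] ex1_truth_set[of p] by auto

lemma mem_truth_set:
  "i \<epsilon> omega \<Longrightarrow> j \<epsilon> omega \<Longrightarrow> a \<epsilon> truth_set (cMem i j) \<longleftrightarrow> maps a omega M \<and> appd a i \<epsilon> appd a j"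
  "i \<epsilon> omega \<Longrightarrow> j \<epsilon> omega \<Longrightarrow> a \<epsilon> truth_set (cEq i j) \<longleftrightarrow> maps a omega M \<and> appd a i = appd a j"
  "q \<epsilon> FM \<Longrightarrow> a \<epsilon> truth_set (cNeg q) \<longleftrightarrow> maps a omega M \<and> \<not> a \<epsilon> truth_set q"
  "q \<epsilon> FM \<Longrightarrow> r \<epsilon> FM \<Longrightarrow> a \<epsilon> truth_set (cAnd q r) \<longleftrightarrow> maps a omega M \<and> a \<epsilon> truth_set q \<and> a \<epsilon> truth_set r"
  "i \<epsilon> omega \<Longrightarrow> q \<epsilon> FM \<Longrightarrow> a \<epsilon> truth_set (cEx i q) \<longleftrightarrow>
    maps a omega M \<and> (\<exists>x. x \<epsilon> M \<and> updd a i x \<epsilon> truth_set q)"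
proof -
  have sep: "b \<epsilon> sep (Asg M) (\<lambda>a. appd a i \<epsilon> appd a j) \<longleftrightarrow> maps b omega M \<and> appd b i \<epsilon> appd b j"
    "b \<epsilon> sep (Asg M) (\<lambda>a. appd a i = appd a j) \<longleftrightarrow> maps b omega M \<and> appd b i = appd b j"
    "b \<epsilon> sep (Asg M) (\<lambda>a. \<not> a \<epsilon> T) \<longleftrightarrow> maps b omega M \<and> \<not> b \<epsilon> T"
    "b \<epsilon> sep (Asg M) (\<lambda>a. a \<epsilon> T \<and> a \<epsilon> U) \<longleftrightarrow> maps b omega M \<and> b \<epsilon> T \<and> b \<epsilon> U"
    "b \<epsilon> sep (Asg M) (\<lambda>a. \<exists>x. x \<epsilon> M \<and> updd a i x \<epsilon> T) \<longleftrightarrow>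
      maps b omega M \<and> (\<exists>x. x \<epsilon> M \<and> updd b i x \<epsilon> T)" for b i j T U
    by (subst mem_sep, intro dfn, simp)+
  note t = truth_set_iff[THEN iffD1, symmetric]
  show "a \<epsilon> truth_set (cMem i j) \<longleftrightarrow> maps a omega M \<and> appd a i \<epsilon> appd a j" if "i \<epsilon> omega" "j \<epsilon> omega"
    using t[OF FM_intros(1)[OF that] truth_sets_simps(1)[OF that, THEN iffD2, OF refl]] sep(1) by simp
  show "a \<epsilon> truth_set (cEq i j) \<longleftrightarrow> maps a omega M \<and> appd a i = appd a j" if "i \<epsilon> omega" "j \<epsilon> omega"
    using t[OF FM_intros(2)[OF that] truth_sets_simps(2)[OF that, THEN iffD2, OF refl]] sep(2) by simp
  have m: "opair q (truth_set q) \<epsilon> truth_sets" if "q \<epsilon> FM" for q using truth_set_iff[OF that] by simp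
  show "a \<epsilon> truth_set (cNeg q) \<longleftrightarrow> maps a omega M \<and> \<not> a \<epsilon> truth_set q" if q: "q \<epsilon> FM"
    using t[OF FM_intros(3)[OF q] truth_sets_simps(3)[THEN iffD2, OF exI, OF conjI, OF m[OF q] refl]] sep(3)
    by simp
  show "a \<epsilon> truth_set (cAnd q r) \<longleftrightarrow> maps a omega M \<and> a \<epsilon> truth_set q \<and> a \<epsilon> truth_set r"
    if q: "q \<epsilon> FM" "r \<epsilon> FM"
    using t[OF FM_intros(4)[OF q] truth_sets_simps(4)[THEN iffD2, OF exI, OF exI, OF conjI,
          OF m[OF q(1)] conjI, OF m[OF q(2)] refl]] sep(4)
    by simp
  show "a \<epsilon> truth_set (cEx i q) \<longleftrightarrow> maps a omega M \<and> (\<exists>x. x \<epsilon> M \<and> updd a i x \<epsilon> truth_set q)"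
    if q: "i \<epsilon> omega" "q \<epsilon> FM"
    using t[OF FM_intros(5)[OF q] truth_sets_simps(5)[OF q(1), THEN iffD2, OF exI, OF conjI, OF m[OF q(2)] refl]] sep(5)
    by simp
qed

lemma ex_satisfaction_rel: "\<exists>S. satisfaction_rel M S"
proof -
  define S where "S = sep (cart FM (Asg M)) (\<lambda>p. \<exists>q a T. p = opair q a \<and> opair q T \<epsilon> truth_sets \<and> a \<epsilon> T)"
  have d: "definable (\<lambda>s. \<exists>q a T. s 0 = opair q a \<and> opair q T \<epsilon> truth_sets \<and> a \<epsilon> T)" by (intro dfn)
  have S: "opair p a \<epsilon> S \<longleftrightarrow> a \<epsilon> truth_set p" if "p \<epsilon> FM" "maps a omega M" for p a
    unfolding S_def mem_sep[OF d] mem_cart using that by (simp add: truth_set_iff)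
  have "satisfaction_rel M S"
    unfolding satisfaction_rel_iff
    by (simp add: S FM_intros mem_truth_set maps_updd cong: conj_cong)
  then show ?thesis by blast
qed

end

text \<open>Makes the witness \<open>S\<close> in \<open>satisfies\<close> immaterial, so that
  satisfaction can be read off any one satisfaction relation.\<close>

lemma satisfaction_rel_unique:
  assumes S: "satisfaction_rel M S" "satisfaction_rel M S'" and "p \<epsilon> FM"
  shows "\<forall>a. maps a omega M \<longrightarrow> (opair p a \<epsilon> S \<longleftrightarrow> opair p a \<epsilon> S')"
  using assms(3)
proof (rule FM_induct[where P = "\<lambda>p. \<forall>a. maps a omega M \<longrightarrow> (opair p a \<epsilon> S \<longleftrightarrow> opair p a \<epsilon> S')"])
  show "definable (\<lambda>s. \<forall>a. maps a omega M \<longrightarrow> (opair (s 0) a \<epsilon> S \<longleftrightarrow> opair (s 0) a \<epsilon> S'))" by (intro dfn)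
qed (use S in \<open>simp_all add: satisfaction_rel_iff maps_updd cong: conj_cong\<close>)

lemma satisfies_iff:
  assumes "satisfaction_rel M S" "p \<epsilon> FM" "maps a omega M"
  shows "satisfies M p a \<longleftrightarrow> opair p a \<epsilon> S"
  unfolding satisfies_def using satisfaction_rel_unique[OF assms(1) _ assms(2)] assms by blast

lemma satisfies_simps:
  assumes a: "maps a omega M"
  shows satisfies_Mem: "i \<epsilon> omega \<Longrightarrow> j \<epsilon> omega \<Longrightarrow> satisfies M (cMem i j) a \<longleftrightarrow> app a i \<epsilon> app a j"
    and satisfies_Eq: "i \<epsilon> omega \<Longrightarrow> j \<epsilon> omega \<Longrightarrow> satisfies M (cEq i j) a \<longleftrightarrow> app a i = app a j"
    and satisfies_Neg: "p \<epsilon> FM \<Longrightarrow> satisfies M (cNeg p) a \<longleftrightarrow> \<not> satisfies M p a"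
    and satisfies_And: "p \<epsilon> FM \<Longrightarrow> q \<epsilon> FM \<Longrightarrow> satisfies M (cAnd p q) a \<longleftrightarrow> satisfies M p a \<and> satisfies M q a"
    and satisfies_Ex: "i \<epsilon> omega \<Longrightarrow> p \<epsilon> FM \<Longrightarrow>
      satisfies M (cEx i p) a \<longleftrightarrow> (\<exists>x. x \<epsilon> M \<and> satisfies M p (updd a i x))"
    and satisfies_All: "i \<epsilon> omega \<Longrightarrow> p \<epsilon> FM \<Longrightarrow>
      satisfies M (cAll i p) a \<longleftrightarrow> (\<forall>x. x \<epsilon> M \<longrightarrow> satisfies M p (updd a i x))"
proof -
  obtain S where S: "satisfaction_rel M S" using ex_satisfaction_rel by blast
  note e = satisfies_iff[OF S] and r = S[unfolded satisfaction_rel_iff, rule_format, OF a]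
  show "i \<epsilon> omega \<Longrightarrow> j \<epsilon> omega \<Longrightarrow> satisfies M (cMem i j) a \<longleftrightarrow> app a i \<epsilon> app a j"
    "i \<epsilon> omega \<Longrightarrow> j \<epsilon> omega \<Longrightarrow> satisfies M (cEq i j) a \<longleftrightarrow> app a i = app a j"
    "p \<epsilon> FM \<Longrightarrow> q \<epsilon> FM \<Longrightarrow> satisfies M (cAnd p q) a \<longleftrightarrow> satisfies M p a \<and> satisfies M q a"
    using r a by (simp_all add: e FM_intros appd_eq_app[OF maps_function[OF a]])
  have neg: "satisfies M (cNeg p) a \<longleftrightarrow> \<not> satisfies M p a" if "p \<epsilon> FM" "maps a omega M" for p a
    using S[unfolded satisfaction_rel_iff, rule_format, OF that(2)] that by (simp add: e FM_intros)
  have ex: "satisfies M (cEx i p) a \<longleftrightarrow> (\<exists>x. x \<epsilon> M \<and> satisfies M p (updd a i x))" if "i \<epsilon> omega" "p \<epsilon> FM" for p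
    using r a that by (simp add: e FM_intros maps_updd cong: conj_cong)
  show "p \<epsilon> FM \<Longrightarrow> satisfies M (cNeg p) a \<longleftrightarrow> \<not> satisfies M p a" using neg a by blast
  show "i \<epsilon> omega \<Longrightarrow> p \<epsilon> FM \<Longrightarrow> satisfies M (cEx i p) a \<longleftrightarrow> (\<exists>x. x \<epsilon> M \<and> satisfies M p (updd a i x))"
    by (rule ex)
  show "satisfies M (cAll i p) a \<longleftrightarrow> (\<forall>x. x \<epsilon> M \<longrightarrow> satisfies M p (updd a i x))" if "i \<epsilon> omega" "p \<epsilon> FM"
    unfolding cAll_def using that a by (auto simp: neg ex FM_intros maps_updd)
qed

section \<open>Absoluteness and locality of truth\<close>

text \<open>In the bounded quantifier case the candidates are elements of \<open>app a j\<close>,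
  hence of the transitive set \<open>T\<close>, so the larger set offers no new ones.\<close>

lemma delta0_absolute_subset:
  assumes "is_delta0 p" and T: "transitive T" and sub: "subset T T'" and a: "maps a omega T"
  shows "satisfies T p a \<longleftrightarrow> satisfies T' p a"
proof -
  have "\<forall>a. maps a omega T \<longrightarrow> (satisfies T p a \<longleftrightarrow> satisfies T' p a)"
    using assms(1)
  proof (rule delta0_induct[where P = "\<lambda>p. \<forall>a. maps a omega T \<longrightarrow> (satisfies T p a \<longleftrightarrow> satisfies T' p a)"])
    show "definable (\<lambda>s. \<forall>a. maps a omega T \<longrightarrow> (satisfies T (s 0) a \<longleftrightarrow> satisfies T' (s 0) a))"
      by (intro dfn)
  next
    fix i j q
    assume ij: "i \<epsilon> omega" "j \<epsilon> omega" "i \<noteq> j" and q: "is_delta0 q"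
      and IH: "\<forall>a. maps a omega T \<longrightarrow> (satisfies T q a \<longleftrightarrow> satisfies T' q a)"
    show "\<forall>a. maps a omega T \<longrightarrow> (satisfies T (cEx i (cAnd (cMem i j) q)) a \<longleftrightarrow>
        satisfies T' (cEx i (cAnd (cMem i j) q)) a)"
    proof (intro allI impI)
      fix a assume a: "maps a omega T"
      note a' = maps_mono[OF a sub]
      have ex: "satisfies M (cEx i (cAnd (cMem i j) q)) a \<longleftrightarrow>
          (\<exists>x. x \<epsilon> M \<and> x \<epsilon> app a j \<and> satisfies M q (updd a i x))" if m: "maps a omega M" for M
        using ij delta0_FM[OF q] m maps_updd[OF m]
        by (simp add: satisfies_Ex satisfies_And satisfies_Mem FM_intros app_updd[OF maps_function[OF m]]
            cong: conj_cong)
      have "x \<epsilon> T" if "x \<epsilon> app a j" for x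
        using T maps_app[OF a ij(2)] that unfolding transitive_def subset_def by blast
      then show "satisfies T (cEx i (cAnd (cMem i j) q)) a \<longleftrightarrow> satisfies T' (cEx i (cAnd (cMem i j) q)) a"
        unfolding ex[OF a] ex[OF a'] using IH maps_updd[OF a] subsetD[OF sub] by blast
    qed
  qed (use sub in \<open>simp_all add: satisfies_Mem satisfies_Eq satisfies_Neg satisfies_And delta0_FM maps_mono\<close>)
  then show ?thesis using a by blast
qed

text \<open>Both sets are compared with their intersection, which is transitive and still contains
  the values of \<open>a\<close>.\<close>

lemma delta0_absolute:
  assumes p: "is_delta0 p" and T: "transitive T" "maps a omega T" and T': "transitive T'" "maps a omega T'"
  shows "satisfies T p a \<longleftrightarrow> satisfies T' p a"
proof -
  have d: "definable (\<lambda>s. s 0 \<epsilon> T')" by (intro dfn)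
  let ?I = "sep T (\<lambda>x. x \<epsilon> T')"
  have "transitive ?I" using T(1) T'(1) unfolding transitive_def subset_def mem_sep[OF d] by blast
  moreover have "maps a omega ?I" using T(2) T'(2) unfolding maps_def mem_sep[OF d] by blast
  moreover have "subset ?I T" "subset ?I T'" unfolding subset_def mem_sep[OF d] by blast+
  ultimately show ?thesis using delta0_absolute_subset[OF p] by metis
qed

lemma function_maps_V:
  assumes "function_on a D" "ordinal c" "a \<epsilon> V c"
  shows "maps a D (V c)"
  unfolding maps_def
proof (intro conjI assms(1) allI impI)
  fix i assume "i \<epsilon> D"
  then have "opair i (app a i) \<epsilon> V c" using V_transitive[OF assms(2,3)] function_app_mem[OF assms(1)] by blast
  then have "upair i (app a i) \<epsilon> V c" by (rule V_transitive[OF assms(2)]) (simp add: opair_def)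
  then show "app a i \<epsilon> V c" by (rule V_transitive[OF assms(2)]) simp
qed

lemma delta0_true_V:
  assumes "is_delta0 p" "transitive T" "maps a omega T"
  shows "delta0_true p a \<longleftrightarrow> satisfies T p a"
  unfolding delta0_true_def using delta0_absolute[OF assms(1)] assms(2,3) by blast

section \<open>Dependence of truth on finitely many values of the assignment\<close>

lemma ex_nat_above:
  assumes "i \<epsilon> omega" "j \<epsilon> omega"
  obtains n where "n \<epsilon> omega" "i \<epsilon> n" "j \<epsilon> n" "subset i n" "subset j n"
proof -
  note o = ordinal_nat[OF assms(1)] ordinal_nat[OF assms(2)]
  have "\<exists>n. n \<epsilon> omega \<and> i \<epsilon> n \<and> j \<epsilon> n"
  proof (cases "i \<epsilon> j")
    case True
    then show ?thesis by (intro exI[of _ "succ j"]) (simp add: succ_omega[OF assms(2)])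
  next
    case False
    then have "j \<epsilon> succ i" using ordinal_linear[OF o] by auto
    then show ?thesis by (intro exI[of _ "succ i"]) (simp add: succ_omega[OF assms(1)])
  qed
  then show thesis using that ordinal_subset[OF ordinal_nat] by blast
qed

definition agree :: "'a \<Rightarrow> 'a \<Rightarrow> 'a \<Rightarrow> bool" where
  "agree n a b \<longleftrightarrow> function_on a omega \<and> function_on b omega \<and> (\<forall>i. i \<epsilon> n \<longrightarrow> appd a i = appd b i)"

lemma definable_agree[dfn]:
  "definable_fun f \<Longrightarrow> definable_fun g \<Longrightarrow> definable_fun h \<Longrightarrow> definable (\<lambda>s. agree (f s) (g s) (h s))"
  by (rule definable_app3[of agree]) (unfold agree_def, intro dfn)

lemma agree_subset: "agree n a b \<Longrightarrow> subset m n \<Longrightarrow> agree m a b"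
  unfolding agree_def subset_def by blast

lemma agree_app:
  assumes "agree n a b" "i \<epsilon> n" "n \<epsilon> omega"
  shows "app a i = app b i"
  using assms(1,2) mem_nat_omega[OF assms(3,2)] unfolding agree_def by (auto simp: appd_eq_app)

lemma agree_updd:
  assumes "agree n a b" "n \<epsilon> omega"
  shows "agree n (updd a i x) (updd b i x)"
  unfolding agree_def
proof (intro conjI function_on_updd allI impI)
  fix k assume k: "k \<epsilon> n"
  then have "k \<epsilon> omega" by (rule mem_nat_omega[OF assms(2)])
  then show "appd (updd a i x) k = appd (updd b i x) k"
    using assms(1) agree_app[OF assms(1) k assms(2)] unfolding agree_def
    by (simp add: appd_eq_app[OF function_on_updd] app_updd)
qed

text \<open>Codes may be nonstandard, so the bound \<open>n\<close> is an element of
  \<open>omega\<close> rather than a metatheoretic number and the induction is internal. The bound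
  is uniform in \<open>M\<close>, which lets it pass to truth in the universe.\<close>

lemma satisfies_support:
  assumes "p \<epsilon> FM"
  shows "\<exists>n. n \<epsilon> omega \<and> (\<forall>M a b. maps a omega M \<longrightarrow> maps b omega M \<longrightarrow> agree n a b \<longrightarrow>
    (satisfies M p a \<longleftrightarrow> satisfies M p b))" (is "?P p")
  using assms
proof (rule FM_induct[where P = "\<lambda>p. ?P p"])
  show "definable (\<lambda>s. ?P (s 0))" by (intro dfn)
next
  fix i j assume ij: "i \<epsilon> omega" "j \<epsilon> omega"
  from ex_nat_above[OF this] obtain n where n: "n \<epsilon> omega" "i \<epsilon> n" "j \<epsilon> n" by blast
  have "app a i = app b i" "app a j = app b j" if "agree n a b" for a b
    using agree_app[OF that] n by blast+
  then show "?P (cMem i j)" "?P (cEq i j)"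
    using n(1) by (auto intro!: exI[of _ n] simp: satisfies_Mem[OF _ ij] satisfies_Eq[OF _ ij])
next
  fix q assume q: "q \<epsilon> FM" "?P q"
  then obtain n where n: "n \<epsilon> omega"
    "\<And>M a b. maps a omega M \<Longrightarrow> maps b omega M \<Longrightarrow> agree n a b \<Longrightarrow> satisfies M q a \<longleftrightarrow> satisfies M q b"
    by blast
  show "?P (cNeg q)"
    using n by (intro exI[of _ n]) (simp add: satisfies_Neg[OF _ q(1)])
  show "?P (cEx i q)" if i: "i \<epsilon> omega" for i
  proof (intro exI[of _ n] conjI n(1) allI impI)
    fix M a b assume m: "maps a omega M" "maps b omega M" and ab: "agree n a b"
    have "satisfies M q (updd a i x) \<longleftrightarrow> satisfies M q (updd b i x)" if "x \<epsilon> M" for x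
      by (rule n(2)[OF maps_updd[OF m(1) that] maps_updd[OF m(2) that] agree_updd[OF ab n(1)]])
    then show "satisfies M (cEx i q) a \<longleftrightarrow> satisfies M (cEx i q) b"
      unfolding satisfies_Ex[OF m(1) i q(1)] satisfies_Ex[OF m(2) i q(1)] by blast
  qed
  fix r assume r: "r \<epsilon> FM" "?P r"
  then obtain m where m: "m \<epsilon> omega"
    "\<And>M a b. maps a omega M \<Longrightarrow> maps b omega M \<Longrightarrow> agree m a b \<Longrightarrow> satisfies M r a \<longleftrightarrow> satisfies M r b"
    by blast
  obtain k where k: "k \<epsilon> omega" "subset n k" "subset m k" using ex_nat_above[OF n(1) m(1)] by blast
  show "?P (cAnd q r)"
  proof (intro exI[of _ k] conjI k(1) allI impI)
    fix M a b assume *: "maps a omega M" "maps b omega M" and ab: "agree k a b"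
    show "satisfies M (cAnd q r) a \<longleftrightarrow> satisfies M (cAnd q r) b"
      using n(2)[OF * agree_subset[OF ab k(2)]] m(2)[OF * agree_subset[OF ab k(3)]]
      by (simp add: satisfies_And[OF *(1) q(1) r(1)] satisfies_And[OF *(2) q(1) r(1)])
  qed
qed

lemma delta0_true_support:
  assumes "is_delta0 p"
  shows "\<exists>n. n \<epsilon> omega \<and> (\<forall>a b. agree n a b \<longrightarrow> (delta0_true p a \<longleftrightarrow> delta0_true p b))"
proof -
  obtain n where n: "n \<epsilon> omega" "\<And>M a b. maps a omega M \<Longrightarrow> maps b omega M \<Longrightarrow> agree n a b \<Longrightarrow>
      satisfies M p a \<longleftrightarrow> satisfies M p b"
    using satisfies_support[OF delta0_FM[OF assms]] by blast
  have "delta0_true p a \<longleftrightarrow> delta0_true p b" if ab: "agree n a b" for a b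
  proof -
    obtain c d where c: "ordinal c" "a \<epsilon> V c" and d: "ordinal d" "b \<epsilon> V d" using ex_mem_V by metis
    have f: "function_on a omega" "function_on b omega" using ab unfolding agree_def by blast+
    \<comment> \<open>A stage above both assignments is a transitive set in which their
      \<open>\<Delta>\<^sub>0\<close> truth can be compared.\<close>
    note e = ordinal_cup[OF c(1) d(1)]
    have "subset (V c) (V (cup c d))" "subset (V d) (V (cup c d))"
      by (rule V_mono_subset[OF e c(1)] V_mono_subset[OF e d(1)], simp add: subset_def)+
    then have m: "maps a omega (V (cup c d))" "maps b omega (V (cup c d))"
      using maps_mono[OF function_maps_V[OF f(1) c]] maps_mono[OF function_maps_V[OF f(2) d]] by blast+
    show ?thesis
      using delta0_true_V[OF assms transitive_V[OF e]] m n(2)[OF m ab] by simp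
  qed
  then show ?thesis using n(1) by blast
qed

lemma sigma_true_Suc:
  "function_on a omega \<Longrightarrow> i \<epsilon> omega \<Longrightarrow> sigma_true (Suc m) (cEx i q) a \<longleftrightarrow> (\<exists>x. pi_true m q (updd a i x))"
  and pi_true_Suc:
  "function_on a omega \<Longrightarrow> i \<epsilon> omega \<Longrightarrow> pi_true (Suc m) (cAll i q) a \<longleftrightarrow> (\<forall>x. sigma_true m q (updd a i x))"
  by (simp_all add: upd_eq_updd)

lemma is_sigma_pi_FM: "(is_sigma m p \<longrightarrow> p \<epsilon> FM) \<and> (is_pi m p \<longrightarrow> p \<epsilon> FM)"
  by (induction m arbitrary: p) (auto simp: delta0_FM FM_intros)

lemma sigma_pi_support:
  "(is_sigma m p \<longrightarrow> (\<exists>n. n \<epsilon> omega \<and> (\<forall>a b. agree n a b \<longrightarrow> (sigma_true m p a \<longleftrightarrow> sigma_true m p b)))) \<and>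
   (is_pi m p \<longrightarrow> (\<exists>n. n \<epsilon> omega \<and> (\<forall>a b. agree n a b \<longrightarrow> (pi_true m p a \<longleftrightarrow> pi_true m p b))))"
proof (induction m arbitrary: p)
  case 0
  then show ?case using delta0_true_support by simp
next
  case (Suc m)
  show ?case
  proof (intro conjI impI)
    assume "is_sigma (Suc m) p"
    then obtain i q where q: "i \<epsilon> omega" "is_pi m q" "p = cEx i q" by auto
    then obtain n where n: "n \<epsilon> omega" "\<And>a b. agree n a b \<Longrightarrow> pi_true m q a \<longleftrightarrow> pi_true m q b"
      using Suc[of q] by blast
    have "sigma_true (Suc m) p a \<longleftrightarrow> sigma_true (Suc m) p b" if "agree n a b" for a b
      using n(2)[OF agree_updd[OF that n(1)]] that
      unfolding q(3) agree_def by (simp add: sigma_true_Suc[OF _ q(1)] del: sigma_true.simps)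
    then show "\<exists>n. n \<epsilon> omega \<and> (\<forall>a b. agree n a b \<longrightarrow> (sigma_true (Suc m) p a \<longleftrightarrow> sigma_true (Suc m) p b))"
      using n(1) by blast
  next
    assume "is_pi (Suc m) p"
    then obtain i q where q: "i \<epsilon> omega" "is_sigma m q" "p = cAll i q" by auto
    then obtain n where n: "n \<epsilon> omega" "\<And>a b. agree n a b \<Longrightarrow> sigma_true m q a \<longleftrightarrow> sigma_true m q b"
      using Suc[of q] by blast
    have "pi_true (Suc m) p a \<longleftrightarrow> pi_true (Suc m) p b" if "agree n a b" for a b
      using n(2)[OF agree_updd[OF that n(1)]] that
      unfolding q(3) agree_def by (simp add: pi_true_Suc[OF _ q(1)] del: pi_true.simps)
    then show "\<exists>n. n \<epsilon> omega \<and> (\<forall>a b. agree n a b \<longrightarrow> (pi_true (Suc m) p a \<longleftrightarrow> pi_true (Suc m) p b))"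
      using n(1) by blast
  qed
qed

lemma definable_delta0_true[dfn]:
  "definable_fun f \<Longrightarrow> definable_fun g \<Longrightarrow> definable (\<lambda>s. delta0_true (f s) (g s))"
  by (rule definable_app2[of delta0_true]) (unfold delta0_true_def, intro dfn)

text \<open>The induction on the metatheoretic \<open>m\<close> yields a separate formula for each
  level, as it must by Tarski's theorem. The guard \<open>function_on\<close> allows
  \<open>upd\<close> to be replaced by the definable \<open>updd\<close>.\<close>

lemma definable_sigma_pi_true:
  "definable (\<lambda>s. function_on (s 1) omega \<and> sigma_true m (s 0) (s 1)) \<and>
   definable (\<lambda>s. function_on (s 1) omega \<and> pi_true m (s 0) (s 1))"
proof (induction m)
  case 0
  show ?case unfolding sigma_true.simps pi_true.simps by (intro conjI dfn)
next
  case (Suc m)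
  have 1: "function_on a omega \<and> sigma_true (Suc m) p a \<longleftrightarrow> function_on a omega \<and> (\<exists>i q. i \<epsilon> omega \<and>
      p = cEx i q \<and> (\<exists>x. function_on (updd a i x) omega \<and> pi_true m q (updd a i x)))" for a p
    by (auto simp: function_on_updd upd_eq_updd)
  have 2: "function_on a omega \<and> pi_true (Suc m) p a \<longleftrightarrow> function_on a omega \<and> (\<exists>i q. i \<epsilon> omega \<and>
      p = cAll i q \<and> (\<forall>x. function_on (updd a i x) omega \<and> sigma_true m q (updd a i x)))" for a p
    by (auto simp: function_on_updd upd_eq_updd)
  note d = definable_app2[of "\<lambda>p a. function_on a omega \<and> sigma_true m p a"]
    definable_app2[of "\<lambda>p a. function_on a omega \<and> pi_true m p a"]
  show ?case unfolding 1 2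
    by (intro conjI definable_and definable_ex definable_all definable_eq definable_mem
        definable_function_on definable_fm_constructors definable_fun_var definable_fun_const
        definable_updd d(1)[OF conjunct1[OF Suc]] d(2)[OF conjunct2[OF Suc]])
qed

section \<open>Reflection\<close>

text \<open>Witnesses cannot be chosen, so the closure works with \<open>h b\<close>, the least
  stage that contains a witness for \<open>b\<close>. Omega many steps, each of which bounds
  \<open>h b\<close> for all \<open>b\<close> in the previous stage, close off under \<Phi>.\<close>

lemma reflecting_limit:
  assumes \<Phi>: "definable (\<lambda>s. \<Phi> (s 0) (s 1))" and \<alpha>: "ordinal \<alpha>"
  obtains \<zeta> where "limit \<zeta>" "\<alpha> \<epsilon> \<zeta>"
    "\<And>b x. b \<epsilon> V \<zeta> \<Longrightarrow> \<Phi> b x \<Longrightarrow> \<exists>x. x \<epsilon> V \<zeta> \<and> \<Phi> b x"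
proof -
  define h where "h b = least (\<lambda>c. \<exists>x. x \<epsilon> V c \<and> \<Phi> b x)" for b
  have dh: "definable_fun (\<lambda>s. h (s 0))"
    unfolding h_def by (intro dfn definable_app2[OF \<Phi>])
  have d: "definable (\<lambda>s. \<exists>x. x \<epsilon> V (s 0) \<and> \<Phi> b x)" for b
    by (intro dfn definable_app2[OF \<Phi>])
  have h: "ordinal (h b)" "\<exists>x. x \<epsilon> V (h b) \<and> \<Phi> b x" if "\<Phi> b x" for b x
  proof -
    obtain c where "ordinal c" "x \<epsilon> V c" using ex_mem_V by blast
    then show "ordinal (h b)" "\<exists>x. x \<epsilon> V (h b) \<and> \<Phi> b x"
      unfolding h_def using least_holds[OF d, of c b] that by blast+
  qed
  \<comment> \<open>Without a witness \<open>least\<close> falls back to \<open>empty\<close>; hence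
    \<open>h\<close> takes ordinal values everywhere and suprema of its values are ordinals.\<close>
  have oh: "ordinal (h b)" for b
  proof (cases "\<exists>x. \<Phi> b x")
    case False
    then have "h b = empty" unfolding h_def least_def the_or_def by auto
    then show ?thesis by simp
  qed (use h(1) in blast)
  \<comment> \<open>The outer \<open>succ\<close> makes the iteration strictly increasing, so that
    its supremum is a limit.\<close>
  define F where "F c = succ (cup c (bigcup (repl (V c) h)))" for c
  have dF: "definable_fun (\<lambda>s. F (s 0))" unfolding F_def by (intro dfn definable_fun_compose[OF dh])
  have oU: "ordinal (cup c (bigcup (repl (V c) h)))" if "ordinal c" for c
    by (intro ordinal_cup[OF that] ordinal_bigcup) (auto simp: mem_repl[OF dh] oh)
  have oF: "ordinal (F c)" if "ordinal c" for c
    unfolding F_def by (rule ordinal_succ[OF oU[OF that]])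
  have sF: "x \<epsilon> F c" if "ordinal c" "ordinal x" "subset x (cup c (bigcup (repl (V c) h)))" for c x
    using ordinal_subset_iff[OF that(2) oU[OF that(1)]] that(3) unfolding F_def by auto
  let ?f = "nrec (succ \<alpha>) F"
  have f0: "?f empty = succ \<alpha>" and fs: "\<And>m. m \<epsilon> omega \<Longrightarrow> ?f (succ m) = F (?f m)"
    by (simp_all add: nrec_empty[OF dF] nrec_succ[OF dF])
  have df: "definable_fun (\<lambda>s. ?f (s 0))" by (rule definable_nrec[OF dF definable_fun_var])
  have of: "ordinal (?f m)" if "m \<epsilon> omega" for m
    using that
  proof (rule omega_induct[where P = "\<lambda>m. ordinal (?f m)"])
    show "definable (\<lambda>s. ordinal (?f (s 0)))" by (intro dfn definable_fun_compose[OF df])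
  qed (simp_all add: f0 fs ordinal_succ \<alpha> oF)
  define \<zeta> where "\<zeta> = bigcup (repl omega ?f)"
  have \<zeta>: "x \<epsilon> \<zeta> \<longleftrightarrow> (\<exists>m. m \<epsilon> omega \<and> x \<epsilon> ?f m)" for x
    unfolding \<zeta>_def by (auto simp: mem_repl[OF df])
  have ff: "?f m \<epsilon> ?f (succ m)" if "m \<epsilon> omega" for m
    unfolding fs[OF that] by (rule sF[OF of[OF that] of[OF that]]) (simp add: subset_def)
  have f\<zeta>: "?f m \<epsilon> \<zeta>" if "m \<epsilon> omega" for m
    unfolding \<zeta> using ff[OF that] succ_omega[OF that] by blast
  have \<alpha>\<zeta>: "\<alpha> \<epsilon> \<zeta>" unfolding \<zeta> using f0 by (intro exI[of _ empty]) simp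
  have o\<zeta>: "ordinal \<zeta>" unfolding \<zeta>_def by (rule ordinal_bigcup) (auto simp: mem_repl[OF df] of)
  have "limit \<zeta>"
    unfolding limit_def
  proof (intro conjI allI impI o\<zeta>)
    show "empty \<epsilon> \<zeta>" using ordinal_linear[OF ordinal_empty o\<zeta>] \<alpha>\<zeta> by auto
    fix a assume "a \<epsilon> \<zeta>"
    then obtain m where m: "m \<epsilon> omega" "a \<epsilon> ?f m" unfolding \<zeta> by blast
    note om = of[OF m(1)]
    have "subset (succ a) (?f m)" using m(2) ordinal_trans[OF om m(2)] by (auto simp: subset_def)
    then have "succ a \<epsilon> ?f (succ m)"
      using ordinal_subset_iff[OF ordinal_succ[OF ordinal_elem[OF om m(2)]] om] ff[OF m(1)]
        ordinal_trans[OF of[OF succ_omega[OF m(1)]] ff[OF m(1)]] by auto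
    then show "succ a \<epsilon> \<zeta>" unfolding \<zeta> using succ_omega[OF m(1)] by blast
  qed
  moreover have "\<exists>x. x \<epsilon> V \<zeta> \<and> \<Phi> b x" if b: "b \<epsilon> V \<zeta>" and x: "\<Phi> b x" for b x
  proof -
    obtain c where c: "c \<epsilon> \<zeta>" "b \<epsilon> V c" using mem_V_limit[OF \<open>limit \<zeta>\<close>] b by blast
    then obtain m where m: "m \<epsilon> omega" "c \<epsilon> ?f m" unfolding \<zeta> by blast
    note om = of[OF m(1)]
    have "b \<epsilon> V (?f m)" using subsetD[OF V_mono[OF om m(2)] c(2)] .
    then have "subset (h b) (cup (?f m) (bigcup (repl (V (?f m)) h)))"
      by (auto simp: subset_def mem_repl[OF dh])
    then have "h b \<epsilon> ?f (succ m)" unfolding fs[OF m(1)] by (rule sF[OF om oh])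
    then have "h b \<epsilon> \<zeta>" unfolding \<zeta> using succ_omega[OF m(1)] by blast
    then have "subset (V (h b)) (V \<zeta>)" by (rule V_mono[OF o\<zeta>])
    then show ?thesis using h(2)[OF x] subsetD by blast
  qed
  ultimately show thesis using that \<alpha>\<zeta> by blast
qed

text \<open>An assignment into \<open>V l\<close> is unbounded in general when \<open>l\<close> has
  cofinality omega, and then is not an element of \<open>V l\<close>. Keeping the values below
  \<open>n\<close> and padding with \<open>empty\<close> leaves a set that is one.\<close>

definition trunc :: "'a \<Rightarrow> 'a \<Rightarrow> 'a" where
  "trunc a n = lam omega (\<lambda>k. if k \<epsilon> n then appd a k else empty)"

lemma mem_trunc: "p \<epsilon> trunc a n \<longleftrightarrow> (\<exists>k. k \<epsilon> omega \<and> p = opair k (if k \<epsilon> n then appd a k else empty))"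
  unfolding trunc_def by (rule mem_lam) (intro dfn)

lemma agree_trunc:
  assumes "function_on a omega" "n \<epsilon> omega"
  shows "agree n (trunc a n) a"
proof -
  have d: "definable_fun (\<lambda>s. if s 0 \<epsilon> n then appd a (s 0) else empty)" by (intro dfn)
  have f: "function_on (trunc a n) omega" unfolding trunc_def by (rule function_on_lam[OF d])
  show ?thesis unfolding agree_def
  proof (intro conjI f assms(1) allI impI)
    fix i assume i: "i \<epsilon> n"
    have io: "i \<epsilon> omega" by (rule mem_nat_omega[OF assms(2) i])
    have "appd (trunc a n) i = app (trunc a n) i" by (rule appd_eq_app[OF f io])
    also have "\<dots> = appd a i" unfolding trunc_def app_lam[OF d io] using i by simp
    finally show "appd (trunc a n) i = appd a i" .
  qed
qed

text \<open>Internal induction on the length: a step adds at most one new pair to an element of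
  \<open>V l\<close>. The base case, the constant function \<open>empty\<close>, is a relation on
  omega and hence an element of \<open>V l\<close>.\<close>

lemma trunc_mem_V:
  assumes l: "limit l" "omega \<epsilon> l" and a: "maps a omega (V l)" and n: "n \<epsilon> omega"
  shows "trunc a n \<epsilon> V l"
  using n
proof (rule omega_induct[where P = "\<lambda>n. trunc a n \<epsilon> V l"])
  show "definable (\<lambda>s. trunc a (s 0) \<epsilon> V l)" unfolding trunc_def by (intro dfn)
  have w: "omega \<epsilon> V l" by (rule ordinal_mem_V[OF limit_ordinal[OF l(1)] l(2)])
  show "trunc a empty \<epsilon> V l"
    by (rule relation_mem_V[OF l(1) w w]) (auto simp: mem_trunc)
  fix m assume m: "m \<epsilon> omega" "trunc a m \<epsilon> V l"
  let ?p = "opair m (app a m)"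
  have "?p \<epsilon> V l" by (intro opair_mem_V[OF l(1)] nat_mem_V[OF l(1) m(1)] maps_app[OF a m(1)])
  then have "cup (trunc a m) (upair ?p ?p) \<epsilon> V l"
    by (intro cup_mem_V[OF l(1)] m(2) upair_mem_V[OF l(1)])
  then show "trunc a (succ m) \<epsilon> V l"
  proof (rule V_subset_closed[OF limit_ordinal[OF l(1)]])
    show "subset (trunc a (succ m)) (cup (trunc a m) (upair ?p ?p))"
      unfolding subset_def mem_cup mem_upair mem_trunc
      using appd_eq_app[OF maps_function[OF a] m(1)] by auto
  qed
qed

text \<open>A Tarski-Vaught argument along the Levy hierarchy: witnesses for \<open>pi_true\<close>
  and counterexamples to \<open>sigma_true\<close> can be moved into \<open>V l\<close>. The closure
  conditions concern parameters \<open>b\<close> in \<open>V l\<close>, so the assignment is first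
  truncated to the support of the formula.\<close>

lemma truth_reflects:
  assumes l: "limit l" "omega \<epsilon> l"
    and pi: "\<And>m i q b x. m < N \<Longrightarrow> i \<epsilon> omega \<Longrightarrow> q \<epsilon> FM \<Longrightarrow> b \<epsilon> V l \<Longrightarrow> pi_true m q (updd b i x) \<Longrightarrow>
      \<exists>x. x \<epsilon> V l \<and> pi_true m q (updd b i x)"
    and sigma: "\<And>m i q b x. m < N \<Longrightarrow> i \<epsilon> omega \<Longrightarrow> q \<epsilon> FM \<Longrightarrow> b \<epsilon> V l \<Longrightarrow> \<not> sigma_true m q (updd b i x) \<Longrightarrow>
      \<exists>x. x \<epsilon> V l \<and> \<not> sigma_true m q (updd b i x)"
  shows "m \<le> N \<Longrightarrow> maps a omega (V l) \<Longrightarrow>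
    (is_sigma m p \<longrightarrow> (satisfies (V l) p a \<longleftrightarrow> sigma_true m p a)) \<and>
    (is_pi m p \<longrightarrow> (satisfies (V l) p a \<longleftrightarrow> pi_true m p a))"
proof (induction m arbitrary: p a)
  case 0
  then show ?case using delta0_true_V[OF _ transitive_V[OF limit_ordinal[OF l(1)]]] by simp
next
  case (Suc m)
  then have m: "m < N" "m \<le> N" and a: "maps a omega (V l)" by auto
  note fa = maps_function[OF a]
  show ?case
  proof (intro conjI impI)
    assume "is_sigma (Suc m) p"
    then obtain i q where q: "i \<epsilon> omega" "is_pi m q" "p = cEx i q" by auto
    have FM: "q \<epsilon> FM" using is_sigma_pi_FM q(2) by blast
    obtain n where n: "n \<epsilon> omega" "\<And>a b. agree n a b \<Longrightarrow> pi_true m q a \<longleftrightarrow> pi_true m q b"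
      using sigma_pi_support q(2) by blast
    have tr: "pi_true m q (updd (trunc a n) i x) \<longleftrightarrow> pi_true m q (updd a i x)" for x
      by (rule n(2)[OF agree_updd[OF agree_trunc[OF fa n(1)] n(1)]])
    have "satisfies (V l) p a \<longleftrightarrow> (\<exists>x. x \<epsilon> V l \<and> pi_true m q (updd a i x))"
      unfolding q(3) satisfies_Ex[OF a q(1) FM] using Suc.IH[OF m(2) maps_updd[OF a]] q(2) by blast
    also have "\<dots> \<longleftrightarrow> (\<exists>x. pi_true m q (updd a i x))"
      using pi[OF m(1) q(1) FM trunc_mem_V[OF l a n(1)]] unfolding tr by blast
    also have "\<dots> \<longleftrightarrow> sigma_true (Suc m) p a"
      unfolding q(3) by (rule sigma_true_Suc[OF fa q(1), symmetric])
    finally show "satisfies (V l) p a \<longleftrightarrow> sigma_true (Suc m) p a" .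
  next
    assume "is_pi (Suc m) p"
    then obtain i q where q: "i \<epsilon> omega" "is_sigma m q" "p = cAll i q" by auto
    have FM: "q \<epsilon> FM" using is_sigma_pi_FM q(2) by blast
    obtain n where n: "n \<epsilon> omega" "\<And>a b. agree n a b \<Longrightarrow> sigma_true m q a \<longleftrightarrow> sigma_true m q b"
      using sigma_pi_support q(2) by blast
    have tr: "sigma_true m q (updd (trunc a n) i x) \<longleftrightarrow> sigma_true m q (updd a i x)" for x
      by (rule n(2)[OF agree_updd[OF agree_trunc[OF fa n(1)] n(1)]])
    have "satisfies (V l) p a \<longleftrightarrow> (\<forall>x. x \<epsilon> V l \<longrightarrow> sigma_true m q (updd a i x))"
      unfolding q(3) satisfies_All[OF a q(1) FM] using Suc.IH[OF m(2) maps_updd[OF a]] q(2) by blast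
    also have "\<dots> \<longleftrightarrow> (\<forall>x. sigma_true m q (updd a i x))"
      using sigma[OF m(1) q(1) FM trunc_mem_V[OF l a n(1)]] unfolding tr by blast
    also have "\<dots> \<longleftrightarrow> pi_true (Suc m) p a"
      unfolding q(3) by (rule pi_true_Suc[OF fa q(1), symmetric])
    finally show "satisfies (V l) p a \<longleftrightarrow> pi_true (Suc m) p a" .
  qed
qed

section \<open>Order types, and a reflecting stage that is a cardinal\<close>

text \<open>Says that the ordinal \<open>x\<close> is the order type of \<open>r\<close> on
  \<open>a\<close>: despite the name, \<open>g\<close> is an isomorphism onto
  \<open>x\<close>.\<close>

definition order_embeds :: "'a \<Rightarrow> 'a \<Rightarrow> 'a \<Rightarrow> bool" where
  "order_embeds a r x \<longleftrightarrow> ordinal x \<and> (\<exists>g. bijection g a x \<and>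
    (\<forall>u v. u \<epsilon> a \<and> v \<epsilon> a \<longrightarrow> (opair u v \<epsilon> r \<longleftrightarrow> appd g u \<epsilon> appd g v)))"

text \<open>A bijection from \<open>a\<close> to \<open>l\<close> transports the order of \<open>l\<close> to a relation on \<open>a\<close>, whose order type
  would have to be an ordinal below \<open>l\<close> as well as \<open>l\<close>.\<close>

lemma cardinal_if_order_types_reflect:
  assumes l: "limit l"
    and refl: "\<And>a r x. a \<epsilon> V l \<Longrightarrow> r \<epsilon> V l \<Longrightarrow> order_embeds a r x \<Longrightarrow> \<exists>x. x \<epsilon> V l \<and> order_embeds a r x"
  shows "cardinal l"
  unfolding cardinal_def
proof (intro conjI allI impI notI)
  show ol: "ordinal l" by (rule limit_ordinal[OF l])
  fix a assume a: "a \<epsilon> l" and "\<exists>f. bijection f a l"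
  then obtain f where f: "bijection f a l" by blast
  note av = ordinal_mem_V[OF ol a]
  have ff: "function_on f a" using f unfolding bijection_def maps_def by blast
  define r where "r = sep (cart a a) (\<lambda>p. \<exists>u v. p = opair u v \<and> appd f u \<epsilon> appd f v)"
  have d: "definable (\<lambda>s. \<exists>u v. s 0 = opair u v \<and> appd f u \<epsilon> appd f v)" by (intro dfn)
  have r: "opair u v \<epsilon> r \<longleftrightarrow> u \<epsilon> a \<and> v \<epsilon> a \<and> appd f u \<epsilon> appd f v" for u v
    unfolding r_def mem_sep[OF d] mem_cart by auto
  have "r \<epsilon> V l"
    by (rule relation_mem_V[OF l av av]) (auto simp: r_def mem_sep[OF d] mem_cart)
  moreover have "order_embeds a r l" unfolding order_embeds_def using ol f r by blast
  ultimately obtain x where x: "x \<epsilon> V l" "order_embeds a r x" using refl[OF av] by blast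
  then obtain g where ox: "ordinal x" and g: "bijection g a x"
    and rg: "\<And>u v. u \<epsilon> a \<Longrightarrow> v \<epsilon> a \<Longrightarrow> opair u v \<epsilon> r \<longleftrightarrow> appd g u \<epsilon> appd g v"
    unfolding order_embeds_def by blast
  have xl: "x \<epsilon> l" using x(1) ordinal_mem_V_iff[OF ol ox] by simp
  have fg: "function_on g a" using g unfolding bijection_def maps_def by blast
  have fl: "appd f u \<epsilon> l" "appd g u \<epsilon> x" if "u \<epsilon> a" for u
    using that f g unfolding bijection_def maps_def
    by (simp_all add: appd_eq_app[OF ff] appd_eq_app[OF fg])
  have onto: "z \<epsilon> l \<Longrightarrow> \<exists>u. u \<epsilon> a \<and> appd f u = z" "z \<epsilon> x \<Longrightarrow> \<exists>u. u \<epsilon> a \<and> appd g u = z" for z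
    using f g appd_eq_app[OF ff] appd_eq_app[OF fg] unfolding bijection_def by metis+
  \<comment> \<open>Two isomorphisms of \<open>r\<close> onto ordinals agree value by value. Carried
    up to \<open>x\<close>, this forces the point that \<open>f\<close> sends to \<open>x\<close> to
    have value \<open>x\<close> under \<open>g\<close> too, although the values of \<open>g\<close>
    are elements of \<open>x\<close>.\<close>
  have "\<forall>u. u \<epsilon> a \<and> appd f u = x \<longrightarrow> appd g u = x"
    using ox
  proof (rule ordinal_induct[where P = "\<lambda>y. \<forall>u. u \<epsilon> a \<and> appd f u = y \<longrightarrow> appd g u = y"])
    show "definable (\<lambda>s. \<forall>u. u \<epsilon> a \<and> appd f u = s 0 \<longrightarrow> appd g u = s 0)" by (intro dfn)
    fix y assume IH: "\<And>z. z \<epsilon> y \<Longrightarrow> \<forall>u. u \<epsilon> a \<and> appd f u = z \<longrightarrow> appd g u = z"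
    show "\<forall>u. u \<epsilon> a \<and> appd f u = y \<longrightarrow> appd g u = y"
    proof (intro allI impI, elim conjE)
      fix u assume u: "u \<epsilon> a" "appd f u = y"
      show "appd g u = y"
      proof (rule extensionality, intro allI iffI)
        fix z assume z: "z \<epsilon> appd g u"
        then obtain v where v: "v \<epsilon> a" "appd g v = z"
          using onto(2) ordinal_trans[OF ox fl(2)[OF u(1)]] by blast
        then have "appd f v \<epsilon> y" using rg[OF v(1) u(1)] r z u by simp
        then have "appd g v = appd f v" using IH[of "appd f v"] v(1) by blast
        then show "z \<epsilon> y" using \<open>appd f v \<epsilon> y\<close> v(2) by simp
      next
        fix z assume z: "z \<epsilon> y"
        then obtain v where v: "v \<epsilon> a" "appd f v = z"
          using onto(1) ordinal_trans[OF ol fl(1)[OF u(1)]] u(2) by blast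
        then have "appd g v \<epsilon> appd g u" using rg[OF v(1) u(1)] r z u by simp
        then show "z \<epsilon> appd g u" using IH[OF z] v by simp
      qed
    qed
  qed
  then show False using onto(1)[OF xl] fl(2) mem_irrefl by metis
qed

theorem ex_correct_cardinal:
  assumes \<alpha>: "ordinal \<alpha>"
  obtains \<zeta> where "limit \<zeta>" "\<alpha> \<epsilon> \<zeta>" "omega \<epsilon> \<zeta>" "\<And>m. m \<le> N \<Longrightarrow> C m \<zeta>"
proof -
  \<comment> \<open>All reflection tasks are joined into one relation and told apart by tags:
    \<open>num m\<close> with \<open>m < N\<close> and then \<open>num 0\<close> for witnesses of
    \<open>pi_true\<close> or \<open>num 1\<close> for counterexamples to \<open>sigma_true\<close>,
    and \<open>num N\<close> for the order types that make the stage a cardinal.\<close>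
  define \<Phi> where "\<Phi> b x \<longleftrightarrow>
    (\<exists>m<N. \<exists>q i a. b = opair (num m) (opair (num 0) (opair q (opair i a))) \<and>
      function_on (updd a i x) omega \<and> pi_true m q (updd a i x)) \<or>
    (\<exists>m<N. \<exists>q i a. b = opair (num m) (opair (num 1) (opair q (opair i a))) \<and>
      \<not> (function_on (updd a i x) omega \<and> sigma_true m q (updd a i x))) \<or>
    (\<exists>a r. b = opair (num N) (opair a r) \<and> order_embeds a r x)" for b x
  have d: "definable_fun f \<Longrightarrow> definable_fun g \<Longrightarrow> definable (\<lambda>s. function_on (g s) omega \<and> pi_true m (f s) (g s))"
    "definable_fun f \<Longrightarrow> definable_fun g \<Longrightarrow> definable (\<lambda>s. function_on (g s) omega \<and> sigma_true m (f s) (g s))"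
    for f g m
    by (rule definable_app2[of "\<lambda>p a. function_on a omega \<and> pi_true m p a"]
        definable_app2[of "\<lambda>p a. function_on a omega \<and> sigma_true m p a"];
        use definable_sigma_pi_true in blast)+
  have "definable (\<lambda>s. \<Phi> (s 0) (s 1))"
    unfolding \<Phi>_def order_embeds_def
    by (intro definable_or definable_ex_less definable_ex definable_and[OF definable_eq]
        definable_not[OF d(2)] d; (intro dfn)?)
  moreover have "ordinal (cup \<alpha> omega)" by (intro ordinal_cup \<alpha> ordinal_omega)
  ultimately obtain \<zeta> where \<zeta>: "limit \<zeta>" "cup \<alpha> omega \<epsilon> \<zeta>"
    and refl: "\<And>b x. b \<epsilon> V \<zeta> \<Longrightarrow> \<Phi> b x \<Longrightarrow> \<exists>x. x \<epsilon> V \<zeta> \<and> \<Phi> b x"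
    using reflecting_limit by blast
  note o = limit_ordinal[OF \<zeta>(1)]
  have below: "c \<epsilon> \<zeta>" if "ordinal c" "subset c (cup \<alpha> omega)" for c
    using ordinal_subset_iff[OF that(1) ordinal_elem[OF o \<zeta>(2)]] that(2) \<zeta>(2) ordinal_trans[OF o \<zeta>(2)] by blast
  have \<alpha>\<zeta>: "\<alpha> \<epsilon> \<zeta>" and w: "omega \<epsilon> \<zeta>" by (rule below; simp add: subset_def \<alpha>)+
  have n: "num m \<epsilon> V \<zeta>" for m by (rule nat_mem_V[OF \<zeta>(1) num_omega])
  note p = opair_mem_V[OF \<zeta>(1)]
  have FMV: "q \<epsilon> V \<zeta>" if "q \<epsilon> FM" for q
    using FM_V[OF that] V_mono[OF o w] subsetD by blast
  have \<Phi>0: "\<Phi> (opair (num m) (opair (num 0) (opair q (opair i a)))) x \<longleftrightarrow> pi_true m q (updd a i x)" if "m < N" for m q i a x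
    unfolding \<Phi>_def using that by (auto simp: function_on_updd simp del: num.simps)
  have \<Phi>1: "\<Phi> (opair (num m) (opair (num 1) (opair q (opair i a)))) x \<longleftrightarrow> \<not> sigma_true m q (updd a i x)" if "m < N" for m q i a x
    unfolding \<Phi>_def using that by (auto simp: function_on_updd simp del: num.simps)
  have \<Phi>2: "\<Phi> (opair (num N) (opair a r)) x \<longleftrightarrow> order_embeds a r x" for a r x
    unfolding \<Phi>_def by (auto simp del: num.simps)
  have card: "cardinal \<zeta>"
  proof (rule cardinal_if_order_types_reflect[OF \<zeta>(1)])
    show "\<exists>x. x \<epsilon> V \<zeta> \<and> order_embeds a r x" if "a \<epsilon> V \<zeta>" "r \<epsilon> V \<zeta>" "order_embeds a r x" for a r x
      using refl[OF p[OF n p[OF that(1,2)]], of N x] that(3) unfolding \<Phi>2 by blast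
  qed
  have "C m \<zeta>" if "m \<le> N" for m
    unfolding C_def Vset_eq[OF o]
  proof (intro conjI card allI impI, elim conjE)
    fix q a assume q: "is_sigma m q" and a: "maps a omega (V \<zeta>)"
    have code: "opair (num k) (opair (num j) (opair r (opair i b))) \<epsilon> V \<zeta>"
      if "r \<epsilon> FM" "i \<epsilon> omega" "b \<epsilon> V \<zeta>" for k j r i b
      by (intro p n FMV that nat_mem_V[OF \<zeta>(1)])
    have "(is_sigma m q \<longrightarrow> (satisfies (V \<zeta>) q a \<longleftrightarrow> sigma_true m q a)) \<and>
      (is_pi m q \<longrightarrow> (satisfies (V \<zeta>) q a \<longleftrightarrow> pi_true m q a))"
    proof (rule truth_reflects[OF \<zeta>(1) w _ _ that a])
      show "\<exists>x. x \<epsilon> V \<zeta> \<and> pi_true k r (updd b i x)"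
        if "k < N" "i \<epsilon> omega" "r \<epsilon> FM" "b \<epsilon> V \<zeta>" "pi_true k r (updd b i x)" for k i r b x
        using refl[OF code[of r i b k 0], of x] that by (simp only: \<Phi>0 simp_thms)
      show "\<exists>x. x \<epsilon> V \<zeta> \<and> \<not> sigma_true k r (updd b i x)"
        if "k < N" "i \<epsilon> omega" "r \<epsilon> FM" "b \<epsilon> V \<zeta>" "\<not> sigma_true k r (updd b i x)" for k i r b x
        using refl[OF code[of r i b k 1], of x] that by (simp only: \<Phi>1 simp_thms)
    qed
    then show "satisfies (V \<zeta>) q a \<longleftrightarrow> sigma_true m q a" using q by blast
  qed
  then show thesis using that \<zeta>(1) \<alpha>\<zeta> w by blast
qed

section \<open>Elementary embeddings\<close>

lemma elementary_embedding_iff: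
  "elementary_embedding j M N \<longleftrightarrow> maps j M N \<and> (\<forall>p a. p \<epsilon> FM \<and> maps a omega M \<longrightarrow>
    (satisfies M p a \<longleftrightarrow> satisfies N p (lam omega (\<lambda>i. appd j (appd a i)))))"
proof -
  have "lam omega (\<lambda>i. app j (app a i)) = lam omega (\<lambda>i. appd j (appd a i))"
    if "maps j M N" "maps a omega M" for a
    using maps_app[OF that(2)] appd_eq_app[OF maps_function[OF that(1)]] appd_eq_app[OF maps_function[OF that(2)]]
    by (intro lam_cong) simp
  then show ?thesis unfolding elementary_embedding_def is_fm_iff by auto
qed

lemma definable_elementary_embedding[dfn]:
  "definable_fun f \<Longrightarrow> definable_fun g \<Longrightarrow> definable_fun h \<Longrightarrow>
    definable (\<lambda>s. elementary_embedding (f s) (g s) (h s))"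
  by (rule definable_app3[of elementary_embedding]) (unfold elementary_embedding_iff, intro dfn)

lemma ex_assignment:
  assumes "x \<epsilon> M" "y \<epsilon> M" "z \<epsilon> M"
  shows "\<exists>a. maps a omega M \<and> app a (num 0) = x \<and> app a (num 1) = y \<and> app a (num 2) = z"
proof -
  let ?c = "lam omega (\<lambda>_. x)"
  have c: "maps ?c omega M"
    unfolding maps_def using assms(1) by (simp add: function_on_lam app_lam definable_fun_const)
  note c1 = maps_updd[OF c assms(2), of "num 1"]
  note c2 = maps_updd[OF c1 assms(3), of "num 2"]
  show ?thesis
    by (intro exI[of _ "updd (updd ?c (num 1) y) (num 2) z"] conjI c2)
      (simp_all add: app_updd function_on_updd maps_function[OF c] app_lam definable_fun_const del: num.simps One_nat_def)
qed

context
  fixes j M N assumes emb: "elementary_embedding j M N"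
begin

lemma emb_app: "x \<epsilon> M \<Longrightarrow> app j x \<epsilon> N"
  using emb maps_app unfolding elementary_embedding_def by blast

lemma emb_function: "function_on j M"
  using emb maps_function unfolding elementary_embedding_def by blast

lemma emb_assignment:
  assumes "x \<epsilon> M" "y \<epsilon> M" "z \<epsilon> M"
  obtains a b where "maps a omega M" "maps b omega N"
    "app a (num 0) = x" "app a (num 1) = y" "app a (num 2) = z"
    "app b (num 0) = app j x" "app b (num 1) = app j y" "app b (num 2) = app j z"
    "\<And>p. p \<epsilon> FM \<Longrightarrow> satisfies M p a \<longleftrightarrow> satisfies N p b"
proof -
  obtain a where a: "maps a omega M" "app a (num 0) = x" "app a (num 1) = y" "app a (num 2) = z"
    using ex_assignment[OF assms] by blast
  let ?b = "lam omega (\<lambda>i. app j (app a i))"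
  have eq: "?b = lam omega (\<lambda>i. appd j (appd a i))"
    using maps_app[OF a(1)] appd_eq_app[OF emb_function] appd_eq_app[OF maps_function[OF a(1)]]
    by (intro lam_cong) simp
  have d: "definable_fun (\<lambda>s. appd j (appd a (s 0)))" by (intro dfn)
  have b: "app ?b i = app j (app a i)" if "i \<epsilon> omega" for i
    unfolding eq app_lam[OF d that]
    using appd_eq_app[OF emb_function maps_app[OF a(1) that]] appd_eq_app[OF maps_function[OF a(1)] that]
    by simp
  have "maps ?b omega N"
    unfolding maps_def
    by (intro conjI allI impI) (simp add: eq function_on_lam[OF d], simp add: b emb_app maps_app[OF a(1)])
  then show thesis
    using a b emb num_omega unfolding elementary_embedding_def is_fm_iff
    by (intro that[of a ?b]) (simp_all del: num.simps One_nat_def)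
qed

lemma emb_mem: "x \<epsilon> M \<Longrightarrow> y \<epsilon> M \<Longrightarrow> app j x \<epsilon> app j y \<longleftrightarrow> x \<epsilon> y"
proof -
  assume xy: "x \<epsilon> M" "y \<epsilon> M"
  obtain a b where ab: "maps a omega M" "maps b omega N"
    "app a (num 0) = x" "app a (num 1) = y" "app b (num 0) = app j x" "app b (num 1) = app j y"
    "\<And>p. p \<epsilon> FM \<Longrightarrow> satisfies M p a \<longleftrightarrow> satisfies N p b"
    using emb_assignment[OF xy xy(1)] by metis
  show ?thesis
    using ab(7)[OF FM_intros(1)[OF num_omega num_omega], of 0 1] ab(1-6)
    by (simp add: satisfies_Mem del: num.simps One_nat_def)
qed

lemma emb_eq: "x \<epsilon> M \<Longrightarrow> y \<epsilon> M \<Longrightarrow> app j x = app j y \<longleftrightarrow> x = y"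
proof -
  assume xy: "x \<epsilon> M" "y \<epsilon> M"
  obtain a b where ab: "maps a omega M" "maps b omega N"
    "app a (num 0) = x" "app a (num 1) = y" "app b (num 0) = app j x" "app b (num 1) = app j y"
    "\<And>p. p \<epsilon> FM \<Longrightarrow> satisfies M p a \<longleftrightarrow> satisfies N p b"
    using emb_assignment[OF xy xy(1)] by metis
  show ?thesis
    using ab(7)[OF FM_intros(2)[OF num_omega num_omega], of 0 1] ab(1-6)
    by (simp add: satisfies_Eq del: num.simps One_nat_def)
qed

text \<open>Lying in some element of the structure is a first-order property, and
  \<open>berkeley_fixing\<close> recognises its marker set by the failure of this property.\<close>

lemma emb_maximal:
  assumes "x \<epsilon> M"
  shows "(\<exists>z. z \<epsilon> N \<and> app j x \<epsilon> z) \<longleftrightarrow> (\<exists>z. z \<epsilon> M \<and> x \<epsilon> z)"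
proof -
  obtain a b where ab: "maps a omega M" "maps b omega N"
    "app a (num 0) = x" "app b (num 0) = app j x"
    "\<And>p. p \<epsilon> FM \<Longrightarrow> satisfies M p a \<longleftrightarrow> satisfies N p b"
    using emb_assignment[OF assms assms assms] by metis
  let ?p = "cMem (num 0) (num 1)"
  have p: "?p \<epsilon> FM" by (intro FM_intros num_omega)
  have "satisfies M (cEx (num 1) ?p) a \<longleftrightarrow> (\<exists>z. z \<epsilon> M \<and> x \<epsilon> z)" if "maps a omega M" "app a (num 0) = x" for a x M
    using that by (simp add: satisfies_Ex[OF that(1) num_omega p] satisfies_Mem maps_updd[OF that(1)]
        app_updd maps_function[OF that(1)] del: num.simps One_nat_def cong: conj_cong)
  then show ?thesis
    using ab(5)[OF FM_intros(5)[OF num_omega p], of 1] ab(1-4) by blast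
qed

lemma emb_subset_upair:
  assumes "x \<epsilon> M" "y \<epsilon> M" "u \<epsilon> M"
  shows "(\<exists>z. z \<epsilon> N \<and> z \<epsilon> app j u \<and> z \<noteq> app j x \<and> z \<noteq> app j y) \<longleftrightarrow>
    (\<exists>z. z \<epsilon> M \<and> z \<epsilon> u \<and> z \<noteq> x \<and> z \<noteq> y)"
proof -
  obtain a b where ab: "maps a omega M" "maps b omega N"
    "app a (num 0) = x" "app a (num 1) = y" "app a (num 2) = u"
    "app b (num 0) = app j x" "app b (num 1) = app j y" "app b (num 2) = app j u"
    "\<And>p. p \<epsilon> FM \<Longrightarrow> satisfies M p a \<longleftrightarrow> satisfies N p b"
    using emb_assignment[OF assms] by metis
  let ?p = "cAnd (cMem (num 3) (num 2)) (cAnd (cNeg (cEq (num 3) (num 0))) (cNeg (cEq (num 3) (num 1))))"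
  have p: "?p \<epsilon> FM" by (intro FM_intros num_omega)
  have "satisfies M (cEx (num 3) ?p) a \<longleftrightarrow> (\<exists>z. z \<epsilon> M \<and> z \<epsilon> app a (num 2) \<and> z \<noteq> app a (num 0) \<and> z \<noteq> app a (num 1))"
    if "maps a omega M" for a M
    by (simp add: satisfies_Ex[OF that num_omega p] satisfies_Mem satisfies_And satisfies_Neg satisfies_Eq
        maps_updd[OF that] app_updd maps_function[OF that] FM_intros del: num.simps One_nat_def cong: conj_cong)
  then show ?thesis
    using ab(9)[OF FM_intros(5)[OF num_omega p], of 3] ab(1-8) by simp
qed

text \<open>That the pair has no third element is first-order over \<open>M\<close>. Transitivity of
  \<open>N\<close> ensures that every element of the image is seen by the quantifier on the other
  side.\<close>

lemma emb_upair:
  assumes N: "transitive N" and x: "x \<epsilon> M" "y \<epsilon> M" "upair x y \<epsilon> M"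
  shows "app j (upair x y) = upair (app j x) (app j y)"
proof (rule extensionality, intro allI)
  fix z
  have "z \<epsilon> N" if "z \<epsilon> app j (upair x y)"
    using N emb_app[OF x(3)] that unfolding transitive_def subset_def by blast
  moreover have "\<not> (\<exists>z. z \<epsilon> N \<and> z \<epsilon> app j (upair x y) \<and> z \<noteq> app j x \<and> z \<noteq> app j y)"
    unfolding emb_subset_upair[OF x] by auto
  moreover have "app j x \<epsilon> app j (upair x y)" "app j y \<epsilon> app j (upair x y)"
    using emb_mem[OF x(1,3)] emb_mem[OF x(2,3)] by simp_all
  ultimately show "z \<epsilon> app j (upair x y) \<longleftrightarrow> z \<epsilon> upair (app j x) (app j y)"
    by (simp only: mem_upair) blast
qed

end

lemma transitive_opair:
  assumes "transitive M" "opair x y \<epsilon> M"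
  shows "x \<epsilon> M" "y \<epsilon> M" "upair x x \<epsilon> M" "upair x y \<epsilon> M"
proof -
  have tr: "\<And>u v. u \<epsilon> M \<Longrightarrow> v \<epsilon> u \<Longrightarrow> v \<epsilon> M" using assms(1) unfolding transitive_def subset_def by blast
  show u: "upair x x \<epsilon> M" "upair x y \<epsilon> M" by (rule tr[OF assms(2)], simp add: opair_def)+
  show "x \<epsilon> M" "y \<epsilon> M" by (rule tr[OF u(2)], simp)+
qed

lemma emb_opair:
  assumes "elementary_embedding j M N" "transitive M" "transitive N" "opair x y \<epsilon> M"
  shows "app j (opair x y) = opair (app j x) (app j y)"
  using transitive_opair[OF assms(2,4)] assms(4) emb_upair[OF assms(1,3)] unfolding opair_def by metis

text \<open>In \<open>M = N \<union> {N, {N, a}}\<close> the set \<open>{N, a}\<close> is the only one that is not an element of an element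
  of \<open>M\<close>, so every embedding of \<open>M\<close> into itself fixes it, and hence fixes \<open>N\<close> and \<open>a\<close>.\<close>

lemma berkeley_fixing:
  assumes \<delta>: "berkeley \<delta>" and N: "transitive N" "\<delta> \<epsilon> N" "a \<epsilon> N" and h: "h \<epsilon> \<delta>"
  obtains J c where "definable_fun (\<lambda>s. J (s 0))"
    "\<And>x. x \<epsilon> N \<Longrightarrow> J x \<epsilon> N"
    "\<And>x y. x \<epsilon> N \<Longrightarrow> y \<epsilon> N \<Longrightarrow> J x \<epsilon> J y \<longleftrightarrow> x \<epsilon> y"
    "\<And>x y. x \<epsilon> N \<Longrightarrow> y \<epsilon> N \<Longrightarrow> J x = J y \<longleftrightarrow> x = y"
    "\<And>x y. opair x y \<epsilon> N \<Longrightarrow> J (opair x y) = opair (J x) (J y)"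
    "J a = a" "h \<epsilon> c" "c \<epsilon> \<delta>" "J c \<noteq> c" "\<And>b. b \<epsilon> c \<Longrightarrow> J b = b"
proof -
  define P where "P = upair N a"
  define M where "M = cup N (upair N P)"
  have M: "x \<epsilon> M \<longleftrightarrow> x \<epsilon> N \<or> x = N \<or> x = P" for x unfolding M_def by simp
  have P: "x \<epsilon> P \<longleftrightarrow> x = N \<or> x = a" for x unfolding P_def by simp
  have tN: "\<And>u v. u \<epsilon> N \<Longrightarrow> v \<epsilon> u \<Longrightarrow> v \<epsilon> N" using N(1) unfolding transitive_def subset_def by blast
  have tM: "transitive M" unfolding transitive_def subset_def M using tN N(3) P by blast
  have \<delta>M: "\<delta> \<epsilon> M" using N(2) M by blast
  obtain j c where j: "elementary_embedding j M M" and c: "is_crit j M c" "h \<epsilon> c" "c \<epsilon> \<delta>"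
    using \<delta> tM \<delta>M h unfolding berkeley_def by blast
  have cN: "c \<epsilon> N" using tN[OF N(2) c(3)] .
  note jf = emb_function[OF j] and mem = emb_mem[OF j] and eq = emb_eq[OF j]
  have max: "(\<exists>z. z \<epsilon> M \<and> x \<epsilon> z) \<longleftrightarrow> x \<noteq> P" if "x \<epsilon> M" for x
  proof (cases "x = P")
    case True
    have "\<not> P \<epsilon> N" using mem_asym[of N P] P by blast
    then show ?thesis using True M tN by (metis mem_irrefl)
  next
    case False
    then show ?thesis using that M P by metis
  qed
  have mM: "N \<epsilon> M" "P \<epsilon> M" "a \<epsilon> M" using M N(3) by auto
  have jP: "app j P = P"
    using emb_maximal[OF j mM(2)] max[OF mM(2)] max[OF emb_app[OF j mM(2)]] by blast
  \<comment> \<open>The images of \<open>N\<close> and \<open>a\<close> lie in \<open>P\<close> and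
    stand in the same membership relation. As \<open>a\<close> is in \<open>N\<close> but not
    conversely, the two points can be neither swapped nor identified.\<close>
  have "app j N \<epsilon> P" "app j a \<epsilon> P" "app j a \<epsilon> app j N"
    using mem[OF mM(1,2)] mem[OF mM(3,2)] mem[OF mM(3,1)] P N(3) jP by auto
  then have jN: "app j N = N" and ja: "app j a = a"
    using mem_asym[of a N] N(3) P by (metis mem_irrefl)+
  have NM: "x \<epsilon> M" if "x \<epsilon> N" for x using that M by blast
  have ap: "appd j x = app j x" if "x \<epsilon> N" for x using appd_eq_app[OF jf NM[OF that]] .
  show thesis
  proof (rule that[of "appd j" c])
    show "definable_fun (\<lambda>s. appd j (s 0))" by (intro dfn)
    show "appd j x \<epsilon> N" if "x \<epsilon> N" for x
      using mem[OF NM[OF that] mM(1)] that jN by (simp add: ap)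
    show "appd j x \<epsilon> appd j y \<longleftrightarrow> x \<epsilon> y" "appd j x = appd j y \<longleftrightarrow> x = y" if "x \<epsilon> N" "y \<epsilon> N" for x y
      using that mem[OF NM NM] eq[OF NM NM] by (simp_all add: ap)
    show "appd j (opair x y) = opair (appd j x) (appd j y)" if "opair x y \<epsilon> N" for x y
      using emb_opair[OF j tM tM NM[OF that]] transitive_opair[OF N(1) that] that by (simp add: ap)
    show "appd j a = a" using ja N(3) by (simp add: ap)
    show "h \<epsilon> c" "c \<epsilon> \<delta>" using c by auto
    show "appd j c \<noteq> c" using c(1) cN unfolding is_crit_def by (simp add: ap)
    show "appd j b = b" if "b \<epsilon> c" for b
      using c(1) tN[OF cN that] NM that unfolding is_crit_def by (simp add: ap)
  qed
qed

section \<open>Reflecting ultraexactness\<close>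

definition sups :: "'a \<Rightarrow> 'a" where
  "sups s = bigcup (repl omega (appd s))"

lemma definable_sups[dfn]: "definable_fun f \<Longrightarrow> definable_fun (\<lambda>s. sups (f s))"
  by (rule definable_fun_app1[of sups]) (unfold sups_def, intro dfn)

lemma mem_sups: "x \<epsilon> sups s \<longleftrightarrow> (\<exists>m. m \<epsilon> omega \<and> x \<epsilon> appd s m)"
proof -
  have "definable_fun (\<lambda>t. appd s (t 0))" by (intro dfn)
  then show ?thesis unfolding sups_def by (auto simp: mem_repl)
qed

text \<open>Here \<open>s\<close> is the sequence \<kappa>, \<open>\<mu>\<^sub>0\<close>,
  \<open>\<mu>\<^sub>1\<close>, and so on, so that a single shift clause covers the values of
  \<open>k\<close> at \<kappa> and at all members of the sequence. The point \<open>c\<close> is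
  moved, being below its image, and is therefore the critical point.\<close>

definition shifting :: "'a \<Rightarrow> 'a \<Rightarrow> 'a \<Rightarrow> 'a \<Rightarrow> bool" where
  "shifting U k A s \<longleftrightarrow> elementary_embedding k U U \<and> (\<exists>x. x \<epsilon> U \<and> appd k x = A) \<and>
    (\<forall>m. m \<epsilon> omega \<longrightarrow> appd k (appd s m) = appd s (succ m)) \<and> appd k (sups s) = sups s \<and>
    (\<exists>c. ordinal c \<and> c \<epsilon> U \<and> c \<epsilon> appd s empty \<and> appd k c = appd s empty \<and> (\<forall>b. b \<epsilon> c \<longrightarrow> appd k b = b))"

lemma definable_shifting: "definable (\<lambda>s. shifting U (s 2) (s 1) (s 0))"
  unfolding shifting_def by (intro dfn)

definition truths :: "'a \<Rightarrow> 'a" where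
  "truths U = sep (cart FM (Asg U)) (\<lambda>p. \<exists>q a. p = opair q a \<and> satisfies U q a)"

definition cardinals :: "'a \<Rightarrow> 'a" where
  "cardinals d = sep d cardinal"

definition bijections :: "'a \<Rightarrow> 'a" where
  "bijections U = sep (cart U (cart U U)) (\<lambda>p. \<exists>f x y. p = opair f (opair x y) \<and> bijection f x y)"

text \<open>Codes that \<open>y\<close> is in bijection with some element of \<open>x\<close>. It
  serves to pull a failure of cardinality of the supremum back along the critical sequence.\<close>

definition collapses :: "'a \<Rightarrow> 'a" where
  "collapses U = sep (cart U U) (\<lambda>p. \<exists>x y a f. p = opair x y \<and> a \<epsilon> x \<and> bijection f a y)"

definition suprema :: "'a \<Rightarrow> 'a" where
  "suprema U = sep (cart (Asg U) U) (\<lambda>p. \<exists>s. p = opair s (sups s))"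

text \<open>Within \<open>cart U (Asg U)\<close> this is the complement of badness. The embedding
  \<open>k\<close> is quantified away, so only pairs of elements that \<open>J\<close> acts on
  remain.\<close>

definition shiftings :: "'a \<Rightarrow> 'a" where
  "shiftings U = sep (cart U (Asg U)) (\<lambda>p. \<exists>A s k. p = opair A s \<and> shifting U k A s)"

lemma opair_mem_cart[simp]: "opair x y \<epsilon> cart X Y \<longleftrightarrow> x \<epsilon> X \<and> y \<epsilon> Y"
  unfolding mem_cart by simp

lemma mem_truths: "opair q a \<epsilon> truths U \<longleftrightarrow> q \<epsilon> FM \<and> maps a omega U \<and> satisfies U q a"
  unfolding truths_def by (subst mem_sep) (intro dfn, auto)

lemma mem_cardinals: "x \<epsilon> cardinals d \<longleftrightarrow> x \<epsilon> d \<and> cardinal x"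
  unfolding cardinals_def by (rule mem_sep) (intro dfn)

lemma mem_bijections: "opair f (opair x y) \<epsilon> bijections U \<longleftrightarrow> f \<epsilon> U \<and> x \<epsilon> U \<and> y \<epsilon> U \<and> bijection f x y"
  unfolding bijections_def by (subst mem_sep) (intro dfn, auto)

lemma mem_collapses: "opair x y \<epsilon> collapses U \<longleftrightarrow> x \<epsilon> U \<and> y \<epsilon> U \<and> (\<exists>a f. a \<epsilon> x \<and> bijection f a y)"
  unfolding collapses_def by (subst mem_sep) (intro dfn, auto)

lemma mem_suprema: "opair s y \<epsilon> suprema U \<longleftrightarrow> maps s omega U \<and> y \<epsilon> U \<and> y = sups s"
  unfolding suprema_def by (subst mem_sep) (intro dfn, auto)

lemma mem_shiftings: "opair A s \<epsilon> shiftings U \<longleftrightarrow> A \<epsilon> U \<and> maps s omega U \<and> (\<exists>k. shifting U k A s)"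
  unfolding shiftings_def
  by (subst mem_sep, intro dfn definable_app3[of "\<lambda>s A k. shifting U k A s", OF definable_shifting], auto)

section \<open>The critical sequence of an embedding that fixes the coded relations\<close>

text \<open>Besides the coded relations the list in \<open>fixed\<close> contains the products they
  live in. \<open>Jopair\<close> applies only to pairs in \<open>N\<close>, and these products put a
  pair into \<open>N\<close> before it is known whether the relation holds.\<close>

context
  fixes \<zeta> \<delta> N J c
  assumes lim: "limit \<zeta>" and w\<zeta>: "omega \<epsilon> \<zeta>" and \<delta>\<zeta>: "\<delta> \<epsilon> \<zeta>"
    and N: "transitive N"
    and dJ: "definable_fun (\<lambda>s. J (s 0))"
    and JN: "\<And>x. x \<epsilon> N \<Longrightarrow> J x \<epsilon> N"
    and Jmem: "\<And>x y. x \<epsilon> N \<Longrightarrow> y \<epsilon> N \<Longrightarrow> J x \<epsilon> J y \<longleftrightarrow> x \<epsilon> y"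
    and Jeq: "\<And>x y. x \<epsilon> N \<Longrightarrow> y \<epsilon> N \<Longrightarrow> J x = J y \<longleftrightarrow> x = y"
    and Jopair: "\<And>x y. opair x y \<epsilon> N \<Longrightarrow> J (opair x y) = opair (J x) (J y)"
    and c\<delta>: "c \<epsilon> \<delta>" and Jc: "J c \<noteq> c" and Jb: "\<And>b. b \<epsilon> c \<Longrightarrow> J b = b"
    and fixed: "\<And>S. S = empty \<or> S = \<delta> \<or> S = V \<zeta> \<or> S = lam omega succ \<or> S = Asg (V \<zeta>) \<or>
      S = cart FM (Asg (V \<zeta>)) \<or> S = truths (V \<zeta>) \<or> S = cardinals \<delta> \<or>
      S = cart (V \<zeta>) (cart (V \<zeta>) (V \<zeta>)) \<or> S = bijections (V \<zeta>) \<or>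
      S = cart (V \<zeta>) (V \<zeta>) \<or> S = collapses (V \<zeta>) \<or> S = cart (Asg (V \<zeta>)) (V \<zeta>) \<or> S = suprema (V \<zeta>) \<or>
      S = cart (V \<zeta>) (Asg (V \<zeta>)) \<or> S = shiftings (V \<zeta>) \<Longrightarrow> S \<epsilon> N \<and> J S = S"
begin

abbreviation (input) U where "U \<equiv> V \<zeta>"

lemma o\<zeta>: "ordinal \<zeta>" by (rule limit_ordinal[OF lim])

lemma o\<delta>: "ordinal \<delta>" by (rule ordinal_elem[OF o\<zeta> \<delta>\<zeta>])

lemma N_trans: "x \<epsilon> N \<Longrightarrow> y \<epsilon> x \<Longrightarrow> y \<epsilon> N"
  using N unfolding transitive_def subset_def by blast

lemma U_N: "x \<epsilon> U \<Longrightarrow> x \<epsilon> N" using N_trans fixed by blast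

lemma \<delta>_U: "x \<epsilon> \<delta> \<Longrightarrow> x \<epsilon> U"
  using ordinal_mem_V[OF o\<zeta>] ordinal_trans[OF o\<zeta> \<delta>\<zeta>] by blast

lemma J_U: "x \<epsilon> U \<Longrightarrow> J x \<epsilon> U"
  using Jmem[of x U] U_N fixed[of U] by simp

lemma J_\<delta>: "x \<epsilon> \<delta> \<Longrightarrow> J x \<epsilon> \<delta>"
  using Jmem[of x \<delta>] U_N \<delta>_U fixed[of \<delta>] by simp

text \<open>The graph of the successor on omega is fixed as a set, so \<open>J\<close> carries each
  of its pairs to a pair in it. Starting from the fixed \<open>empty\<close>, every internal natural
  number is fixed.\<close>

lemma J_nat: "i \<epsilon> omega \<Longrightarrow> J i = i"
proof (rule omega_induct[where P = "\<lambda>i. J i = i"])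
  show "definable (\<lambda>s. J (s 0) = s 0)" by (intro dfn dJ)
  show "J empty = empty" using fixed by blast
  fix i assume i: "i \<epsilon> omega" "J i = i"
  have d: "definable_fun (\<lambda>s. succ (s 0))" by (intro dfn)
  have S: "lam omega succ \<epsilon> N" "J (lam omega succ) = lam omega succ" using fixed by blast+
  have p: "opair i (succ i) \<epsilon> lam omega succ" using i(1) by (simp add: mem_lam[OF d])
  have "J (opair i (succ i)) \<epsilon> lam omega succ"
    using Jmem[OF N_trans[OF S(1) p] S(1)] p S(2) by simp
  then show "J (succ i) = succ i"
    using Jopair[OF N_trans[OF S(1) p]] i by (simp add: mem_lam[OF d] del: mem_succ)
qed

lemma FM_U: "q \<epsilon> FM \<Longrightarrow> q \<epsilon> U"
  using FM_V V_mono[OF o\<zeta> w\<zeta>] subsetD by blast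

lemma J_opair: "opair x y \<epsilon> N \<Longrightarrow> J x = x \<Longrightarrow> J y = y \<Longrightarrow> J (opair x y) = opair x y"
  using Jopair by simp

text \<open>Codes are built from natural numbers by pairing, and all pairs met on the way lie in
  \<open>V \<zeta>\<close>, hence in \<open>N\<close>, where \<open>J\<close> commutes with
  pairing.\<close>

lemma J_FM: "q \<epsilon> FM \<Longrightarrow> J q = q"
proof (rule FM_induct[where P = "\<lambda>q. J q = q"])
  have n: "J (num m) = num m" for m using J_nat num_omega by blast
  have o: "J (opair (num m) x) = opair (num m) x" if "opair (num m) x \<epsilon> FM" "J x = x" for m x
    using J_opair[OF U_N[OF FM_U[OF that(1)]] n that(2)] .
  have o2: "J (opair x y) = opair x y" if "opair (num m) (opair x y) \<epsilon> FM" "J x = x" "J y = y" for m x y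
    using J_opair[OF U_N[OF opair_mem_VD(2)[OF lim FM_U[OF that(1)]]] that(2,3)] .
  show "definable (\<lambda>s. J (s 0) = s 0)" by (intro dfn dJ)
  show "J (cMem i j) = cMem i j" "J (cEq i j) = cEq i j" if "i \<epsilon> omega" "j \<epsilon> omega" for i j
    using FM_intros(1,2)[OF that] J_nat that unfolding cMem_def cEq_def by (blast intro: o o2)+
  show "J (cNeg q) = cNeg q" if "q \<epsilon> FM" "J q = q" for q
    using FM_intros(3)[OF that(1)] that unfolding cNeg_def by (blast intro: o)
  show "J (cAnd q r) = cAnd q r" if "q \<epsilon> FM" "r \<epsilon> FM" "J q = q" "J r = r" for q r
    using FM_intros(4)[OF that(1,2)] that unfolding cAnd_def by (blast intro: o o2)
  show "J (cEx i q) = cEx i q" if "i \<epsilon> omega" "q \<epsilon> FM" "J q = q" for i q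
    using FM_intros(5)[OF that(1,2)] that J_nat unfolding cEx_def by (blast intro: o o2)
qed

lemma Asg_N: "maps a omega U \<Longrightarrow> a \<epsilon> N"
  using N_trans[of "Asg U" a] fixed by simp

text \<open>The set of assignments is fixed and so are their indices; hence the image of an
  assignment is its composition with \<open>J\<close>.\<close>

lemma J_Asg:
  assumes a: "maps a omega U"
  shows "maps (J a) omega U" "\<And>i. i \<epsilon> omega \<Longrightarrow> app (J a) i = J (app a i)"
proof -
  have S: "Asg U \<epsilon> N" "J (Asg U) = Asg U" using fixed by blast+
  show m: "maps (J a) omega U" using Jmem[OF Asg_N[OF a] S(1)] a S(2) by simp
  fix i assume i: "i \<epsilon> omega"
  have p: "opair i (app a i) \<epsilon> a" by (rule function_app_mem[OF maps_function[OF a] i])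
  note pN = N_trans[OF Asg_N[OF a] p]
  have "opair i (J (app a i)) \<epsilon> J a"
    using Jmem[OF pN Asg_N[OF a]] p Jopair[OF pN] J_nat[OF i] by simp
  then show "app (J a) i = J (app a i)"
    using function_mem_iff[OF maps_function[OF m] i] by simp
qed

definition j_U where "j_U = lam U J"

lemma j_U_app: "x \<epsilon> U \<Longrightarrow> app j_U x = J x"
  unfolding j_U_def by (rule app_lam[OF dJ])

lemma j_U_function: "function_on j_U U"
  unfolding j_U_def by (rule function_on_lam[OF dJ])

lemma j_U_appd: "x \<epsilon> U \<Longrightarrow> appd j_U x = J x"
  using appd_eq_app[OF j_U_function] j_U_app by simp

text \<open>Since \<open>truths U\<close> and all codes are fixed, \<open>q\<close> holds at
  \<open>a\<close> exactly if it holds at \<open>J a\<close>, which is the composed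
  assignment.\<close>

lemma j_U_elementary: "elementary_embedding j_U U U"
  unfolding elementary_embedding_def is_fm_iff
proof (intro conjI allI impI)
  show "maps j_U U U" unfolding maps_def using j_U_function j_U_app J_U by simp
  fix q a assume "q \<epsilon> FM \<and> maps a omega U"
  then have q: "q \<epsilon> FM" and a: "maps a omega U" by blast+
  have eq: "lam omega (\<lambda>i. app j_U (app a i)) = J a"
  proof -
    have d: "definable_fun (\<lambda>s. J (appd a (s 0)))" by (intro definable_fun_compose[OF dJ] dfn)
    have "lam omega (\<lambda>i. app j_U (app a i)) = lam omega (\<lambda>i. J (appd a i))"
      by (rule lam_cong) (simp add: j_U_app maps_app[OF a] appd_eq_app[OF maps_function[OF a]])
    also have "\<dots> = J a"
      by (rule function_ext[OF function_on_lam[OF d] maps_function[OF J_Asg(1)[OF a]]])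
        (simp add: app_lam[OF d] J_Asg(2)[OF a] appd_eq_app[OF maps_function[OF a]])
    finally show ?thesis .
  qed
  have S: "cart FM (Asg U) \<epsilon> N" "truths U \<epsilon> N" "J (truths U) = truths U" using fixed by blast+
  have p: "opair q a \<epsilon> N" by (rule N_trans[OF S(1)]) (simp add: q a)
  have "opair q a \<epsilon> truths U \<longleftrightarrow> opair q (J a) \<epsilon> truths U"
    using Jmem[OF p S(2)] S(3) Jopair[OF p] J_FM[OF q] by simp
  then show "satisfies U q a \<longleftrightarrow> satisfies U q (lam omega (\<lambda>i. app j_U (app a i)))"
    unfolding eq mem_truths using q a J_Asg(1)[OF a] by simp
qed

lemma oc: "ordinal c" by (rule ordinal_elem[OF o\<delta> c\<delta>])

text \<open>A value below \<open>c\<close> would itself be fixed, against injectivity and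
  \<open>J c\<close> being different from \<open>c\<close>.\<close>

lemma c_less: "c \<epsilon> J c"
proof -
  have "ordinal (J c)" by (rule ordinal_elem[OF o\<delta> J_\<delta>[OF c\<delta>]])
  moreover have "\<not> J c \<epsilon> c"
  proof
    assume "J c \<epsilon> c"
    then have "J (J c) = J c" by (rule Jb)
    then show False using Jeq[OF JN, of c c] Jc U_N[OF \<delta>_U[OF c\<delta>]] \<open>J c \<epsilon> c\<close> Jmem mem_irrefl
      by (metis)
  qed
  ultimately show ?thesis using ordinal_linear[OF oc] Jc by metis
qed

lemma c_not_image:
  assumes y: "ordinal y" "y \<epsilon> U"
  shows "J y \<noteq> c"
proof
  assume e: "J y = c"
  have cN: "c \<epsilon> N" using U_N[OF \<delta>_U[OF c\<delta>]] .
  have "y \<epsilon> J y \<Longrightarrow> False" using Jb e by (metis mem_irrefl)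
  moreover have "y \<noteq> c" using e Jc by auto
  ultimately have "c \<epsilon> y" using ordinal_linear[OF y(1) oc] e by blast
  then have "J c \<epsilon> c" using Jmem[OF cN U_N[OF y(2)]] e by simp
  then show False using mem_asym[OF c_less] by blast
qed

text \<open>Since \<open>a\<close> and its elements are fixed, the image of \<open>f\<close> maps
  \<open>a\<close> onto \<open>J l\<close> and takes only values of the form
  \<open>J (app f x)\<close>. But \<open>c\<close> is in \<open>J l\<close> and is not the image of
  an ordinal. This is applied with \<open>l\<close> being \<open>c\<close> and with \<open>l\<close>
  being the supremum of the critical sequence.\<close>

lemma no_collapse:
  assumes f: "bijection f a l" and a: "a \<epsilon> c" and l: "ordinal l" "l \<epsilon> U" "c \<epsilon> J l"
  shows False
proof -
  have aU: "a \<epsilon> U" using \<delta>_U[OF ordinal_trans[OF o\<delta> c\<delta> a]] .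
  have m: "maps f a l" using f unfolding bijection_def by blast
  have fU: "f \<epsilon> U"
  proof (rule relation_mem_V[OF lim aU l(2)])
    fix p assume "p \<epsilon> f"
    then obtain x where "x \<epsilon> a" "p = opair x (app f x)" using function_memE[OF maps_function[OF m]] by blast
    then show "\<exists>u v. u \<epsilon> a \<and> v \<epsilon> l \<and> p = opair u v" using maps_app[OF m] by blast
  qed
  have S: "cart U (cart U U) \<epsilon> N" "bijections U \<epsilon> N" "J (bijections U) = bijections U" using fixed by blast+
  have p: "opair f (opair a l) \<epsilon> N" by (rule N_trans[OF S(1)]) (simp add: fU aU l)
  have "opair f (opair a l) \<epsilon> bijections U" using f fU aU l by (simp add: mem_bijections)
  then have "J (opair f (opair a l)) \<epsilon> bijections U" using Jmem[OF p S(2)] S(3) by simp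
  then have Jf: "bijection (J f) a (J l)"
    using Jopair[OF p] Jopair[OF transitive_opair(2)[OF N p]] Jb[OF a] by (simp add: mem_bijections)
  then obtain x where x: "x \<epsilon> a" "app (J f) x = c" using l(3) unfolding bijection_def by blast
  have "opair x (app f x) \<epsilon> f" by (rule function_app_mem[OF maps_function[OF m] x(1)])
  moreover from this have pN: "opair x (app f x) \<epsilon> N" using N_trans U_N[OF fU] by blast
  ultimately have "opair x (J (app f x)) \<epsilon> J f"
    using Jmem[OF pN U_N[OF fU]] Jopair[OF pN] Jb[OF ordinal_trans[OF oc a x(1)]] by simp
  moreover have "function_on (J f) a" using Jf unfolding bijection_def maps_def by blast
  ultimately have "J (app f x) = c" using function_mem_iff x by metis
  moreover have "app f x \<epsilon> l" by (rule maps_app[OF m x(1)])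
  ultimately show False
    using c_not_image[OF ordinal_elem[OF l(1)]] V_transitive[OF o\<zeta> l(2)] by blast
qed

lemma cardinal_c: "cardinal c"
  unfolding cardinal_def using oc no_collapse[OF _ _ oc \<delta>_U[OF c\<delta>] c_less] by blast

section \<open>Cardinality along the critical sequence and at its supremum\<close>

definition crit_seq where "crit_seq = nrec c J"

lemma definable_crit_seq: "definable_fun f \<Longrightarrow> definable_fun (\<lambda>s. crit_seq (f s))"
  unfolding crit_seq_def by (rule definable_nrec[OF dJ])

lemma crit_seq_empty: "crit_seq empty = c"
  unfolding crit_seq_def by (rule nrec_empty[OF dJ])

lemma crit_seq_succ: "m \<epsilon> omega \<Longrightarrow> crit_seq (succ m) = J (crit_seq m)"
  unfolding crit_seq_def by (rule nrec_succ[OF dJ])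

text \<open>Being a cardinal passes along the sequence because the set of cardinals below \<delta>
  is fixed; no formula is evaluated in \<open>N\<close>.\<close>

lemma crit_seq_cardinals: "m \<epsilon> omega \<Longrightarrow> crit_seq m \<epsilon> cardinals \<delta>"
proof (rule omega_induct[where P = "\<lambda>m. crit_seq m \<epsilon> cardinals \<delta>"])
  show "definable (\<lambda>s. crit_seq (s 0) \<epsilon> cardinals \<delta>)" by (intro dfn definable_crit_seq)
  show "crit_seq empty \<epsilon> cardinals \<delta>" by (simp add: crit_seq_empty mem_cardinals c\<delta> cardinal_c)
  fix m assume m: "m \<epsilon> omega" "crit_seq m \<epsilon> cardinals \<delta>"
  have S: "cardinals \<delta> \<epsilon> N" "J (cardinals \<delta>) = cardinals \<delta>" using fixed by blast+
  show "crit_seq (succ m) \<epsilon> cardinals \<delta>"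
    using Jmem[OF N_trans[OF S(1) m(2)] S(1)] m S(2) by (simp add: crit_seq_succ)
qed

lemma crit_seq_\<delta>: "m \<epsilon> omega \<Longrightarrow> crit_seq m \<epsilon> \<delta>"
  using crit_seq_cardinals mem_cardinals by blast

lemma crit_seq_U: "m \<epsilon> omega \<Longrightarrow> crit_seq m \<epsilon> U"
  using crit_seq_\<delta> \<delta>_U by blast

lemma crit_seq_ordinal: "m \<epsilon> omega \<Longrightarrow> ordinal (crit_seq m)"
  using crit_seq_\<delta> ordinal_elem[OF o\<delta>] by blast

lemma crit_seq_less_succ: "m \<epsilon> omega \<Longrightarrow> crit_seq m \<epsilon> crit_seq (succ m)"
proof (rule omega_induct[where P = "\<lambda>m. crit_seq m \<epsilon> crit_seq (succ m)"])
  show "definable (\<lambda>s. crit_seq (s 0) \<epsilon> crit_seq (succ (s 0)))" by (intro dfn definable_crit_seq)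
  show "crit_seq empty \<epsilon> crit_seq (succ empty)" by (simp add: crit_seq_succ crit_seq_empty c_less)
  fix m assume m: "m \<epsilon> omega" "crit_seq m \<epsilon> crit_seq (succ m)"
  note s = succ_omega[OF m(1)]
  show "crit_seq (succ m) \<epsilon> crit_seq (succ (succ m))"
    using Jmem[OF U_N[OF crit_seq_U[OF m(1)]] U_N[OF crit_seq_U[OF s]]] m(2)
    unfolding crit_seq_succ[OF m(1), symmetric] crit_seq_succ[OF s, symmetric] by simp
qed

lemma crit_seq_mono:
  assumes "n \<epsilon> omega"
  shows "\<forall>m. m \<epsilon> n \<longrightarrow> crit_seq m \<epsilon> crit_seq n"
  using assms
proof (rule omega_induct[where P = "\<lambda>n. \<forall>m. m \<epsilon> n \<longrightarrow> crit_seq m \<epsilon> crit_seq n"])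
  show "definable (\<lambda>s. \<forall>m. m \<epsilon> s 0 \<longrightarrow> crit_seq m \<epsilon> crit_seq (s 0))" by (intro dfn definable_crit_seq)
  fix n assume n: "n \<epsilon> omega" "\<forall>m. m \<epsilon> n \<longrightarrow> crit_seq m \<epsilon> crit_seq n"
  then show "\<forall>m. m \<epsilon> succ n \<longrightarrow> crit_seq m \<epsilon> crit_seq (succ n)"
    using crit_seq_less_succ[OF n(1)] ordinal_trans[OF crit_seq_ordinal[OF succ_omega[OF n(1)]]] by auto
qed simp

definition crit_fun where "crit_fun = lam omega crit_seq"

definition crit_sup where "crit_sup = sups crit_fun"

lemma maps_crit_fun: "maps crit_fun omega U"
  unfolding maps_def crit_fun_def
  by (simp add: function_on_lam app_lam definable_crit_seq definable_fun_var crit_seq_U)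

lemma appd_crit_fun: "m \<epsilon> omega \<Longrightarrow> appd crit_fun m = crit_seq m"
  unfolding crit_fun_def
  by (simp add: appd_eq_app[of _ omega] function_on_lam app_lam definable_crit_seq definable_fun_var)

lemma mem_crit_sup: "x \<epsilon> crit_sup \<longleftrightarrow> (\<exists>m. m \<epsilon> omega \<and> x \<epsilon> crit_seq m)"
  unfolding crit_sup_def mem_sups using appd_crit_fun by auto

lemma crit_seq_mem_sup: "m \<epsilon> omega \<Longrightarrow> crit_seq m \<epsilon> crit_sup"
  unfolding mem_crit_sup using crit_seq_less_succ succ_omega by blast

lemma ordinal_crit_sup: "ordinal crit_sup"
proof -
  have "definable_fun (\<lambda>s. appd crit_fun (s 0))" by (intro dfn)
  then show ?thesis
    unfolding crit_sup_def sups_def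
    by (intro ordinal_bigcup) (auto simp: mem_repl appd_crit_fun crit_seq_ordinal)
qed

lemma crit_sup_mem: "crit_sup \<epsilon> \<zeta>"
proof -
  \<comment> \<open>The supremum may be \<delta> itself; it is below \<zeta> in either case.\<close>
  have "subset crit_sup \<delta>"
    unfolding subset_def mem_crit_sup using crit_seq_\<delta> ordinal_trans[OF o\<delta>] by blast
  then show ?thesis
    using ordinal_subset_iff[OF ordinal_crit_sup o\<delta>] \<delta>\<zeta> ordinal_trans[OF o\<zeta> \<delta>\<zeta>] by blast
qed

lemma crit_sup_U: "crit_sup \<epsilon> U"
  by (rule ordinal_mem_V[OF o\<zeta> crit_sup_mem])

text \<open>As the indices are fixed, applying \<open>J\<close> to the sequence as a set applies it
  to every term, which is a shift by one.\<close>

lemma appd_J_crit_fun: "m \<epsilon> omega \<Longrightarrow> appd (J crit_fun) m = crit_seq (succ m)"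
  using appd_eq_app[OF maps_function[OF J_Asg(1)[OF maps_crit_fun]]] J_Asg(2)[OF maps_crit_fun]
    appd_eq_app[OF maps_function[OF maps_crit_fun]] appd_crit_fun crit_seq_succ by simp

lemma sups_J_crit_fun: "sups (J crit_fun) = crit_sup"
proof (rule extensionality, intro allI)
  fix x
  have "x \<epsilon> crit_seq (succ m)" if "m \<epsilon> omega" "x \<epsilon> crit_seq m" for m
    using ordinal_trans[OF crit_seq_ordinal[OF succ_omega] crit_seq_less_succ] that by blast
  then show "x \<epsilon> sups (J crit_fun) \<longleftrightarrow> x \<epsilon> crit_sup"
    unfolding mem_sups mem_crit_sup using appd_J_crit_fun succ_omega by metis
qed

text \<open>The coded supremum relation is fixed, so the image of the supremum is the supremum of
  the shifted sequence, which has the same value.\<close>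

lemma J_crit_sup: "J crit_sup = crit_sup"
proof -
  have S: "cart (Asg U) U \<epsilon> N" "suprema U \<epsilon> N" "J (suprema U) = suprema U" using fixed by blast+
  have p: "opair crit_fun crit_sup \<epsilon> N"
    by (rule N_trans[OF S(1)]) (simp add: maps_crit_fun crit_sup_U)
  have "opair crit_fun crit_sup \<epsilon> suprema U"
    by (simp add: mem_suprema maps_crit_fun crit_sup_U crit_sup_def[symmetric])
  then have "J (opair crit_fun crit_sup) \<epsilon> suprema U" using Jmem[OF p S(2)] S(3) by simp
  then show ?thesis by (simp add: Jopair[OF p] mem_suprema sups_J_crit_fun)
qed

text \<open>The critical point \<open>c\<close> is sent to \<open>J c\<close>, the first term of the
  shifted sequence. That is why the embedding testifies for the shift and not for
  \<open>crit_fun\<close> itself.\<close>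

lemma shifting_J: "A \<epsilon> U \<Longrightarrow> shifting U j_U (J A) (J crit_fun)"
  unfolding shifting_def
proof (intro conjI allI impI j_U_elementary)
  assume A: "A \<epsilon> U"
  show "\<exists>x. x \<epsilon> U \<and> appd j_U x = J A" using A j_U_appd by blast
  show "appd j_U (appd (J crit_fun) m) = appd (J crit_fun) (succ m)" if "m \<epsilon> omega" for m
    unfolding appd_J_crit_fun[OF that] appd_J_crit_fun[OF succ_omega[OF that]]
      crit_seq_succ[OF succ_omega[OF that]] by (rule j_U_appd[OF crit_seq_U[OF succ_omega[OF that]]])
  show "appd j_U (sups (J crit_fun)) = sups (J crit_fun)"
    by (simp add: sups_J_crit_fun j_U_appd crit_sup_U J_crit_sup)
  have "b \<epsilon> U" if "b \<epsilon> c" for b using \<delta>_U[OF ordinal_trans[OF o\<delta> c\<delta> that]] .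
  then show "\<exists>x. ordinal x \<and> x \<epsilon> U \<and> x \<epsilon> appd (J crit_fun) empty \<and>
      appd j_U x = appd (J crit_fun) empty \<and> (\<forall>b. b \<epsilon> x \<longrightarrow> appd j_U b = b)"
    using \<delta>_U[OF c\<delta>]
    by (intro exI[of _ c]) (simp add: oc appd_J_crit_fun crit_seq_succ crit_seq_empty c_less j_U_appd Jb)
qed

text \<open>If \<open>A\<close> had no such embedding for the critical sequence, then by elementarity \<open>J A\<close> would have none
  for its shift; but \<open>J\<close> itself is one.\<close>

lemma ex_shifting:
  assumes A: "A \<epsilon> U"
  shows "\<exists>k. shifting U k A crit_fun"
proof -
  have S: "cart U (Asg U) \<epsilon> N" "shiftings U \<epsilon> N" "J (shiftings U) = shiftings U" using fixed by blast+
  have p: "opair A crit_fun \<epsilon> N" by (rule N_trans[OF S(1)]) (simp add: A maps_crit_fun)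
  have "opair (J A) (J crit_fun) \<epsilon> shiftings U"
    using J_U[OF A] J_Asg(1)[OF maps_crit_fun] shifting_J[OF A] unfolding mem_shiftings by blast
  then have "opair A crit_fun \<epsilon> shiftings U" using Jmem[OF p S(2)] Jopair[OF p] S(3) by simp
  then show ?thesis unfolding mem_shiftings by blast
qed

text \<open>A bijection from below some term gives a pair in \<open>collapses U\<close>. As
  \<open>J\<close> fixes the supremum and moves each term to the next, membership of that pair
  descends from each term to its predecessor and finally to \<open>c\<close>, where
  \<open>no_collapse\<close> applies.\<close>

lemma cardinal_crit_sup: "cardinal crit_sup"
  unfolding cardinal_def
proof (intro conjI allI impI notI ordinal_crit_sup, elim exE)
  fix a f assume a: "a \<epsilon> crit_sup" and f: "bijection f a crit_sup"
  have S: "cart U U \<epsilon> N" "collapses U \<epsilon> N" "J (collapses U) = collapses U" using fixed by blast+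
  obtain m where m: "m \<epsilon> omega" "a \<epsilon> crit_seq m" using a mem_crit_sup by blast
  have "opair (crit_seq m) crit_sup \<epsilon> collapses U \<longrightarrow> opair c crit_sup \<epsilon> collapses U"
    using m(1)
  proof (rule omega_induct[where P = "\<lambda>m. opair (crit_seq m) crit_sup \<epsilon> collapses U \<longrightarrow> opair c crit_sup \<epsilon> collapses U"])
    show "definable (\<lambda>s. opair (crit_seq (s 0)) crit_sup \<epsilon> collapses U \<longrightarrow> opair c crit_sup \<epsilon> collapses U)"
      by (intro dfn definable_crit_seq)
    fix m assume m: "m \<epsilon> omega"
      and IH: "opair (crit_seq m) crit_sup \<epsilon> collapses U \<longrightarrow> opair c crit_sup \<epsilon> collapses U"
    have p: "opair (crit_seq m) crit_sup \<epsilon> N"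
      by (rule N_trans[OF S(1)]) (simp add: crit_seq_U[OF m] crit_sup_U)
    have "J (opair (crit_seq m) crit_sup) = opair (crit_seq (succ m)) crit_sup"
      by (simp add: Jopair[OF p] crit_seq_succ[OF m] J_crit_sup)
    then show "opair (crit_seq (succ m)) crit_sup \<epsilon> collapses U \<longrightarrow> opair c crit_sup \<epsilon> collapses U"
      using Jmem[OF p S(2)] S(3) IH by simp
  qed (simp add: crit_seq_empty)
  moreover have "opair (crit_seq m) crit_sup \<epsilon> collapses U"
    unfolding mem_collapses using crit_seq_U[OF m(1)] crit_sup_U m(2) f by blast
  ultimately obtain b g where "b \<epsilon> c" "bijection g b crit_sup" unfolding mem_collapses by blast
  moreover have "c \<epsilon> J crit_sup"
    using crit_seq_mem_sup[OF empty_omega] by (simp add: J_crit_sup crit_seq_empty)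
  ultimately show False using no_collapse[OF _ _ ordinal_crit_sup crit_sup_U] by blast
qed

lemma limit_cardinal_crit_sup: "limit_cardinal crit_sup"
  unfolding limit_cardinal_def
proof (intro conjI allI impI cardinal_crit_sup)
  show "crit_sup \<noteq> empty" using crit_seq_mem_sup[OF empty_omega] by auto
  fix a assume "a \<epsilon> crit_sup"
  then obtain m where "m \<epsilon> omega" "a \<epsilon> crit_seq m" using mem_crit_sup by blast
  then show "\<exists>x. cardinal x \<and> a \<epsilon> x \<and> x \<epsilon> crit_sup"
    using crit_seq_cardinals crit_seq_mem_sup mem_cardinals by blast
qed

text \<open>Both stages in the definition of ultraexactness are taken at \<zeta>, with
  \<open>X\<close> being \<open>U\<close> itself. The critical point \<open>x\<close> of
  \<open>k\<close> lies below \<open>c\<close>, hence below the supremum, which makes the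
  restriction nontrivial.\<close>

lemma ultraexact_if_shifting:
  assumes ex: "C n \<zeta>" "C (n + 1) \<zeta>" and k: "shifting U k A crit_fun"
  shows "ultraexact_embedding n crit_sup U \<zeta> k"
    and "\<exists>x. x \<epsilon> U \<and> app k x = A"
    and "m \<epsilon> omega \<Longrightarrow> app k (crit_seq m) = crit_seq (succ m)"
    and "\<exists>x. is_crit k U x \<and> app k x = c"
proof -
  have emb: "elementary_embedding k U U" using k unfolding shifting_def by blast
  note kf = emb_function[OF emb]
  note ap = appd_eq_app[OF kf]
  show "\<exists>x. x \<epsilon> U \<and> app k x = A" using k ap unfolding shifting_def by metis
  show "app k (crit_seq m) = crit_seq (succ m)" if "m \<epsilon> omega"
    using k that appd_crit_fun[OF that] appd_crit_fun[OF succ_omega[OF that]] ap[OF crit_seq_U[OF that]]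
    unfolding shifting_def by metis
  obtain x where x: "ordinal x" "x \<epsilon> U" "x \<epsilon> c" "app k x = c" "\<And>b. b \<epsilon> x \<Longrightarrow> app k b = b"
  proof -
    obtain x where x: "ordinal x" "x \<epsilon> U" "x \<epsilon> c" "appd k x = c" "\<forall>b. b \<epsilon> x \<longrightarrow> appd k b = b"
      using k appd_crit_fun[OF empty_omega] unfolding shifting_def crit_seq_empty by auto
    then show thesis using that[of x] ap V_transitive[OF o\<zeta> x(2)] by metis
  qed
  have "is_crit k U x" unfolding is_crit_def using x by auto
  then show "\<exists>x. is_crit k U x \<and> app k x = c" using x(4) by blast
  have xl: "x \<epsilon> crit_sup"
    unfolding mem_crit_sup using x(3) crit_seq_empty empty_omega by metis
  have kl: "app k crit_sup = crit_sup"
    using k ap[OF crit_sup_U] unfolding shifting_def crit_sup_def[symmetric] by simp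
  have "restriction k crit_sup \<noteq> lam crit_sup (\<lambda>x. x)"
  proof
    assume "restriction k crit_sup = lam crit_sup (\<lambda>x. x)"
    moreover have "opair x (app k x) \<epsilon> restriction k crit_sup"
      unfolding mem_restriction using function_app_mem[OF kf x(2)] xl by blast
    ultimately have "app k x = x" by (simp add: mem_lam definable_fun_var)
    then show False using x(3,4) by simp
  qed
  moreover have "restriction k (V crit_sup) \<epsilon> U"
  proof -
    \<comment> \<open>The restriction relates two elements of \<open>U\<close>, namely
      \<open>V crit_sup\<close> and its image under \<open>k\<close>, so it lies in the limit
      stage.\<close>
    have v: "V crit_sup \<epsilon> U" by (rule V_mem_V[OF o\<zeta> crit_sup_mem])
    show ?thesis
    proof (rule relation_mem_V[OF lim v emb_app[OF emb v]])
      fix p assume "p \<epsilon> restriction k (V crit_sup)"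
      then obtain u y where u: "u \<epsilon> V crit_sup" "p = opair u y" "p \<epsilon> k" unfolding mem_restriction by blast
      have uU: "u \<epsilon> U" by (rule V_transitive[OF o\<zeta> v u(1)])
      have "p = opair u (app k u)" using u function_mem_iff[OF kf uU] by simp
      then show "\<exists>x y. x \<epsilon> V crit_sup \<and> y \<epsilon> app k (V crit_sup) \<and> p = opair x y"
        using u(1) emb_mem[OF emb uU v] by blast
    qed
  qed
  moreover have "elementary_submodel U (Vset \<zeta>)"
    unfolding elementary_submodel_def Vset_eq[OF o\<zeta>] by simp
  moreover have "subset (V crit_sup) U" by (rule V_mono[OF o\<zeta> crit_sup_mem])
  ultimately show "ultraexact_embedding n crit_sup U \<zeta> k"
    unfolding ultraexact_embedding_def Vset_eq[OF ordinal_crit_sup]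
    using limit_cardinal_crit_sup ex crit_sup_mem crit_sup_U emb kl Vset_eq[OF o\<zeta>] by auto
qed

lemma parametrically_ultraexact_crit:
  assumes ex: "C n \<zeta>" "C (n + 1) \<zeta>"
  shows "cardinal c \<and> (\<exists>\<mu>. (\<forall>m. m \<epsilon> omega \<longrightarrow> app \<mu> m \<epsilon> \<delta>) \<and> parametrically_ultraexact n c \<mu>)"
proof -
  \<comment> \<open>The sequence starts one step late: term 0 of the critical sequence is \<kappa>,
    and \<open>\<mu>\<^sub>m\<close> is term \<open>m+1\<close>.\<close>
  define \<mu> where "\<mu> = lam omega (\<lambda>m. crit_seq (succ m))"
  have d: "definable_fun (\<lambda>s. crit_seq (succ (s 0)))" by (intro dfn definable_crit_seq)
  have \<mu>: "app \<mu> m = crit_seq (succ m)" if "m \<epsilon> omega" for m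
    unfolding \<mu>_def by (rule app_lam[OF d that])
  have "increasing_cardinals \<mu>"
    unfolding increasing_cardinals_def
  proof (intro conjI allI impI)
    show "function_on \<mu> omega" unfolding \<mu>_def by (rule function_on_lam[OF d])
    show "cardinal (app \<mu> m)" if "m \<epsilon> omega" for m
      using crit_seq_cardinals[OF succ_omega[OF that]] \<mu>[OF that] mem_cardinals by simp
    fix m m' assume "m' \<epsilon> omega \<and> m \<epsilon> m'"
    then have m: "m' \<epsilon> omega" "m \<epsilon> m'" "m \<epsilon> omega" using mem_nat_omega by blast+
    have "subset (succ m) m'" unfolding subset_def using m(2) ordinal_trans[OF ordinal_nat[OF m(1)] m(2)] by auto
    then have "succ m \<epsilon> succ m'"
      using ordinal_subset_iff[OF ordinal_nat[OF succ_omega[OF m(3)]] ordinal_nat[OF m(1)]] by auto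
    then show "app \<mu> m \<epsilon> app \<mu> m'"
      using crit_seq_mono[OF succ_omega[OF m(1)]] unfolding \<mu>[OF m(1)] \<mu>[OF m(3)] by blast
  qed
  moreover have sup: "seq_sup \<mu> = crit_sup"
    unfolding seq_sup_def
  proof (rule coll_eq, intro allI)
    show "x \<epsilon> crit_sup \<longleftrightarrow> (\<exists>m. m \<epsilon> omega \<and> x \<epsilon> app \<mu> m)" for x
      using mem_sups[of x "J crit_fun"] appd_J_crit_fun \<mu> unfolding sups_J_crit_fun by auto
  qed
  moreover have "c \<epsilon> app \<mu> empty"
    using \<mu>[OF empty_omega] crit_seq_less_succ[OF empty_omega] by (simp add: crit_seq_empty)
  moreover have "\<exists>X z k. ultraexact_embedding n crit_sup X z k \<and> (\<exists>x. x \<epsilon> X \<and> app k x = A) \<and>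
      app k c = app \<mu> empty \<and> (\<forall>m. m \<epsilon> omega \<longrightarrow> app k (app \<mu> m) = app \<mu> (succ m)) \<and>
      (\<exists>x. is_crit k X x \<and> app k x = c)" if A: "A \<epsilon> Vset (succ crit_sup)" for A
  proof -
    \<comment> \<open>As \<zeta> is a limit above the supremum, every parameter in the next stage is
      an element of \<open>U\<close>.\<close>
    have s: "succ crit_sup \<epsilon> \<zeta>" using lim crit_sup_mem unfolding limit_def by blast
    then have "A \<epsilon> U"
      using A V_mono[OF o\<zeta> s] subsetD Vset_eq[OF ordinal_succ[OF ordinal_crit_sup]] by auto
    then obtain k where k: "shifting U k A crit_fun" using ex_shifting by blast
    note u = ultraexact_if_shifting[OF ex k]
    show ?thesis
      using u(1,2,4) u(3)[OF empty_omega] u(3)[OF succ_omega] \<mu> succ_omega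
      by (intro exI[of _ U] exI[of _ \<zeta>] exI[of _ k]) (simp add: crit_seq_empty)
  qed
  ultimately have "parametrically_ultraexact n c \<mu>"
    unfolding parametrically_ultraexact_def using cardinal_c by simp
  then show ?thesis using cardinal_c \<mu> crit_seq_\<delta> succ_omega by metis
qed

end

theorem berkeley_parametrically_ultraexact:
  assumes \<delta>: "berkeley \<delta>" and \<alpha>: "\<alpha> \<epsilon> \<delta>"
  shows "\<exists>\<kappa>. cardinal \<kappa> \<and> \<alpha> \<epsilon> \<kappa> \<and> \<kappa> \<epsilon> \<delta> \<and>
    (\<exists>\<mu>. (\<forall>m. m \<epsilon> omega \<longrightarrow> app \<mu> m \<epsilon> \<delta>) \<and> parametrically_ultraexact n \<kappa> \<mu>)"
proof -
  have "ordinal \<delta>" using \<delta> unfolding berkeley_def by blast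
  \<comment> \<open>Both \<open>C n\<close> and \<open>C (n + 1)\<close> are required of the same
    \<zeta>, and \<open>C\<close> is stated level by level, so all levels up to \<open>n + 1\<close>
    are taken together.\<close>
  then obtain \<zeta> where \<zeta>: "limit \<zeta>" "\<delta> \<epsilon> \<zeta>" "omega \<epsilon> \<zeta>" and ex: "\<And>m. m \<le> n + 1 \<Longrightarrow> C m \<zeta>"
    using ex_correct_cardinal[of \<delta> "n + 1"] by blast
  let ?U = "V \<zeta>"
  \<comment> \<open>The tuple is a right-nested pair ending in \<open>empty\<close>. A transitive
    set containing it contains every component, and a map that fixes it and commutes with pairing
    fixes every component.\<close>
  define Ss where "Ss = [empty, \<delta>, ?U, lam omega succ, Asg ?U, cart FM (Asg ?U), truths ?U, cardinals \<delta>,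
    cart ?U (cart ?U ?U), bijections ?U, cart ?U ?U, collapses ?U, cart (Asg ?U) ?U, suprema ?U,
    cart ?U (Asg ?U), shiftings ?U]"
  define a where "a = foldr opair Ss empty"
  obtain N where N: "transitive N" "a \<epsilon> N" using ex_transitive by blast
  have inN: "\<forall>S\<in>set Ss'. S \<epsilon> N" if "foldr opair Ss' empty \<epsilon> N" for Ss'
    using that by (induction Ss') (auto dest: transitive_opair[OF N(1)])
  have SN: "S \<epsilon> N" if "S \<in> set Ss" for S using inN[of Ss] N(2) that unfolding a_def by blast
  have \<delta>N: "\<delta> \<epsilon> N" by (rule SN) (simp add: Ss_def)
  obtain J c where J: "definable_fun (\<lambda>s. J (s 0))"
    "\<And>x. x \<epsilon> N \<Longrightarrow> J x \<epsilon> N"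
    "\<And>x y. x \<epsilon> N \<Longrightarrow> y \<epsilon> N \<Longrightarrow> J x \<epsilon> J y \<longleftrightarrow> x \<epsilon> y"
    "\<And>x y. x \<epsilon> N \<Longrightarrow> y \<epsilon> N \<Longrightarrow> J x = J y \<longleftrightarrow> x = y"
    "\<And>x y. opair x y \<epsilon> N \<Longrightarrow> J (opair x y) = opair (J x) (J y)"
    "J a = a" "\<alpha> \<epsilon> c" "c \<epsilon> \<delta>" "J c \<noteq> c" "\<And>b. b \<epsilon> c \<Longrightarrow> J b = b"
    by (rule berkeley_fixing[OF \<delta> N(1) \<delta>N N(2) \<alpha>], rule that)
  have fx: "\<forall>S\<in>set Ss'. J S = S"
    if "foldr opair Ss' empty \<epsilon> N" "J (foldr opair Ss' empty) = foldr opair Ss' empty" for Ss'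
    using that
  proof (induction Ss')
    case (Cons S Ss')
    let ?t = "foldr opair Ss' empty"
    have p: "opair S ?t \<epsilon> N" "J (opair S ?t) = opair S ?t" using Cons.prems by simp_all
    have "J S = S" "J ?t = ?t" using J(5)[OF p(1)] p(2) by (simp_all only: opair_inject)
    then show ?case using Cons.IH transitive_opair(2)[OF N(1) p(1)] by (simp only: list.set) blast
  qed simp
  have fixed: "S \<epsilon> N \<and> J S = S" if "S \<in> set Ss" for S
    using SN[OF that] fx[of Ss] N(2) J(6) that unfolding a_def by blast
  have "cardinal c \<and> (\<exists>\<mu>. (\<forall>m. m \<epsilon> omega \<longrightarrow> app \<mu> m \<epsilon> \<delta>) \<and> parametrically_ultraexact n c \<mu>)"
  proof (rule parametrically_ultraexact_crit[OF \<zeta>(1,3,2) N(1) J(1-5,8-10) _ ex ex])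
    fix S
    assume "S = empty \<or> S = \<delta> \<or> S = V \<zeta> \<or> S = lam omega succ \<or> S = Asg (V \<zeta>) \<or>
      S = cart FM (Asg (V \<zeta>)) \<or> S = truths (V \<zeta>) \<or> S = cardinals \<delta> \<or>
      S = cart (V \<zeta>) (cart (V \<zeta>) (V \<zeta>)) \<or> S = bijections (V \<zeta>) \<or>
      S = cart (V \<zeta>) (V \<zeta>) \<or> S = collapses (V \<zeta>) \<or> S = cart (Asg (V \<zeta>)) (V \<zeta>) \<or> S = suprema (V \<zeta>) \<or>
      S = cart (V \<zeta>) (Asg (V \<zeta>)) \<or> S = shiftings (V \<zeta>)"
    then show "S \<epsilon> N \<and> J S = S" by (intro fixed) (simp add: Ss_def)
  qed simp_all
  then show ?thesis using J(7,8) by blast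
qed

end

theorem theorem5p8:
  fixes E :: "'a \<Rightarrow> 'a \<Rightarrow> bool" and n :: nat and \<delta> :: 'a
  assumes "zf_model E"
    and "n > 0"
    and "set_structure.berkeley E \<delta>"
  shows "\<forall>\<alpha>. E \<alpha> \<delta> \<longrightarrow>
    (\<exists>\<kappa>. set_structure.cardinal E \<kappa> \<and> E \<alpha> \<kappa> \<and> E \<kappa> \<delta> \<and>
      (\<exists>\<mu>. (\<forall>m. E m (set_structure.omega E) \<longrightarrow> E (set_structure.app E \<mu> m) \<delta>) \<and>
           set_structure.parametrically_ultraexact E n \<kappa> \<mu>))"
  using zf_model.berkeley_parametrically_ultraexact[OF assms(1,3)] by blast

end
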